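(* For every real $p\ge 2$ there exists a finite constant $C(p)$, depending only on $p$, such that for every integer $n\ge 3$, every real $\alpha$ with $$\frac{\log^2 n}{n}\le\alpha\le\frac{n}{\log^2 n},$$ and every $z\in\mathbb{R}$, $$\left|\mathbb{P}_\alpha(W_{n,\alpha}\le z)-\Phi(z)\right|\le\frac{C(p)}{(1+|z|)^p\sqrt{n}},$$ where $$W_{n,\alpha}=W_{n,\alpha}(\lambda)=\frac{\sum_i\left(\alpha\binom{\lambda_i}{2}-\binom{\lambda_i'}{2}\right)}{\sqrt{\alpha\binom{n}{2}}}$$ and $\lambda$ is a random partition of $n$ chosen from the Jack$_\alpha$ measure $\mathbb{P}_\alpha$.
   Context: Let $\mathcal{P}_n$ be the set of all partitions of the positive integer $n$, identified with their Young diagrams. For $\alpha>0$ the Jack$_\alpha$ measure on $\mathcal{P}_n$ is the probability measure $$\mathbb{P}_\alpha(\lambda)=\frac{\alpha^n n!}{\prod_{s\in\lambda}(\alpha a(s)+l(s)+1)(\alpha a(s)+l(s)+\alpha)},\qquad\lambda\in\mathcal{P}_n,$$ where the product is over all boxes $s$ of the diagram of $\lambda$, $a(s)$ (the arm) is the number of boxes in the same row as $s$ and to the right of $s$, and $l(s)$ (the leg) is the number of boxes in the same column as $s$ and below $s$. $\lambda_i$ is the length of the $i$-th row of $\lambda$ and $\lambda_i'$ is the length of the $i$-th column of $\lambda$. $\log$ is the natural logarithm, $\log^2 n=(\log n)^2$, and $\Phi$ is the standard normal distribution function. *)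

theory Defs
  imports "HOL-Probability.Probability"
begin

definition int_partitions :: "nat \<Rightarrow> nat list set" where
  "int_partitions n = {lam. sorted_wrt (\<ge>) lam \<and> 0 \<notin> set lam \<and> sum_list lam = n}"

text \<open>Boxes are pairs (row, column), both counted from 0, with row 0 at the top and
  column 0 on the left.\<close>

definition diagram :: "nat list \<Rightarrow> (nat \<times> nat) set" where
  "diagram lam = {(i, j). i < length lam \<and> j < lam ! i}"

definition row_len :: "nat list \<Rightarrow> nat \<Rightarrow> nat" where
  "row_len lam i = card {j. (i, j) \<in> diagram lam}"

definition col_len :: "nat list \<Rightarrow> nat \<Rightarrow> nat" where
  "col_len lam j = card {i. (i, j) \<in> diagram lam}"

definition arm :: "nat list \<Rightarrow> nat \<times> nat \<Rightarrow> nat" where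
  "arm lam s = card {j. j > snd s \<and> (fst s, j) \<in> diagram lam}"

definition leg :: "nat list \<Rightarrow> nat \<times> nat \<Rightarrow> nat" where
  "leg lam s = card {i. i > fst s \<and> (i, snd s) \<in> diagram lam}"

definition jack_weight :: "real \<Rightarrow> nat \<Rightarrow> nat list \<Rightarrow> real" where
  "jack_weight \<alpha> n lam =
     \<alpha> ^ n * fact n /
     (\<Prod>s\<in>diagram lam.
        (\<alpha> * real (arm lam s) + real (leg lam s) + 1) *
        (\<alpha> * real (arm lam s) + real (leg lam s) + \<alpha>))"

text \<open>That the weights sum to 1, so that this is a probability measure for \<open>\<alpha> > 0\<close>, is a
  theorem about Jack polynomials; the definition does not presuppose it.\<close>

definition jack_measure :: "real \<Rightarrow> nat \<Rightarrow> nat list measure" where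
  "jack_measure \<alpha> n = point_measure (int_partitions n) (\<lambda>lam. ennreal (jack_weight \<alpha> n lam))"

text \<open>A partition of \<open>n\<close> has at most \<open>n\<close> rows and at most \<open>n\<close> columns, and rows and columns
  outside the diagram have length 0, so the sum over \<open>i < n\<close> contains all nonzero terms.\<close>

definition W_stat :: "nat \<Rightarrow> real \<Rightarrow> nat list \<Rightarrow> real" where
  "W_stat n \<alpha> lam =
     (\<Sum>i<n. \<alpha> * real (row_len lam i choose 2) - real (col_len lam i choose 2)) /
     sqrt (\<alpha> * real (n choose 2))"

end

theory Submission
  imports Defs
begin

text \<open>A partition is grown one box at a time. Let \<mu> have the Jack law on partitions of \<open>n - 1\<close>
  and add a box to row r with probability \<open>up \<mu> r\<close>, the residue at the content of the new box of
  a rational function whose poles are the contents of all boxes that could be added. The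
  ratio of the hook products before and after is itself a product of differences of such contents,
  and this makes the resulting partition of n Jack distributed (\<open>mass_balance\<close>,
  \<open>growth_law\<close>). Hence \<open>W = V + T\<close>, where V depends on \<mu> only and T is the
  scaled content of the last box. The expansion of the rational function at infinity shows that,
  given \<mu>, T has mean 0 and variance exactly \<open>2/n\<close>, whatever \<mu> is
  (\<open>up_moments\<close>). The reciprocal function governs the removal of a box and shows that T has
  mean \<open>(2/n) W\<close> given the final partition (\<open>down_moments\<close>). Together,
  \<open>E[W f(W)] = (n/2) E[T f(V + T)]\<close> for every f (\<open>content_sum_stein_identity\<close>).

  This identity forces W to be nearly normal. Given \<mu>, the right-hand side is
  unchanged if \<open>f(V + T)\<close> is replaced by \<open>f(V + T) - f(V)\<close>. As the conditional variance does not
  depend on \<mu>, it then becomes an average of \<open>f'\<close> over points at distance at most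
  \<open>2 sup |T|\<close> from W, with \<mu> keeping its law: W and its zero-bias transform are coupled
  through V. Let f be the solution of Stein's equation
  \<open>f'(w) = w f(w) + 1(w \<le> z) - \<Phi>(z)\<close> and \<open>g(w) = w f(w)\<close>. The difference between the distribution
  functions is, up to a shift of z by a multiple of \<open>sup |T|\<close>, the difference of two averages
  of g over neighbouring points. The local Lipschitz constant of g is of order
  \<open>(1 + |w|)^(k+2) / (1 + |z|)^k\<close> for every k (\<open>stein_sol_times_lipschitz\<close>), which is where the
  decay in z comes from. The numerator is absorbed by moments of W, which the same identity
  with \<open>f(w) = w^(2k+1)\<close> bounds recursively (\<open>even_moment_le\<close>). The outcome is
  \<open>nonuniform_berry_esseen\<close>, a statement about any such pair \<open>(V, T)\<close>.

  It remains to see that \<open>|T|\<close> is of order \<open>1 / sqrt n\<close>. The content of an added box lies between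
  minus the length of the first column and \<alpha> times the length of the first row. Splitting the
  first row off the hook product shows that it has length l with probability at most
  \<open>\<alpha> (n/\<alpha>)^l / (l! (l-1)!)\<close>, and similarly for the first column with \<open>1/\<alpha>\<close> in place of
  \<alpha>. Beyond a large multiple of \<open>sqrt (n/\<alpha>)\<close>, which is at least \<open>log n\<close> by assumption, this
  is smaller than any given power of \<open>1/n\<close> (\<open>long_rows_or_cols_unlikely\<close>). All quantities in
  question are bounded by powers of n, so the exceptional event is negligible for \<open>|z|\<close> up to
  a power of n; for larger \<open>|z|\<close> only a Gaussian tail is left.\<close>

section \<open>The normal distribution function\<close>

abbreviation gauss_cdf :: "real \<Rightarrow> real" where
  "gauss_cdf \<equiv> cdf std_normal_distribution"

interpretation gauss: real_distribution std_normal_distribution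
  by (rule real_dist_normal_dist)

lemma gauss_density_pos: "0 < std_normal_density x"
  by (simp add: std_normal_density_def)

lemma gauss_density_deriv:
  "(std_normal_density has_real_derivative - x * std_normal_density x) (at x)"
  unfolding std_normal_density_def
  by (auto intro!: derivative_eq_intros simp: power2_eq_square)
     (simp add: real_div_sqrt field_simps)

lemma gauss_density_continuous: "continuous_on S std_normal_density"
  by (intro continuous_at_imp_continuous_on ballI DERIV_isCont[OF gauss_density_deriv])

lemma gauss_measure_Icc:
  assumes "a \<le> b"
  shows "measure std_normal_distribution {a..b} = integral {a..b} std_normal_density"
proof -
  define F where "F x = integral {a - 1..x} std_normal_density" for x
  have deriv: "(F has_real_derivative std_normal_density x) (at x)" if "a \<le> x" "x \<le> b" for x
  proof -
    have "(F has_real_derivative std_normal_density x) (at x within {a - 1..b + 1})"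
      unfolding F_def
      by (rule integral_has_real_derivative[OF gauss_density_continuous]) (use that in auto)
    then show ?thesis using that by (simp add: at_within_Icc_at)
  qed
  have "emeasure std_normal_distribution {a..b}
      = (\<integral>\<^sup>+x. ennreal (std_normal_density x) * indicator {a..b} x \<partial>lborel)"
    by (rule emeasure_density) auto
  also have "\<dots> = ennreal (F b - F a)"
    by (rule nn_integral_FTC_Icc) (use assms deriv in auto)
  also have "F b - F a = integral {a..b} std_normal_density"
    using Henstock_Kurzweil_Integration.integral_combine[of "a - 1" a b std_normal_density] assms
    by (simp add: F_def integrable_continuous_real[OF gauss_density_continuous])
  moreover have "0 \<le> integral {a..b} std_normal_density"
    by (rule integral_nonneg[OF integrable_continuous_real[OF gauss_density_continuous]])
       (simp add: gauss_density_pos less_imp_le)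
  ultimately show ?thesis
    by (simp add: measure_def)
qed

lemma gauss_cdf_diff:
  assumes "a \<le> b"
  shows "gauss_cdf b - gauss_cdf a = integral {a..b} std_normal_density"
proof (cases "a = b")
  case False
  have ivl: "insert a {a<..b} = {a..b}"
    using assms by auto
  have "measure std_normal_distribution {a} = 0"
    using gauss_measure_Icc[of a a] by simp
  moreover have "measure std_normal_distribution {a..b}
      = measure std_normal_distribution {a} + measure std_normal_distribution {a<..b}"
    using gauss.finite_measure_Union[of "{a}" "{a<..b}"] assms
    by (simp add: ivl)
  moreover have "gauss_cdf b - gauss_cdf a = measure std_normal_distribution {a<..b}"
    using gauss.cdf_diff_eq[of a b] assms False by auto
  ultimately show ?thesis
    using gauss_measure_Icc[OF assms] by simp
qed simp

lemma gauss_cdf_deriv: "(gauss_cdf has_real_derivative std_normal_density x) (at x)"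
proof -
  have "((\<lambda>u. integral {x - 1..u} std_normal_density) has_real_derivative std_normal_density x)
      (at x within {x - 1..x + 1})"
    by (rule integral_has_real_derivative[OF gauss_density_continuous]) simp
  then have "((\<lambda>u. integral {x - 1..u} std_normal_density) has_real_derivative std_normal_density x) (at x)"
    by (simp add: at_within_Icc_at)
  then have "((\<lambda>u. gauss_cdf (x - 1) + integral {x - 1..u} std_normal_density) has_real_derivative
      std_normal_density x) (at x)"
    by (auto intro!: derivative_eq_intros)
  then show ?thesis
  proof (rule has_field_derivative_transform_within[where d = 1])
    show "gauss_cdf (x - 1) + integral {x - 1..u} std_normal_density = gauss_cdf u"
      if "dist u x < 1" for u
      using gauss_cdf_diff[of "x - 1" u] that by (auto simp: dist_real_def abs_if split: if_splits)
  qed simp_all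
qed

lemmas gauss_cdf_deriv' [derivative_intros] = DERIV_chain2[OF gauss_cdf_deriv]
lemmas gauss_density_deriv' [derivative_intros] = DERIV_chain2[OF gauss_density_deriv]

lemma gauss_density_minus: "std_normal_density (- x) = std_normal_density x"
  by (simp add: std_normal_density_def)

text \<open>The sum of both sides has derivative 0 and tends to 1 at infinity.\<close>

lemma gauss_cdf_minus: "gauss_cdf (- x) = 1 - gauss_cdf x"
proof -
  define s where "s x = gauss_cdf x + gauss_cdf (- x)" for x
  have "(s has_real_derivative 0) (at x)" for x
    unfolding s_def by (auto intro!: derivative_eq_intros simp: gauss_density_minus)
  then have const: "s x = s y" for x y
    by (metis DERIV_isconst_all)
  have "((\<lambda>y. gauss_cdf y + gauss_cdf (- y)) \<longlongrightarrow> 1 + 0) at_top"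
    by (intro tendsto_add gauss.cdf_lim_at_top_prob
        filterlim_compose[OF gauss.cdf_lim_at_bot filterlim_uminus_at_bot_at_top])
  then have "(s \<longlongrightarrow> 1) at_top"
    by (simp add: s_def[abs_def])
  moreover have "(s \<longlongrightarrow> s x) at_top"
  proof -
    have "s = (\<lambda>_. s x)" using const by blast
    then show ?thesis by (metis tendsto_const)
  qed
  ultimately have "s x = 1"
    using tendsto_unique[of at_top s] by auto
  then show ?thesis by (simp add: s_def)
qed

lemma gauss_cdf_nonneg: "0 \<le> gauss_cdf x"
  by (rule gauss.cdf_nonneg)

lemma gauss_cdf_le_1: "gauss_cdf x \<le> 1"
  by (rule gauss.cdf_bounded_prob)

lemma gauss_density_at_bot: "(std_normal_density \<longlongrightarrow> 0) at_bot"
  unfolding std_normal_density_def by real_asymp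

text \<open>Left of \<open>-1\<close> the density minus the distribution function is increasing, and it vanishes
  at minus infinity. Between \<open>-1\<close> and 0 the density is at least \<open>1/5\<close>; any constant in place
  of 5 would do.\<close>

lemma gauss_cdf_le_density:
  assumes "x \<le> 0"
  shows "gauss_cdf x \<le> 5 * std_normal_density x"
proof (cases "x \<le> -1")
  case True
  define d where "d y = std_normal_density y - gauss_cdf y" for y
  have "d y \<le> d x" if "y \<le> x" for y
  proof (rule DERIV_nonneg_imp_nondecreasing[OF that])
    fix u assume u: "y \<le> u" "u \<le> x"
    have "(d has_real_derivative (- u - 1) * std_normal_density u) (at u)"
      unfolding d_def by (auto intro!: derivative_eq_intros simp: algebra_simps)
    moreover have "0 \<le> (- u - 1) * std_normal_density u"
      using u True gauss_density_pos[of u] by (intro mult_nonneg_nonneg) auto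
    ultimately show "\<exists>y. (d has_real_derivative y) (at u) \<and> 0 \<le> y" by blast
  qed
  moreover have "(d \<longlongrightarrow> 0 - 0) at_bot"
    unfolding d_def by (intro tendsto_diff gauss_density_at_bot gauss.cdf_lim_at_bot)
  ultimately have "0 \<le> d x"
    by (intro tendsto_upperbound[of d 0 at_bot]) (auto simp: eventually_at_bot_linorder intro: exI[of _ x])
  then show ?thesis
    using gauss_density_pos[of x] by (simp add: d_def)
next
  case False
  have "sqrt (2 * pi) * exp (1 / 2) \<le> 5"
  proof (rule power2_le_imp_le)
    have "(sqrt (2 * pi) * exp (1 / 2))\<^sup>2 = 2 * pi * exp 1"
      by (simp add: power_mult_distrib flip: exp_double)
    also have "\<dots> \<le> 2 * 4 * 3"
      using pi_less_4 exp_le by (intro mult_mono) auto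
    finally show "(sqrt (2 * pi) * exp (1 / 2))\<^sup>2 \<le> 5\<^sup>2" by simp
  qed simp
  moreover have "x\<^sup>2 \<le> 1"
    using False assms by (simp add: abs_square_le_1)
  then have "exp (x\<^sup>2 / 2) \<le> exp (1 / 2)" by simp
  ultimately have "sqrt (2 * pi) * exp (x\<^sup>2 / 2) \<le> 5"
    by (meson mult_left_mono order_trans real_sqrt_ge_zero pi_ge_zero zero_le_mult_iff zero_le_numeral)
  then have "1 \<le> 5 * std_normal_density x"
    by (simp add: std_normal_density_def exp_minus field_simps)
  then show ?thesis
    using gauss_cdf_le_1[of x] by linarith
qed

lemma gauss_tail_le_density: "0 \<le> x \<Longrightarrow> 1 - gauss_cdf x \<le> 5 * std_normal_density x"
  using gauss_cdf_le_density[of "- x"] by (simp add: gauss_cdf_minus gauss_density_minus)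

text \<open>From \<open>1 + |z| \<le> e\<^bsup>|z|\<^esup>\<close> and \<open>m |z| \<le> m\<^sup>2 + z\<^sup>2/4\<close>.\<close>

lemma exp_minus_square_le_power:
  fixes z :: real
  shows "exp (- z\<^sup>2 / 4) \<le> exp (real m ^ 2) / (1 + \<bar>z\<bar>) ^ m"
proof -
  have "(1 + \<bar>z\<bar>) ^ m \<le> exp \<bar>z\<bar> ^ m"
    by (intro power_mono) (auto simp: exp_ge_add_one_self)
  also have "\<dots> = exp (real m * \<bar>z\<bar>)"
    by (simp add: exp_of_nat_mult)
  also have "\<dots> \<le> exp (real m ^ 2 + z\<^sup>2 / 4)"
    using zero_le_power2[of "real m - \<bar>z\<bar> / 2"] by (simp add: power2_eq_square algebra_simps)
  finally have "(1 + \<bar>z\<bar>) ^ m \<le> exp (real m ^ 2) * exp (z\<^sup>2 / 4)"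
    by (simp add: exp_add)
  then show ?thesis
    by (simp add: exp_minus field_simps)
qed

lemma gauss_density_le_power:
  "std_normal_density z \<le> exp (real m ^ 2) / (1 + \<bar>z\<bar>) ^ m"
proof -
  have "1 \<le> sqrt (2 * pi)" using pi_gt3 by simp
  then have "std_normal_density z \<le> exp (- z\<^sup>2 / 2)"
    by (simp add: std_normal_density_def field_simps)
  also have "\<dots> \<le> exp (- z\<^sup>2 / 4)" by simp
  finally show ?thesis using exp_minus_square_le_power order_trans by blast
qed

section \<open>The solution of Stein's equation\<close>

definition lower_mills :: "real \<Rightarrow> real" where
  "lower_mills w = gauss_cdf w / std_normal_density w"

lemma lower_mills_nonneg: "0 \<le> lower_mills w"
  by (simp add: lower_mills_def gauss_cdf_nonneg gauss_density_pos less_imp_le)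

lemma lower_mills_deriv: "(lower_mills has_real_derivative 1 + w * lower_mills w) (at w)"
  unfolding lower_mills_def
  using gauss_density_pos[of w]
  by (auto intro!: derivative_eq_intros simp: field_simps power2_eq_square)

lemma lower_mills_le: "w \<le> 0 \<Longrightarrow> lower_mills w \<le> 5"
  using gauss_cdf_le_density[of w] gauss_density_pos[of w]
  by (simp add: lower_mills_def field_simps)

text \<open>This is the bounded solution of \<open>f'(w) = w f(w) + 1(w \<le> z) - \<Phi>(z)\<close>, see
  \<open>stein_sol_deriv\<close> below. Both branches come from \<open>lower_mills\<close>, which solves
  \<open>y' = 1 + w y\<close>.\<close>

definition stein_sol :: "real \<Rightarrow> real \<Rightarrow> real" where
  "stein_sol z w = (if w \<le> z then lower_mills w * (1 - gauss_cdf z)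
                    else gauss_cdf z * lower_mills (- w))"

text \<open>With this symmetry it suffices to bound the solution for \<open>w \<le> z\<close> or for \<open>z \<ge> 0\<close>.\<close>

lemma stein_sol_reflect: "stein_sol (- z) (- w) = stein_sol z w"
  by (cases w z rule: linorder_cases)
     (auto simp: stein_sol_def gauss_cdf_minus lower_mills_def gauss_density_minus)

lemma stein_sol_left: "w \<le> z \<Longrightarrow> stein_sol z w = lower_mills w * (1 - gauss_cdf z)"
  by (simp add: stein_sol_def)

lemma stein_sol_right: "z \<le> w \<Longrightarrow> stein_sol z w = gauss_cdf z * lower_mills (- w)"
  using stein_sol_left[of "- w" "- z"] by (simp add: stein_sol_reflect gauss_cdf_minus)

lemma stein_sol_nonneg: "0 \<le> stein_sol z w"
  by (simp add: stein_sol_def lower_mills_nonneg gauss_cdf_nonneg gauss_cdf_le_1)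

lemma gauss_density_antimono:
  "\<bar>w\<bar> \<le> \<bar>z\<bar> \<Longrightarrow> std_normal_density z \<le> std_normal_density w"
  by (simp add: std_normal_density_def divide_right_mono abs_le_square_iff)

text \<open>The growth of \<open>1 / \<phi>(w)\<close> is compensated by the tail \<open>1 - \<Phi>(z)\<close>, which is of the order of
  \<open>\<phi>(z)\<close>.\<close>

lemma stein_sol_left_le_ratio:
  assumes "w \<le> z" "0 \<le> z"
  shows "stein_sol z w \<le> 5 * (std_normal_density z / std_normal_density w)"
proof -
  have "stein_sol z w = gauss_cdf w * ((1 - gauss_cdf z) / std_normal_density w)"
    using assms by (simp add: stein_sol_left lower_mills_def)
  also have "\<dots> \<le> 1 * ((5 * std_normal_density z) / std_normal_density w)"
    using gauss_tail_le_density[of z] assms gauss_cdf_nonneg gauss_cdf_le_1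
    by (intro mult_mono divide_right_mono) (auto simp: gauss_density_pos less_imp_le)
  finally show ?thesis by simp
qed

lemma stein_sol_le: "stein_sol z w \<le> 5"
proof -
  have left: "stein_sol z w \<le> 5" if "w \<le> z" for z w
  proof (cases "w \<le> 0")
    case True
    have "lower_mills w * (1 - gauss_cdf z) \<le> 5 * 1"
      using True lower_mills_le gauss_cdf_nonneg gauss_cdf_le_1
      by (intro mult_mono) auto
    then show ?thesis using that by (simp add: stein_sol_left)
  next
    case False
    then have "std_normal_density z / std_normal_density w \<le> 1"
      using that gauss_density_antimono[of w z] gauss_density_pos[of w] by simp
    then show ?thesis
      using stein_sol_left_le_ratio[OF that] that False by linarith
  qed
  show ?thesis
    using left[of w z] left[of "- w" "- z"] by (cases "w \<le> z") (auto simp: stein_sol_reflect)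
qed

text \<open>The first summand pays for the region where \<open>|w|\<close> is much smaller than \<open>|z|\<close> and Gaussian
  decay is available, the second for the region where \<open>1 + |w|\<close> is comparable with \<open>1 + |z|\<close>.\<close>

definition decay_const :: "nat \<Rightarrow> real" where
  "decay_const m = 5 * (exp (real m ^ 2) + 2 ^ m)"

lemma decay_const_pos: "0 < decay_const m"
  by (simp add: decay_const_def add_pos_pos)

text \<open>A bound polynomial in w but decaying in z: if \<open>|w| \<ge> |z|/2\<close>, the quotient on the right is
  bounded below and boundedness of the solution is enough; otherwise \<open>\<phi>(z) / \<phi>(w)\<close> is at most
  \<open>exp (- z\<^sup>2/4)\<close>.\<close>

lemma stein_sol_decay:
  "stein_sol z w \<le> decay_const m * (1 + \<bar>w\<bar>) ^ m / (1 + \<bar>z\<bar>) ^ m"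
proof -
  have nonneg: "stein_sol z w \<le> decay_const m * (1 + \<bar>w\<bar>) ^ m / (1 + \<bar>z\<bar>) ^ m" if "0 \<le> z" for z w
  proof (cases "\<bar>z\<bar> / 2 \<le> \<bar>w\<bar>")
    case True
    have "(1 + \<bar>z\<bar>) ^ m \<le> (2 * (1 + \<bar>w\<bar>)) ^ m"
      using True by (intro power_mono) auto
    then have "5 * (1 + \<bar>z\<bar>) ^ m \<le> 5 * 2 ^ m * (1 + \<bar>w\<bar>) ^ m"
      unfolding power_mult_distrib by simp
    also have "\<dots> \<le> decay_const m * (1 + \<bar>w\<bar>) ^ m"
      by (intro mult_right_mono) (auto simp: decay_const_def)
    finally have "stein_sol z w * (1 + \<bar>z\<bar>) ^ m \<le> decay_const m * (1 + \<bar>w\<bar>) ^ m"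
      using mult_right_mono[OF stein_sol_le[of z w] zero_le_power[of "1 + \<bar>z\<bar>" m]] by linarith
    then show ?thesis by (simp add: pos_le_divide_eq)
  next
    case False
    have "w\<^sup>2 \<le> (z / 2)\<^sup>2"
      using False that by (intro power2_le_iff_abs_le[THEN iffD2]) auto
    then have w2: "w\<^sup>2 \<le> z\<^sup>2 / 4" by (simp add: power_divide)
    have "stein_sol z w \<le> 5 * (std_normal_density z / std_normal_density w)"
      using False that by (intro stein_sol_left_le_ratio) auto
    also have "std_normal_density z / std_normal_density w = exp (w\<^sup>2 / 2 - z\<^sup>2 / 2)"
      by (simp add: std_normal_density_def flip: exp_diff)
    also have "\<dots> \<le> exp (- z\<^sup>2 / 4)"
      unfolding exp_le_cancel_iff using w2 zero_le_power2[of z] by linarith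
    also have "\<dots> \<le> exp (real m ^ 2) / (1 + \<bar>z\<bar>) ^ m"
      by (rule exp_minus_square_le_power)
    finally have "stein_sol z w \<le> 5 * exp (real m ^ 2) * 1 / (1 + \<bar>z\<bar>) ^ m"
      by simp
    also have "\<dots> \<le> decay_const m * (1 + \<bar>w\<bar>) ^ m / (1 + \<bar>z\<bar>) ^ m"
      by (intro divide_right_mono mult_mono) (auto simp: decay_const_def one_le_power)
    finally show ?thesis .
  qed
  show ?thesis
    using nonneg[of z w] nonneg[of "- z" "- w"] by (cases "0 \<le> z") (auto simp: stein_sol_reflect)
qed

lemma gauss_tail_decay:
  assumes "w \<le> z"
  shows "1 - gauss_cdf z \<le> decay_const m * (1 + \<bar>w\<bar>) ^ m / (1 + \<bar>z\<bar>) ^ m"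
proof (cases "0 \<le> z")
  case True
  have "1 - gauss_cdf z \<le> 5 * (exp (real m ^ 2) / (1 + \<bar>z\<bar>) ^ m)"
    using gauss_tail_le_density[OF True] gauss_density_le_power[of z m] by linarith
  also have "\<dots> = 5 * exp (real m ^ 2) * 1 / (1 + \<bar>z\<bar>) ^ m" by simp
  also have "\<dots> \<le> decay_const m * (1 + \<bar>w\<bar>) ^ m / (1 + \<bar>z\<bar>) ^ m"
    by (intro divide_right_mono mult_mono) (auto simp: decay_const_def one_le_power)
  finally show ?thesis .
next
  case False
  then have "(1 + \<bar>z\<bar>) ^ m \<le> (1 + \<bar>w\<bar>) ^ m"
    using assms by (intro power_mono) auto
  moreover have "1 \<le> decay_const m"
    using one_le_power[of "2::real" m] exp_ge_zero[of "real m ^ 2"]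
    unfolding decay_const_def by (simp only: distrib_left) linarith
  ultimately have "1 * (1 + \<bar>z\<bar>) ^ m \<le> decay_const m * (1 + \<bar>w\<bar>) ^ m"
    by (intro mult_mono) auto
  then have "1 \<le> decay_const m * (1 + \<bar>w\<bar>) ^ m / (1 + \<bar>z\<bar>) ^ m"
    by (simp add: field_simps)
  then show ?thesis using gauss_cdf_nonneg[of z] by linarith
qed

lemma gauss_cdf_decay:
  "z \<le> w \<Longrightarrow> gauss_cdf z \<le> decay_const m * (1 + \<bar>w\<bar>) ^ m / (1 + \<bar>z\<bar>) ^ m"
  using gauss_tail_decay[of "- w" "- z" m] by (simp add: gauss_cdf_minus)

lemma stein_sol_continuous: "isCont (stein_sol z) w"
proof -
  have m: "isCont lower_mills u" for u by (rule DERIV_isCont[OF lower_mills_deriv])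
  have m': "isCont (\<lambda>u. lower_mills (- u)) u" for u
    by (rule isCont_o2[OF _ m]) (intro continuous_intros)
  have "continuous_on ({..z} \<union> {z..}) (stein_sol z)"
  proof (rule continuous_on_closed_Un)
    show "continuous_on {..z} (stein_sol z)"
      by (rule continuous_on_cong[THEN iffD2, OF refl stein_sol_left])
         (auto intro!: continuous_intros continuous_at_imp_continuous_on m)
    show "continuous_on {z..} (stein_sol z)"
      by (rule continuous_on_cong[THEN iffD2, OF refl stein_sol_right])
         (auto intro!: continuous_intros continuous_at_imp_continuous_on m')
  qed auto
  moreover have "{..z} \<union> {z..} = UNIV" by auto
  ultimately show ?thesis by (simp add: continuous_on_eq_continuous_at)
qed

lemma stein_sol_deriv:
  assumes "w \<noteq> z"
  shows "(stein_sol z has_real_derivative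
           w * stein_sol z w + (if w \<le> z then 1 else 0) - gauss_cdf z) (at w)"
proof (cases "w < z")
  case True
  have "((\<lambda>w. lower_mills w * (1 - gauss_cdf z)) has_real_derivative
      w * stein_sol z w + 1 - gauss_cdf z) (at w)"
    using True by (auto intro!: derivative_eq_intros lower_mills_deriv simp: stein_sol_left algebra_simps)
  then have "(stein_sol z has_real_derivative w * stein_sol z w + 1 - gauss_cdf z) (at w)"
    by (rule has_field_derivative_transform_within[where d = "z - w"])
       (use True in \<open>auto simp: stein_sol_left dist_real_def\<close>)
  then show ?thesis using True by simp
next
  case False
  then have w: "z < w" using assms by simp
  have "((\<lambda>w. gauss_cdf z * lower_mills (- w)) has_real_derivative
      w * stein_sol z w - gauss_cdf z) (at w)"
    using w by (auto intro!: derivative_eq_intros DERIV_chain2[OF lower_mills_deriv]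
        simp: stein_sol_right algebra_simps)
  then have "(stein_sol z has_real_derivative w * stein_sol z w - gauss_cdf z) (at w)"
    by (rule has_field_derivative_transform_within[where d = "w - z"])
       (use w in \<open>auto simp: stein_sol_right dist_real_def\<close>)
  then show ?thesis using w by simp
qed

text \<open>The derivative of the Stein solution jumps at z, so the mean value inequality is applied
  on either side of that point.\<close>

lemma mean_value_except_point:
  fixes F :: "real \<Rightarrow> real"
  assumes "a \<le> b" and cont: "\<And>x. isCont F x"
    and deriv: "\<And>x. x \<noteq> z \<Longrightarrow> a \<le> x \<Longrightarrow> x \<le> b \<Longrightarrow> (F has_real_derivative F' x) (at x)"
    and le: "\<And>x. x \<noteq> z \<Longrightarrow> a \<le> x \<Longrightarrow> x \<le> b \<Longrightarrow> F' x \<le> M"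
  shows "F b - F a \<le> M * (b - a)"
proof -
  have piece: "F v - F u \<le> M * (v - u)" if uv: "u \<le> v" "a \<le> u" "v \<le> b" "z \<notin> {u<..<v}" for u v
  proof (cases "u = v")
    case False
    then have "u < v" using uv by simp
    moreover have "continuous_on {u..v} F"
      by (intro continuous_at_imp_continuous_on ballI cont)
    moreover have d: "(F has_real_derivative F' x) (at x)" "F' x \<le> M" if "u < x" "x < v" for x
      using that uv by (auto intro!: deriv le)
    ultimately obtain l c where c: "u < c" "c < v" "(F has_real_derivative l) (at c)"
        "F v - F u = (v - u) * l"
      using MVT[of u v F] real_differentiable_def by blast
    then have "l \<le> M" using d DERIV_unique by blast
    then show ?thesis using c \<open>u < v\<close> by (simp add: mult.commute)
  qed simp
  show ?thesis
  proof (cases "z \<in> {a..b}")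
    case True
    then show ?thesis
      using piece[of a z] piece[of z b] by (auto simp: algebra_simps)
  next
    case False
    then show ?thesis using piece[of a b] assms(1) by auto
  qed
qed

text \<open>The factor t makes the inequality insensitive to the sign of t: an upper bound on the
  derivative suffices on both sides of v. This is the form in which \<open>f'\<close> enters Stein's method
  below, the average of the left-hand side over a centred T being \<open>E[T f(v + T)]\<close>.\<close>

lemma weighted_increment_le:
  fixes F :: "real \<Rightarrow> real"
  assumes cont: "\<And>x. isCont F x" and t: "\<bar>t\<bar> \<le> \<delta>"
    and deriv: "\<And>x. x \<noteq> z \<Longrightarrow> \<bar>x - v\<bar> \<le> \<delta> \<Longrightarrow> (F has_real_derivative F' x) (at x)"
    and le: "\<And>x. x \<noteq> z \<Longrightarrow> \<bar>x - v\<bar> \<le> \<delta> \<Longrightarrow> F' x \<le> M"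
  shows "t * (F (v + t) - F v) \<le> M * t\<^sup>2"
proof (cases "0 \<le> t")
  case True
  have "F (v + t) - F v \<le> M * (v + t - v)"
    by (rule mean_value_except_point[where z = z and F' = F', OF _ cont])
       (use True t deriv le in auto)
  then have "t * (F (v + t) - F v) \<le> t * (M * t)"
    using True by (intro mult_left_mono) auto
  then show ?thesis by (simp add: power2_eq_square algebra_simps)
next
  case False
  have "F v - F (v + t) \<le> M * (v - (v + t))"
    by (rule mean_value_except_point[where z = z and F' = F', OF _ cont])
       (use False t deriv le in auto)
  then have "- t * (F v - F (v + t)) \<le> - t * (M * (- t))"
    using False by (intro mult_left_mono) auto
  then show ?thesis by (simp add: power2_eq_square algebra_simps)
qed

text \<open>The derivative of \<open>g(w) = w f(w)\<close> is \<open>(1 + w\<^sup>2) f(w) + w (1(w \<le> z) - \<Phi>(z))\<close>. Both \<open>f(w)\<close> and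
  \<open>|1(w \<le> z) - \<Phi>(z)|\<close> are at most \<open>decay_const m\<close> times \<open>((1 + |w|) / (1 + |z|))^m\<close>, and
  \<open>1 + w\<^sup>2 + |w| \<le> (1 + |w|)\<^sup>2\<close>.\<close>

lemma stein_sol_times_lipschitz:
  assumes wv: "\<bar>w - v\<bar> \<le> \<delta>"
  shows "\<bar>w * stein_sol z w - v * stein_sol z v\<bar>
           \<le> \<delta> * (decay_const m * (1 + \<bar>v\<bar> + \<delta>) ^ (m + 2) / (1 + \<bar>z\<bar>) ^ m)"
proof -
  define g where "g w = w * stein_sol z w" for w
  define g' where "g' w = (1 + w\<^sup>2) * stein_sol z w
      + w * ((if w \<le> z then 1 else 0) - gauss_cdf z)" for w
  define M where "M = decay_const m * (1 + \<bar>v\<bar> + \<delta>) ^ (m + 2) / (1 + \<bar>z\<bar>) ^ m"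
  have cont: "isCont g w" for w
    unfolding g_def by (intro continuous_intros stein_sol_continuous)
  have deriv: "(g has_real_derivative g' w) (at w)" if "w \<noteq> z" for w
    unfolding g_def g'_def
    by (rule derivative_eq_intros stein_sol_deriv that refl | simp add: that power2_eq_square algebra_simps)+
  have bound: "\<bar>g' w\<bar> \<le> M" if "w \<noteq> z" "\<bar>w - v\<bar> \<le> \<delta>" for w
  proof -
    define S where "S = decay_const m * (1 + \<bar>w\<bar>) ^ m / (1 + \<bar>z\<bar>) ^ m"
    have S0: "0 \<le> S" using decay_const_pos[of m] by (simp add: S_def)
    have f: "stein_sol z w \<le> S" unfolding S_def by (rule stein_sol_decay)
    have "\<bar>(if w \<le> z then 1 else 0) - gauss_cdf z\<bar> \<le> S"
      using gauss_tail_decay[of w z m] gauss_cdf_decay[of z w m]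
      by (auto simp: S_def gauss_cdf_nonneg gauss_cdf_le_1)
    then have "\<bar>g' w\<bar> \<le> (1 + w\<^sup>2) * S + \<bar>w\<bar> * S"
      unfolding g'_def using f stein_sol_nonneg[of z w]
      by (intro order_trans[OF abs_triangle_ineq] add_mono)
         (auto simp: abs_mult intro!: mult_mono)
    also have "\<dots> = (1 + \<bar>w\<bar> + w\<^sup>2) * S" by (simp add: algebra_simps)
    also have "\<dots> \<le> (1 + \<bar>w\<bar>)\<^sup>2 * S"
      using S0 by (intro mult_right_mono) (auto simp: power2_eq_square algebra_simps)
    also have "\<dots> = decay_const m * (1 + \<bar>w\<bar>) ^ (m + 2) / (1 + \<bar>z\<bar>) ^ m"
      by (simp add: S_def power_add power2_eq_square)
    also have "\<dots> \<le> M"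
      unfolding M_def using that decay_const_pos[of m]
      by (intro divide_right_mono mult_left_mono power_mono) auto
    finally show ?thesis .
  qed
  have d: "0 \<le> \<delta>" using wv by linarith
  have M0: "0 \<le> M" using decay_const_pos[of m] d by (simp add: M_def)
  have one: "\<bar>g w - g v\<bar> \<le> M * \<bar>w - v\<bar>"
  proof (cases "w = v")
    case False
    have "(w - v) * (g (v + (w - v)) - g v) \<le> M * (w - v)\<^sup>2"
      by (rule weighted_increment_le[where z = z and F' = g', OF cont wv deriv])
         (use bound in \<open>auto simp: abs_le_iff\<close>)
    moreover have "(w - v) * (- g (v + (w - v)) - (- g v)) \<le> M * (w - v)\<^sup>2"
      by (rule weighted_increment_le[where z = z and F' = "\<lambda>w. - g' w" and F = "\<lambda>w. - g w", OF _ wv])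
         (use deriv bound cont in \<open>auto simp: abs_le_iff intro!: derivative_eq_intros\<close>)
    ultimately have "\<bar>(w - v) * (g w - g v)\<bar> \<le> M * \<bar>w - v\<bar>\<^sup>2"
      by (simp add: abs_le_iff algebra_simps)
    then have "\<bar>w - v\<bar> * \<bar>g w - g v\<bar> \<le> \<bar>w - v\<bar> * (M * \<bar>w - v\<bar>)"
      by (simp only: abs_mult power2_eq_square mult_ac)
    then show ?thesis by (rule mult_left_le_imp_le) (use False in simp)
  qed simp
  also have "\<dots> \<le> M * \<delta>" using wv M0 by (intro mult_left_mono) auto
  finally show ?thesis by (simp add: g_def M_def mult.commute)
qed

section \<open>A non-uniform Berry--Esseen bound from a Stein identity\<close>

lemma power_add_le:
  fixes a b :: real
  assumes "0 \<le> a" "0 \<le> b"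
  shows "(a + b) ^ j \<le> 2 ^ j * (a ^ j + b ^ j)"
proof -
  have "(a + b) ^ j \<le> (2 * max a b) ^ j"
    using assms by (intro power_mono) auto
  also have "\<dots> = 2 ^ j * max a b ^ j" by (rule power_mult_distrib)
  also have "\<dots> \<le> 2 ^ j * (a ^ j + b ^ j)"
    using assms by (intro mult_left_mono) (auto simp: max_def)
  finally show ?thesis .
qed

text \<open>The recursion is that of the Gaussian moments, \<open>E W\<^bsup>2k+2\<^esup> = (2k+1) E W\<^bsup>2k\<^esup>\<close>, with room for a
  perturbation of W by \<open>2 \<Delta>\<close> and for an exceptional event.\<close>

fun moment_bound :: "real \<Rightarrow> nat \<Rightarrow> real" where
  "moment_bound \<Delta> 0 = 1"
| "moment_bound \<Delta> (Suc k)
     = real (2 * k + 1) * (2 ^ (2 * k) * (moment_bound \<Delta> k + (2 * \<Delta>) ^ (2 * k))) + \<Delta>"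

text \<open>The summands account for the Lipschitz bound on \<open>w f(w)\<close>, the shift of z in \<open>\<Phi>(z)\<close>, the
  exceptional event, and the values of z outside the range of W, in this order.\<close>

definition berry_esseen_const :: "real \<Rightarrow> nat \<Rightarrow> real" where
  "berry_esseen_const \<Delta> i =
     (1 + 2 * \<Delta>) ^ (2 * i)
       * (2 * decay_const (2 * i) * (2 ^ (2 * i + 2) * (moment_bound \<Delta> (i + 1) + (1 + 2 * \<Delta>) ^ (2 * i + 2)))
          + 2 * exp (real (2 * i) ^ 2))
     + 12 * 4 ^ i + 5 * exp (real (2 * i + 1) ^ 2)"

text \<open>A two-stage experiment: u is drawn with weights m, then r with weights \<open>p u\<close>, and
  \<open>W = V u + T u r\<close>. That the conditional variance b is the same for all u is essential: it
  means that passing from W to its zero-bias transform does not change the law of u.\<close>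

locale stein_step =
  fixes U :: "'a set" and R :: "'b set"
    and m :: "'a \<Rightarrow> real" and p :: "'a \<Rightarrow> 'b \<Rightarrow> real"
    and V :: "'a \<Rightarrow> real" and T :: "'a \<Rightarrow> 'b \<Rightarrow> real" and b :: real
  assumes fin: "finite U" "finite R"
    and m_nonneg: "u \<in> U \<Longrightarrow> 0 \<le> m u" and m_sum: "(\<Sum>u\<in>U. m u) = 1"
    and p_nonneg: "u \<in> U \<Longrightarrow> r \<in> R \<Longrightarrow> 0 \<le> p u r"
    and p_sum: "u \<in> U \<Longrightarrow> (\<Sum>r\<in>R. p u r) = 1"
    and T_mean: "u \<in> U \<Longrightarrow> (\<Sum>r\<in>R. p u r * T u r) = 0"
    and T_var: "u \<in> U \<Longrightarrow> (\<Sum>r\<in>R. p u r * (T u r)\<^sup>2) = b"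
    and b_pos: "0 < b"
    and stein: "(\<Sum>u\<in>U. m u * (\<Sum>r\<in>R. p u r * ((V u + T u r) * f (V u + T u r))))
              = (\<Sum>u\<in>U. m u * (\<Sum>r\<in>R. p u r * (T u r * f (V u + T u r)))) / b"
begin

definition E :: "(real \<Rightarrow> real) \<Rightarrow> real" where
  "E h = (\<Sum>u\<in>U. m u * (\<Sum>r\<in>R. p u r * h (V u + T u r)))"

lemma E_mono:
  assumes "\<And>u r. u \<in> U \<Longrightarrow> r \<in> R \<Longrightarrow> h (V u + T u r) \<le> k (V u + T u r)"
  shows "E h \<le> E k"
  unfolding E_def by (intro sum_mono mult_left_mono m_nonneg p_nonneg assms) auto

lemma E_const: "E (\<lambda>_. c) = c"
proof -
  have "E (\<lambda>_. c) = (\<Sum>u\<in>U. m u * (c * (\<Sum>r\<in>R. p u r)))"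
    by (simp add: E_def sum_distrib_left mult.commute)
  also have "\<dots> = (\<Sum>u\<in>U. m u * c)"
    by (rule sum.cong) (simp_all add: p_sum)
  also have "\<dots> = c" using m_sum by (simp flip: sum_distrib_right)
  finally show ?thesis .
qed

lemma E_add: "E (\<lambda>w. h w + k w) = E h + E k"
  by (simp add: E_def distrib_left sum.distrib)

lemma E_cmult: "E (\<lambda>w. c * h w) = c * E h"
  by (simp add: E_def sum_distrib_left mult_ac)

definition distribution :: "real \<Rightarrow> real" where
  "distribution z = E (\<lambda>w. if w \<le> z then 1 else 0)"

end

text \<open>Outside the exceptional set B the last step is at most \<delta>. The number K is a crude bound
  on everything, and the probability of B is small even compared with \<open>K\<^bsup>-q\<^esup>\<close>. Constants may depend
  on \<Delta> and q, but not on \<delta> or K.\<close>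

locale stein_step_bounded = stein_step U R m p V T b
  for U :: "'a set" and R :: "'b set" and m p V T b +
  fixes B :: "'a set" and \<delta> \<Delta> K :: real and q :: nat
  assumes small: "u \<in> U - B \<Longrightarrow> r \<in> R \<Longrightarrow> p u r \<noteq> 0 \<Longrightarrow> \<bar>T u r\<bar> \<le> \<delta>"
    and V_bound: "u \<in> U \<Longrightarrow> \<bar>V u\<bar> \<le> K / 2"
    and T_bound: "u \<in> U \<Longrightarrow> r \<in> R \<Longrightarrow> \<bar>T u r\<bar> \<le> K / 2"
    and K1: "1 \<le> K" and Kb: "1 \<le> K * b"
    and delta_pos: "0 < \<delta>" and delta_le: "\<delta> \<le> \<Delta>" and delta_K: "1 \<le> \<delta> * K"
    and bad: "(\<Sum>u\<in>U \<inter> B. m u) * K ^ q \<le> \<delta>"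
begin

abbreviation \<epsilon> :: real where "\<epsilon> \<equiv> (\<Sum>u\<in>U \<inter> B. m u)"

lemma eps_nonneg: "0 \<le> \<epsilon>"
  by (intro sum_nonneg m_nonneg) auto

lemma W_bound: "u \<in> U \<Longrightarrow> r \<in> R \<Longrightarrow> \<bar>V u + T u r\<bar> \<le> K"
  using V_bound[of u] T_bound[of u r] by linarith

lemma split_good_bad: "(\<Sum>u\<in>U. h u) = (\<Sum>u\<in>U - B. h u) + (\<Sum>u\<in>U \<inter> B. h u)" for h :: "'a \<Rightarrow> real"
  using sum.subset_diff[of "U \<inter> B" U h] fin by (simp add: Diff_Int_distrib)
   (simp add: Diff_Int)

lemma good_mass: "(\<Sum>u\<in>U - B. m u) = 1 - \<epsilon>"
  using split_good_bad[of m] m_sum by simp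

lemma eps_power_le: "j \<le> q \<Longrightarrow> \<epsilon> * K ^ j \<le> \<delta>"
  using mult_left_mono[OF power_increasing[of j q K] eps_nonneg] K1 bad by linarith

text \<open>Given u, all values of \<open>|W|\<close> are at least \<open>|V u| - \<delta>\<close>, so moments of V are controlled by
  moments of W.\<close>

lemma decouple:
  assumes "0 \<le> c"
  shows "(\<Sum>u\<in>U - B. m u * (\<bar>V u\<bar> + c) ^ j) \<le> E (\<lambda>w. (\<bar>w\<bar> + (c + \<delta>)) ^ j)"
proof -
  have "(\<Sum>u\<in>U - B. m u * (\<bar>V u\<bar> + c) ^ j)
      \<le> (\<Sum>u\<in>U - B. m u * (\<Sum>r\<in>R. p u r * (\<bar>V u + T u r\<bar> + (c + \<delta>)) ^ j))"
  proof (intro sum_mono mult_left_mono m_nonneg)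
    fix u assume u: "u \<in> U - B"
    have "(\<bar>V u\<bar> + c) ^ j = (\<Sum>r\<in>R. p u r * (\<bar>V u\<bar> + c) ^ j)"
      using u p_sum[of u] by (simp flip: sum_distrib_right)
    also have "\<dots> \<le> (\<Sum>r\<in>R. p u r * (\<bar>V u + T u r\<bar> + (c + \<delta>)) ^ j)"
    proof (rule sum_mono)
      fix r assume r: "r \<in> R"
      show "p u r * (\<bar>V u\<bar> + c) ^ j \<le> p u r * (\<bar>V u + T u r\<bar> + (c + \<delta>)) ^ j"
        using small[OF u r] p_nonneg[of u r] u r assms
        by (cases "p u r = 0") (auto intro!: mult_left_mono power_mono)
    qed
    finally show "(\<bar>V u\<bar> + c) ^ j \<le> (\<Sum>r\<in>R. p u r * (\<bar>V u + T u r\<bar> + (c + \<delta>)) ^ j)" .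
  qed auto
  also have "\<dots> \<le> E (\<lambda>w. (\<bar>w\<bar> + (c + \<delta>)) ^ j)"
    unfolding E_def using assms delta_pos fin
    by (intro sum_mono2 mult_nonneg_nonneg m_nonneg sum_nonneg p_nonneg) auto
  finally show ?thesis .
qed

text \<open>If \<open>c u\<close> bounds \<open>F'\<close> from above within distance \<delta> of \<open>V u\<close>, it bounds the contribution
  of u to \<open>E[T F(V + T)] / b\<close>: since T has conditional mean 0, one may subtract \<open>F (V u)\<close>, and
  then \<open>E[c T\<^sup>2] = c b\<close>. Applied to F and \<open>- F\<close> this replaces the zero-bias coupling without
  constructing it.\<close>

lemma stein_upper:
  assumes good: "\<And>u t. u \<in> U - B \<Longrightarrow> \<bar>t\<bar> \<le> \<delta> \<Longrightarrow> t * (F (V u + t) - F (V u)) \<le> c u * t\<^sup>2"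
    and M: "\<And>w. \<bar>w\<bar> \<le> K \<Longrightarrow> \<bar>F w\<bar> \<le> M"
  shows "E (\<lambda>w. w * F w) \<le> (\<Sum>u\<in>U - B. m u * c u) + \<epsilon> * (K\<^sup>2 * M)"
proof -
  have "0 \<le> M" using M[of 0] K1 by simp
  define X where "X u = (\<Sum>r\<in>R. p u r * (T u r * F (V u + T u r)))" for u
  have goodX: "X u \<le> c u * b" if u: "u \<in> U - B" for u
  proof -
    have "X u = X u - (\<Sum>r\<in>R. p u r * T u r) * F (V u)"
      using u T_mean[of u] by simp
    also have "\<dots> = (\<Sum>r\<in>R. p u r * (T u r * (F (V u + T u r) - F (V u))))"
      unfolding X_def sum_distrib_right sum_subtractf[symmetric]
      by (intro sum.cong) (simp_all add: algebra_simps)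
    also have "\<dots> \<le> (\<Sum>r\<in>R. p u r * (c u * (T u r)\<^sup>2))"
    proof (rule sum_mono)
      fix r assume r: "r \<in> R"
      show "p u r * (T u r * (F (V u + T u r) - F (V u))) \<le> p u r * (c u * (T u r)\<^sup>2)"
        using small[OF u r] p_nonneg[of u r] u r good[OF u, of "T u r"]
        by (cases "p u r = 0") (auto intro!: mult_left_mono)
    qed
    also have "\<dots> = c u * (\<Sum>r\<in>R. p u r * (T u r)\<^sup>2)"
      by (simp add: sum_distrib_left mult_ac)
    finally show ?thesis using T_var[of u] u by simp
  qed
  have badX: "X u \<le> K * M" if u: "u \<in> U \<inter> B" for u
  proof -
    have "X u \<le> (\<Sum>r\<in>R. p u r * (K * M))"
      unfolding X_def
    proof (intro sum_mono mult_left_mono)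
      fix r assume r: "r \<in> R"
      have "\<bar>T u r * F (V u + T u r)\<bar> \<le> K * M"
        unfolding abs_mult using u r T_bound[of u r] K1 W_bound[of u r] \<open>0 \<le> M\<close>
        by (intro mult_mono M) auto
      then show "T u r * F (V u + T u r) \<le> K * M" by simp
    qed (use u p_nonneg in auto)
    then show ?thesis using p_sum[of u] u by (simp flip: sum_distrib_right)
  qed
  have "E (\<lambda>w. w * F w) = (\<Sum>u\<in>U. m u * X u) / b"
    unfolding E_def X_def by (rule stein)
  also have "(\<Sum>u\<in>U. m u * X u) \<le> (\<Sum>u\<in>U - B. m u * (c u * b)) + (\<Sum>u\<in>U \<inter> B. m u * (K * M))"
    unfolding split_good_bad
    by (intro add_mono sum_mono mult_left_mono goodX badX m_nonneg) auto
  also have "\<dots> = (\<Sum>u\<in>U - B. m u * c u) * b + \<epsilon> * (K * M)"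
    by (simp only: sum_distrib_right mult.assoc)
  \<comment> \<open>This is where \<open>1 / b \<le> K\<close> enters.\<close>
  also have "\<epsilon> * (K * M) \<le> \<epsilon> * (K\<^sup>2 * M) * b"
  proof -
    have "K * M * 1 \<le> K * M * (K * b)"
      using Kb K1 \<open>0 \<le> M\<close> by (intro mult_left_mono) auto
    then have "\<epsilon> * (K * M) \<le> \<epsilon> * (K * M * (K * b))"
      using eps_nonneg by (intro mult_left_mono) auto
    then show ?thesis by (simp add: power2_eq_square mult_ac)
  qed
  finally show ?thesis
    using b_pos by (simp add: add_divide_distrib divide_right_mono)
qed

lemma shifted_even_moment_le:
  assumes "0 \<le> c" "c \<le> d"
  shows "E (\<lambda>w. (\<bar>w\<bar> + c) ^ (2 * k)) \<le> 2 ^ (2 * k) * (E (\<lambda>w. w ^ (2 * k)) + d ^ (2 * k))"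
proof -
  have "E (\<lambda>w. (\<bar>w\<bar> + c) ^ (2 * k)) \<le> E (\<lambda>w. 2 ^ (2 * k) * (w ^ (2 * k) + d ^ (2 * k)))"
  proof (rule E_mono)
    fix u r
    let ?w = "V u + T u r"
    have "(\<bar>?w\<bar> + c) ^ (2 * k) \<le> (\<bar>?w\<bar> + d) ^ (2 * k)"
      using assms by (intro power_mono) auto
    also have "\<dots> \<le> 2 ^ (2 * k) * (\<bar>?w\<bar> ^ (2 * k) + d ^ (2 * k))"
      using assms by (intro power_add_le) auto
    finally show "(\<bar>?w\<bar> + c) ^ (2 * k) \<le> 2 ^ (2 * k) * (?w ^ (2 * k) + d ^ (2 * k))"
      by (simp add: power_even_abs)
  qed
  also have "\<dots> = 2 ^ (2 * k) * (E (\<lambda>w. w ^ (2 * k)) + d ^ (2 * k))"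
    by (simp only: E_cmult E_add E_const)
  finally show ?thesis .
qed

text \<open>The Stein identity for \<open>F(w) = w\<^bsup>2k+1\<^esup>\<close> expresses a moment through lower ones.\<close>

lemma even_moment_le:
  assumes "2 * k + 1 \<le> q"
  shows "E (\<lambda>w. w ^ (2 * k)) \<le> moment_bound \<Delta> k"
  using assms
proof (induction k)
  case 0
  then show ?case by (simp add: E_const)
next
  case (Suc k)
  define c where "c u = real (2 * k + 1) * (\<bar>V u\<bar> + \<delta>) ^ (2 * k)" for u
  have "E (\<lambda>w. w ^ (2 * Suc k)) = E (\<lambda>w. w * w ^ (2 * k + 1))"
    by (simp add: power_Suc)
  also have "\<dots> \<le> (\<Sum>u\<in>U - B. m u * c u) + \<epsilon> * (K\<^sup>2 * K ^ (2 * k + 1))"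
  proof (rule stein_upper)
    show "t * ((V u + t) ^ (2 * k + 1) - V u ^ (2 * k + 1)) \<le> c u * t\<^sup>2" if "\<bar>t\<bar> \<le> \<delta>" for u t
    proof (rule weighted_increment_le[where z = 0 and F' = "\<lambda>x. real (2 * k + 1) * x ^ (2 * k)", OF _ that])
      show "isCont (\<lambda>x. x ^ (2 * k + 1)) x" for x :: real by (intro continuous_intros)
      show "((\<lambda>x. x ^ (2 * k + 1)) has_real_derivative real (2 * k + 1) * x ^ (2 * k)) (at x)" for x :: real
        using DERIV_pow[of "2 * k + 1" x UNIV] by simp
      show "real (2 * k + 1) * x ^ (2 * k) \<le> c u" if "\<bar>x - V u\<bar> \<le> \<delta>" for x
      proof -
        have "\<bar>x\<bar> ^ (2 * k) \<le> (\<bar>V u\<bar> + \<delta>) ^ (2 * k)" using that by (intro power_mono) auto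
        then show ?thesis unfolding c_def by (intro mult_left_mono) (auto simp: power_even_abs)
      qed
    qed
    show "\<bar>w ^ (2 * k + 1)\<bar> \<le> K ^ (2 * k + 1)" if "\<bar>w\<bar> \<le> K" for w
      using that by (simp only: power_abs) (intro power_mono, auto)
  qed
  also have "\<epsilon> * (K\<^sup>2 * K ^ (2 * k + 1)) = \<epsilon> * K ^ (2 * k + 3)"
    by (simp add: power_add power2_eq_square power3_eq_cube)
  also have "\<dots> \<le> \<Delta>"
    using eps_power_le[of "2 * k + 3"] Suc.prems delta_le by simp
  also have "(\<Sum>u\<in>U - B. m u * c u) = real (2 * k + 1) * (\<Sum>u\<in>U - B. m u * (\<bar>V u\<bar> + \<delta>) ^ (2 * k))"
    unfolding c_def sum_distrib_left by (intro sum.cong) auto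
  also have "(\<Sum>u\<in>U - B. m u * (\<bar>V u\<bar> + \<delta>) ^ (2 * k)) \<le> E (\<lambda>w. (\<bar>w\<bar> + (\<delta> + \<delta>)) ^ (2 * k))"
    using delta_pos by (intro decouple) auto
  also have "\<dots> \<le> 2 ^ (2 * k) * (E (\<lambda>w. w ^ (2 * k)) + (2 * \<Delta>) ^ (2 * k))"
    using delta_pos delta_le by (intro shifted_even_moment_le) auto
  also have "\<dots> \<le> 2 ^ (2 * k) * (moment_bound \<Delta> k + (2 * \<Delta>) ^ (2 * k))"
    using Suc by (intro mult_left_mono add_right_mono) auto
  finally show ?case by (simp add: mult_left_mono)
qed

text \<open>A bound for the oscillation of \<open>w f(w)\<close> within distance \<delta> of \<open>V u\<close>, see \<open>osc_bound\<close>.\<close>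

definition osc :: "nat \<Rightarrow> real \<Rightarrow> 'a \<Rightarrow> real" where
  "osc j z u = \<delta> * (decay_const j * (1 + \<bar>V u\<bar> + \<delta>) ^ (j + 2) / (1 + \<bar>z\<bar>) ^ j)"

lemma osc_bound:
  "\<bar>w - V u\<bar> \<le> \<delta> \<Longrightarrow> \<bar>w * stein_sol z w - V u * stein_sol z (V u)\<bar> \<le> osc j z u"
  unfolding osc_def by (rule stein_sol_times_lipschitz)

lemma osc_sum_le:
  assumes "2 * i + 3 \<le> q"
  shows "2 * (\<Sum>u\<in>U - B. m u * osc (2 * i) z u)
     \<le> \<delta> * (2 * decay_const (2 * i) * (2 ^ (2 * i + 2) * (moment_bound \<Delta> (i + 1) + (1 + 2 * \<Delta>) ^ (2 * i + 2))))
        / (1 + \<bar>z\<bar>) ^ (2 * i)"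
proof -
  define A where "A = 2 ^ (2 * i + 2) * (moment_bound \<Delta> (i + 1) + (1 + 2 * \<Delta>) ^ (2 * i + 2))"
  have "(\<Sum>u\<in>U - B. m u * (\<bar>V u\<bar> + (1 + \<delta>)) ^ (2 * (i + 1))) \<le> E (\<lambda>w. (\<bar>w\<bar> + (1 + \<delta> + \<delta>)) ^ (2 * (i + 1)))"
    using delta_pos by (intro decouple) auto
  also have "\<dots> \<le> 2 ^ (2 * (i + 1)) * (E (\<lambda>w. w ^ (2 * (i + 1))) + (1 + 2 * \<Delta>) ^ (2 * (i + 1)))"
    using delta_pos delta_le by (intro shifted_even_moment_le) auto
  also have "\<dots> \<le> 2 ^ (2 * (i + 1)) * (moment_bound \<Delta> (i + 1) + (1 + 2 * \<Delta>) ^ (2 * (i + 1)))"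
    using assms by (intro mult_left_mono add_right_mono even_moment_le) auto
  also have "\<dots> = A" by (simp add: A_def)
  finally have "(\<Sum>u\<in>U - B. m u * (\<bar>V u\<bar> + (1 + \<delta>)) ^ (2 * (i + 1))) \<le> A" .
  then have "2 * \<delta> * decay_const (2 * i) / (1 + \<bar>z\<bar>) ^ (2 * i)
      * (\<Sum>u\<in>U - B. m u * (\<bar>V u\<bar> + (1 + \<delta>)) ^ (2 * (i + 1)))
      \<le> 2 * \<delta> * decay_const (2 * i) / (1 + \<bar>z\<bar>) ^ (2 * i) * A"
    using delta_pos decay_const_pos[of "2 * i"] by (intro mult_left_mono) auto
  moreover have "2 * (\<Sum>u\<in>U - B. m u * osc (2 * i) z u) = 2 * \<delta> * decay_const (2 * i) / (1 + \<bar>z\<bar>) ^ (2 * i)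
      * (\<Sum>u\<in>U - B. m u * (\<bar>V u\<bar> + (1 + \<delta>)) ^ (2 * (i + 1)))"
    unfolding sum_distrib_left osc_def
    by (intro sum.cong refl) (simp add: add_ac mult_ac)
  ultimately show ?thesis by (simp add: A_def mult_ac)
qed

lemma stein_times_sum_le:
  "\<bar>E (\<lambda>w. w * stein_sol z w) - (\<Sum>u\<in>U - B. m u * (V u * stein_sol z (V u)))\<bar>
     \<le> (\<Sum>u\<in>U - B. m u * osc j z u) + \<epsilon> * (5 * K)"
proof -
  define g where "g w = w * stein_sol z w" for w
  define X where "X u = (\<Sum>r\<in>R. p u r * g (V u + T u r))" for u
  have "E g - (\<Sum>u\<in>U - B. m u * g (V u)) = (\<Sum>u\<in>U - B. m u * (X u - g (V u))) + (\<Sum>u\<in>U \<inter> B. m u * X u)"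
    by (simp add: E_def X_def split_good_bad right_diff_distrib sum_subtractf)
  moreover have "\<bar>(\<Sum>u\<in>U - B. m u * (X u - g (V u)))\<bar> \<le> (\<Sum>u\<in>U - B. m u * osc j z u)"
  proof (rule order_trans[OF sum_abs], rule sum_mono)
    fix u assume u: "u \<in> U - B"
    have "X u - g (V u) = X u - (\<Sum>r\<in>R. p u r) * g (V u)"
      using u p_sum[of u] by simp
    also have "\<dots> = (\<Sum>r\<in>R. p u r * (g (V u + T u r) - g (V u)))"
      by (simp add: X_def sum_distrib_right sum_subtractf right_diff_distrib)
    also have "\<bar>\<dots>\<bar> \<le> (\<Sum>r\<in>R. p u r * osc j z u)"
    proof (rule order_trans[OF sum_abs], rule sum_mono)
      fix r assume r: "r \<in> R"
      show "\<bar>p u r * (g (V u + T u r) - g (V u))\<bar> \<le> p u r * osc j z u"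
        using small[OF u r] p_nonneg[of u r] u r osc_bound[of "V u + T u r" u z j]
        by (cases "p u r = 0") (auto simp: abs_mult g_def intro!: mult_left_mono)
    qed
    also have "\<dots> = osc j z u" using u p_sum[of u] by (simp flip: sum_distrib_right)
    finally show "\<bar>m u * (X u - g (V u))\<bar> \<le> m u * osc j z u"
      using u m_nonneg[of u] by (auto simp: abs_mult intro!: mult_left_mono)
  qed
  moreover have "\<bar>(\<Sum>u\<in>U \<inter> B. m u * X u)\<bar> \<le> \<epsilon> * (5 * K)"
    unfolding sum_distrib_right
  proof (rule order_trans[OF sum_abs], rule sum_mono)
    fix u assume u: "u \<in> U \<inter> B"
    have "\<bar>X u\<bar> \<le> (\<Sum>r\<in>R. p u r * (5 * K))"
      unfolding X_def
    proof (rule order_trans[OF sum_abs], rule sum_mono)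
      fix r assume r: "r \<in> R"
      have "\<bar>g (V u + T u r)\<bar> \<le> K * 5"
        unfolding g_def abs_mult using u r W_bound[of u r] stein_sol_nonneg stein_sol_le K1
        by (intro mult_mono) auto
      then show "\<bar>p u r * g (V u + T u r)\<bar> \<le> p u r * (5 * K)"
        using u r p_nonneg[of u r] by (auto simp: abs_mult intro!: mult_left_mono)
    qed
    also have "\<dots> = 5 * K" using u p_sum[of u] by (simp flip: sum_distrib_right)
    finally show "\<bar>m u * X u\<bar> \<le> m u * (5 * K)"
      using u m_nonneg[of u] by (auto simp: abs_mult intro!: mult_left_mono)
  qed
  ultimately show ?thesis
    unfolding g_def[symmetric, abs_def] by linarith
qed

text \<open>Near \<open>V u\<close>, the derivative of the Stein solution is at most its value \<open>w f(w) - \<Phi>(z)\<close> at \<open>V u\<close>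
  plus the oscillation, plus 1 unless the whole neighbourhood lies to the right of z. Inserted
  in the Stein identity, the two averages of \<open>w f(w)\<close> cancel up to the oscillation.\<close>

lemma gauss_cdf_le_V:
  "gauss_cdf z \<le> (\<Sum>u\<in>U - B. m u * (if V u \<le> z + \<delta> then 1 else 0))
     + 2 * (\<Sum>u\<in>U - B. m u * osc j z u) + 11 * (\<epsilon> * K\<^sup>2)"
proof -
  define c where "c u = V u * stein_sol z (V u) + osc j z u
      + (if V u \<le> z + \<delta> then 1 else 0) - gauss_cdf z" for u
  have "E (\<lambda>w. w * stein_sol z w) \<le> (\<Sum>u\<in>U - B. m u * c u) + \<epsilon> * (K\<^sup>2 * 5)"
  proof (rule stein_upper)
    show "t * (stein_sol z (V u + t) - stein_sol z (V u)) \<le> c u * t\<^sup>2" if "\<bar>t\<bar> \<le> \<delta>" for u t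
    proof (rule weighted_increment_le[OF stein_sol_continuous that stein_sol_deriv])
      fix x assume x: "x \<noteq> z" "\<bar>x - V u\<bar> \<le> \<delta>"
      show "x * stein_sol z x + (if x \<le> z then 1 else 0) - gauss_cdf z \<le> c u"
        using osc_bound[OF x(2), of z j] x by (auto simp: c_def)
    qed
    show "\<bar>stein_sol z w\<bar> \<le> 5" for w using stein_sol_nonneg[of z w] stein_sol_le[of z w] by simp
  qed
  moreover have "(\<Sum>u\<in>U - B. m u * c u) = (\<Sum>u\<in>U - B. m u * (V u * stein_sol z (V u)))
      + (\<Sum>u\<in>U - B. m u * osc j z u) + (\<Sum>u\<in>U - B. m u * (if V u \<le> z + \<delta> then 1 else 0))
      - (1 - \<epsilon>) * gauss_cdf z"
    unfolding good_mass[symmetric] sum_distrib_right c_def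
    by (simp add: algebra_simps sum.distrib sum_subtractf del: mult_if_delta)
  moreover have "\<epsilon> * gauss_cdf z \<le> \<epsilon> * K\<^sup>2"
    using gauss_cdf_le_1[of z] one_le_power[OF K1, of 2] eps_nonneg by (intro mult_left_mono) auto
  moreover have "\<epsilon> * (5 * K) \<le> \<epsilon> * (5 * K\<^sup>2)"
    using K1 eps_nonneg by (intro mult_left_mono) (auto simp: power2_eq_square)
  ultimately show ?thesis
    using stein_times_sum_le[of z j] by (simp add: algebra_simps abs_le_iff)
qed

text \<open>The mirror image, with \<open>- f\<close> in place of f.\<close>

lemma V_le_gauss_cdf:
  "(\<Sum>u\<in>U - B. m u * (if V u \<le> z - \<delta> then 1 else 0))
     \<le> gauss_cdf z + 2 * (\<Sum>u\<in>U - B. m u * osc j z u) + 11 * (\<epsilon> * K\<^sup>2)"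
proof -
  define c where "c u = - (V u * stein_sol z (V u)) + osc j z u
      - (if V u \<le> z - \<delta> then 1 else 0) + gauss_cdf z" for u
  have "E (\<lambda>w. w * (- stein_sol z w)) \<le> (\<Sum>u\<in>U - B. m u * c u) + \<epsilon> * (K\<^sup>2 * 5)"
  proof (rule stein_upper)
    show "t * (- stein_sol z (V u + t) - (- stein_sol z (V u))) \<le> c u * t\<^sup>2" if "\<bar>t\<bar> \<le> \<delta>" for u t
    proof (rule weighted_increment_le[OF _ that])
      show "isCont (\<lambda>x. - stein_sol z x) x" for x
        by (intro continuous_intros stein_sol_continuous)
      show "((\<lambda>x. - stein_sol z x) has_real_derivative
          - (x * stein_sol z x + (if x \<le> z then 1 else 0) - gauss_cdf z)) (at x)" if "x \<noteq> z" for x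
        by (intro DERIV_minus stein_sol_deriv that)
      fix x assume x: "x \<noteq> z" "\<bar>x - V u\<bar> \<le> \<delta>"
      show "- (x * stein_sol z x + (if x \<le> z then 1 else 0) - gauss_cdf z) \<le> c u"
        using osc_bound[OF x(2), of z j] x by (auto simp: c_def)
    qed
    show "\<bar>- stein_sol z w\<bar> \<le> 5" for w using stein_sol_nonneg[of z w] stein_sol_le[of z w] by simp
  qed
  moreover have "E (\<lambda>w. w * (- stein_sol z w)) = - E (\<lambda>w. w * stein_sol z w)"
    using E_cmult[of "-1" "\<lambda>w. w * stein_sol z w"] by simp
  moreover have "(\<Sum>u\<in>U - B. m u * c u) = - (\<Sum>u\<in>U - B. m u * (V u * stein_sol z (V u)))
      + (\<Sum>u\<in>U - B. m u * osc j z u) - (\<Sum>u\<in>U - B. m u * (if V u \<le> z - \<delta> then 1 else 0))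
      + (1 - \<epsilon>) * gauss_cdf z"
    unfolding good_mass[symmetric] sum_distrib_right c_def
    by (simp add: algebra_simps sum.distrib sum_subtractf sum_negf del: mult_if_delta)
  moreover have "0 \<le> \<epsilon> * gauss_cdf z" "0 \<le> \<epsilon> * K\<^sup>2"
    using gauss_cdf_nonneg[of z] eps_nonneg by auto
  moreover have "\<epsilon> * (5 * K) \<le> \<epsilon> * (5 * K\<^sup>2)"
    using K1 eps_nonneg by (intro mult_left_mono) (auto simp: power2_eq_square)
  ultimately show ?thesis
    using stein_times_sum_le[of z j] by (simp add: algebra_simps abs_le_iff)
qed


lemma distribution_le_V:
  "distribution z \<le> (\<Sum>u\<in>U - B. m u * (if V u \<le> z + \<delta> then 1 else 0)) + \<epsilon>"
proof -
  define X where "X u = (\<Sum>r\<in>R. p u r * (if V u + T u r \<le> z then 1 else 0))" for u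
  have X1: "X u \<le> 1" if "u \<in> U" for u
  proof -
    have "X u \<le> (\<Sum>r\<in>R. p u r * 1)"
      unfolding X_def using that p_nonneg by (intro sum_mono mult_left_mono) auto
    then show ?thesis using p_sum[OF that] by simp
  qed
  have X0: "X u \<le> (if V u \<le> z + \<delta> then 1 else 0)" if u: "u \<in> U - B" for u
  proof (cases "V u \<le> z + \<delta>")
    case False
    have "X u = (\<Sum>r\<in>R. 0)"
      unfolding X_def
    proof (rule sum.cong[OF refl])
      fix r assume "r \<in> R"
      then show "p u r * (if V u + T u r \<le> z then 1 else 0) = 0"
        using small[OF u, of r] False by (cases "p u r = 0") auto
    qed
    then show ?thesis using False by simp
  qed (use X1 u in auto)
  have "distribution z = (\<Sum>u\<in>U - B. m u * X u) + (\<Sum>u\<in>U \<inter> B. m u * X u)"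
    unfolding distribution_def E_def X_def[symmetric] by (rule split_good_bad)
  also have "\<dots> \<le> (\<Sum>u\<in>U - B. m u * (if V u \<le> z + \<delta> then 1 else 0)) + (\<Sum>u\<in>U \<inter> B. m u * 1)"
    by (intro add_mono sum_mono mult_left_mono X0 X1 m_nonneg) auto
  finally show ?thesis by simp
qed

lemma V_le_distribution:
  "(\<Sum>u\<in>U - B. m u * (if V u \<le> z - \<delta> then 1 else 0)) \<le> distribution z"
proof -
  define X where "X u = (\<Sum>r\<in>R. p u r * (if V u + T u r \<le> z then 1 else 0))" for u
  have X0: "0 \<le> X u" if "u \<in> U" for u
    unfolding X_def using that p_nonneg by (intro sum_nonneg) auto
  have X1: "(if V u \<le> z - \<delta> then 1 else 0) \<le> X u" if u: "u \<in> U - B" for u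
  proof (cases "V u \<le> z - \<delta>")
    case True
    have "X u = (\<Sum>r\<in>R. p u r)"
      unfolding X_def
    proof (rule sum.cong[OF refl])
      fix r assume "r \<in> R"
      then show "p u r * (if V u + T u r \<le> z then 1 else 0) = p u r"
        using small[OF u, of r] True by (cases "p u r = 0") auto
    qed
    then show ?thesis using True u p_sum[of u] by simp
  qed (use X0 u in auto)
  have "(\<Sum>u\<in>U - B. m u * (if V u \<le> z - \<delta> then 1 else 0)) + (\<Sum>u\<in>U \<inter> B. m u * 0)
      \<le> (\<Sum>u\<in>U - B. m u * X u) + (\<Sum>u\<in>U \<inter> B. m u * X u)"
    by (intro add_mono sum_mono mult_left_mono X0 X1 m_nonneg) auto
  also have "\<dots> = distribution z"
    unfolding distribution_def E_def X_def[symmetric] by (rule split_good_bad[symmetric])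
  finally show ?thesis by simp
qed

text \<open>The density decays faster than any power, and \<open>1 + |z|\<close> changes by a bounded factor within distance
  \<open>2 \<Delta>\<close>.\<close>

lemma gauss_cdf_shift:
  assumes "\<bar>t\<bar> \<le> 2 * \<delta>"
  shows "\<bar>gauss_cdf (z + t) - gauss_cdf z\<bar>
    \<le> \<delta> * ((1 + 2 * \<Delta>) ^ j * (2 * exp (real j ^ 2))) / (1 + \<bar>z\<bar>) ^ j"
proof -
  have key: "gauss_cdf y - gauss_cdf x
      \<le> \<delta> * ((1 + 2 * \<Delta>) ^ j * (2 * exp (real j ^ 2))) / (1 + \<bar>z\<bar>) ^ j"
    if xy: "x \<le> y" "y - x \<le> 2 * \<delta>" "z = x \<or> z = y" for x y
  proof -
    define M where "M = (1 + 2 * \<Delta>) ^ j * exp (real j ^ 2) / (1 + \<bar>z\<bar>) ^ j"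
    have M0: "0 \<le> M" using delta_pos delta_le by (simp add: M_def)
    have "gauss_cdf y - gauss_cdf x \<le> M * (y - x)"
    proof (rule mean_value_except_point[OF xy(1) DERIV_isCont[OF gauss_cdf_deriv] gauss_cdf_deriv])
      fix w assume w: "x \<le> w" "w \<le> y"
      have wz: "1 + \<bar>z\<bar> \<le> (1 + 2 * \<Delta>) * (1 + \<bar>w\<bar>)"
      proof -
        have "\<bar>z\<bar> \<le> \<bar>w\<bar> + 2 * \<Delta>" using w xy delta_le by linarith
        moreover have "0 \<le> 2 * \<Delta> * \<bar>w\<bar>" using delta_pos delta_le by simp
        ultimately show ?thesis by (simp add: algebra_simps)
      qed
      then have "(1 + \<bar>z\<bar>) ^ j \<le> (1 + 2 * \<Delta>) ^ j * (1 + \<bar>w\<bar>) ^ j"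
        unfolding power_mult_distrib[symmetric] by (intro power_mono) auto
      then have "exp (real j ^ 2) / (1 + \<bar>w\<bar>) ^ j \<le> M"
        by (simp add: M_def field_simps)
      then show "std_normal_density w \<le> M"
        using gauss_density_le_power[of w j] by linarith
    qed
    also have "\<dots> \<le> M * (2 * \<delta>)" using xy M0 by (intro mult_left_mono)
    finally show ?thesis by (simp add: M_def mult_ac)
  qed
  have mono: "gauss_cdf x \<le> gauss_cdf y" if "x \<le> y" for x y
    using that by (rule gauss.cdf_nondecreasing)
  show ?thesis
    using key[of z "z + t"] key[of "z + t" z] mono[of z "z + t"] mono[of "z + t" z] assms
    by (cases "0 \<le> t") auto
qed

text \<open>Beyond the range of W only the Gaussian tail is left. One spare power of \<open>1 + |z| > K\<close> turns
  into the factor \<delta>, because \<open>\<delta> K \<ge> 1\<close>.\<close>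

lemma distribution_outside:
  assumes "K < \<bar>z\<bar>"
  shows "\<bar>distribution z - gauss_cdf z\<bar> \<le> 5 * exp (real (j + 1) ^ 2) * \<delta> / (1 + \<bar>z\<bar>) ^ j"
proof -
  have tail: "1 - gauss_cdf \<bar>z\<bar> \<le> 5 * exp (real (j + 1) ^ 2) * \<delta> / (1 + \<bar>z\<bar>) ^ j"
  proof -
    have "1 - gauss_cdf \<bar>z\<bar> \<le> 5 * std_normal_density \<bar>z\<bar>"
      by (rule gauss_tail_le_density) simp
    also have "\<dots> \<le> 5 * (exp (real (j + 1) ^ 2) / (1 + \<bar>z\<bar>) ^ (j + 1))"
      using gauss_density_le_power[of "\<bar>z\<bar>" "j + 1"] by simp
    also have "\<dots> = 5 * exp (real (j + 1) ^ 2) / (1 + \<bar>z\<bar>) ^ j * (1 / (1 + \<bar>z\<bar>))"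
      by simp
    also have "\<dots> \<le> 5 * exp (real (j + 1) ^ 2) / (1 + \<bar>z\<bar>) ^ j * \<delta>"
    proof (rule mult_left_mono)
      have "1 \<le> \<delta> * (1 + \<bar>z\<bar>)"
        using delta_K assms delta_pos mult_left_mono[of K "1 + \<bar>z\<bar>" \<delta>] by linarith
      then show "1 / (1 + \<bar>z\<bar>) \<le> \<delta>"
        by (simp add: pos_divide_le_eq)
    qed simp
    finally show ?thesis by simp
  qed
  show ?thesis
  proof (cases "0 \<le> z")
    case True
    have "distribution z = E (\<lambda>_. 1)"
      unfolding distribution_def E_def
    proof (intro sum.cong refl arg_cong2[where f = "(*)"])
      fix u r assume "u \<in> U" "r \<in> R"
      then show "(if V u + T u r \<le> z then 1 else 0) = (1::real)"
        using W_bound[of u r] True assms by auto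
    qed
    then show ?thesis using tail True gauss_cdf_le_1[of z] by (simp add: E_const)
  next
    case False
    have "distribution z = E (\<lambda>_. 0)"
      unfolding distribution_def E_def
    proof (intro sum.cong refl arg_cong2[where f = "(*)"])
      fix u r assume "u \<in> U" "r \<in> R"
      then show "(if V u + T u r \<le> z then 1 else 0) = (0::real)"
        using W_bound[of u r] False assms by auto
    qed
    then show ?thesis
      using tail False gauss_cdf_nonneg[of z] gauss_cdf_minus[of z] by (simp add: E_const)
  qed
qed

text \<open>Comparing W with V costs a shift by \<delta>, comparing V with the normal law another one;
  hence the previous estimates are used at \<open>z \<plusminus> 2 \<delta>\<close>. For \<open>|z| \<le> K\<close> the exceptional probability is
  absorbed by \<open>K\<^bsup>-q\<^esup>\<close>: two powers of K bound the Stein terms and \<open>2 i\<close> powers pay for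
  \<open>(1 + |z|)\<^bsup>2i\<^esup>\<close>; one more is used by the moment of order \<open>2 i + 2\<close>.\<close>

theorem nonuniform_berry_esseen:
  assumes q: "q = 2 * i + 3"
  shows "\<bar>distribution z - gauss_cdf z\<bar> \<le> berry_esseen_const \<Delta> i * \<delta> / (1 + \<bar>z\<bar>) ^ (2 * i)"
proof -
  define A where "A = 2 * decay_const (2 * i)
      * (2 ^ (2 * i + 2) * (moment_bound \<Delta> (i + 1) + (1 + 2 * \<Delta>) ^ (2 * i + 2)))"
  define S where "S = 2 * exp (real (2 * i) ^ 2)"
  define c where "c = (1 + 2 * \<Delta>) ^ (2 * i)"
  define Z where "Z = (1 + \<bar>z\<bar>) ^ (2 * i)"
  have Z: "0 < Z" by (simp add: Z_def add_pos_nonneg)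
  have D: "0 < \<Delta>" using delta_pos delta_le by linarith
  have mb: "0 \<le> moment_bound \<Delta> k" for k
    using D by (induction k) auto
  have A0: "0 \<le> A" using D mb[of "i + 1"] decay_const_pos[of "2 * i"]
    by (simp add: A_def del: moment_bound.simps)
  have c0: "0 \<le> c" and S0: "0 \<le> S" using D by (simp_all add: c_def S_def)
  have C: "berry_esseen_const \<Delta> i = c * (A + S) + 12 * 4 ^ i + 5 * exp (real (2 * i + 1) ^ 2)"
    by (simp only: berry_esseen_const_def A_def S_def c_def)
  show ?thesis
  proof (cases "K < \<bar>z\<bar>")
    case True
    have "\<bar>distribution z - gauss_cdf z\<bar> \<le> 5 * exp (real (2 * i + 1) ^ 2) * \<delta> / Z"
      using distribution_outside[OF True, of "2 * i"] by (simp only: Z_def)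
    also have "\<dots> \<le> berry_esseen_const \<Delta> i * \<delta> / Z"
      unfolding C using A0 c0 S0 delta_pos Z by (intro divide_right_mono mult_right_mono) auto
    finally show ?thesis by (simp only: Z_def)
  next
    case False
    have exc: "12 * (\<epsilon> * K\<^sup>2) \<le> 12 * 4 ^ i * \<delta> / Z"
    proof -
      have "Z \<le> (2 * K) ^ (2 * i)"
        unfolding Z_def using False K1 by (intro power_mono) auto
      also have "\<dots> = 4 ^ i * K ^ (2 * i)"
        by (simp only: power_mult_distrib power_mult) simp
      finally have "\<epsilon> * K\<^sup>2 * Z \<le> \<epsilon> * K\<^sup>2 * (4 ^ i * K ^ (2 * i))"
        using eps_nonneg by (intro mult_left_mono) auto
      also have "\<dots> = 4 ^ i * (\<epsilon> * K ^ (2 * i + 2))"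
        by (simp add: power_add power2_eq_square)
      also have "\<dots> \<le> 4 ^ i * \<delta>"
        using eps_power_le[of "2 * i + 2"] q by (intro mult_left_mono) auto
      finally show ?thesis using Z by (simp add: field_simps)
    qed
    have osc: "2 * (\<Sum>u\<in>U - B. m u * osc (2 * i) (z + t) u) \<le> c * A * \<delta> / Z" if t: "\<bar>t\<bar> \<le> 2 * \<delta>" for t
    proof -
      have "1 + \<bar>z\<bar> \<le> (1 + 2 * \<Delta>) * (1 + \<bar>z + t\<bar>)"
      proof -
        have "\<bar>z\<bar> \<le> \<bar>z + t\<bar> + 2 * \<Delta>" using t delta_le by linarith
        moreover have "0 \<le> 2 * \<Delta> * \<bar>z + t\<bar>" using D by simp
        ultimately show ?thesis by (simp add: algebra_simps)
      qed
      then have "Z \<le> c * (1 + \<bar>z + t\<bar>) ^ (2 * i)"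
        unfolding Z_def c_def power_mult_distrib[symmetric] by (intro power_mono) auto
      moreover have pos: "0 < (1 + \<bar>z + t\<bar>) ^ (2 * i)" by (simp add: add_pos_nonneg)
      ultimately have "1 / (1 + \<bar>z + t\<bar>) ^ (2 * i) \<le> c / Z"
        using Z by (simp add: field_simps)
      then have "\<delta> * A * (1 / (1 + \<bar>z + t\<bar>) ^ (2 * i)) \<le> \<delta> * A * (c / Z)"
        using delta_pos A0 by (intro mult_left_mono) auto
      moreover have "2 * (\<Sum>u\<in>U - B. m u * osc (2 * i) (z + t) u) \<le> \<delta> * A / (1 + \<bar>z + t\<bar>) ^ (2 * i)"
        unfolding A_def by (rule osc_sum_le) (simp add: q)
      ultimately show ?thesis by (simp add: mult_ac)
    qed
    have shift: "\<bar>gauss_cdf (z + t) - gauss_cdf z\<bar> \<le> c * S * \<delta> / Z" if "\<bar>t\<bar> \<le> 2 * \<delta>" for t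
      using gauss_cdf_shift[OF that, of z "2 * i"] by (simp only: c_def S_def Z_def mult_ac)
    have eps1: "\<epsilon> \<le> \<epsilon> * K\<^sup>2"
      using mult_left_mono[OF one_le_power[OF K1, of 2] eps_nonneg] by simp
    have e: "z + 2 * \<delta> - \<delta> = z + \<delta>" "z - 2 * \<delta> + \<delta> = z - \<delta>" by simp_all
    have "distribution z \<le> gauss_cdf z + (c * A * \<delta> / Z + c * S * \<delta> / Z + 12 * 4 ^ i * \<delta> / Z)"
      using distribution_le_V[of z] V_le_gauss_cdf[of "z + 2 * \<delta>" "2 * i", unfolded e]
        osc[of "2 * \<delta>"] shift[of "2 * \<delta>"] eps1 exc delta_pos
      unfolding abs_le_iff by linarith
    moreover have "gauss_cdf z \<le> distribution z + (c * A * \<delta> / Z + c * S * \<delta> / Z + 12 * 4 ^ i * \<delta> / Z)"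
      using V_le_distribution[of z] gauss_cdf_le_V[of "z - 2 * \<delta>" "2 * i", unfolded e]
        osc[of "- (2 * \<delta>)"] shift[of "- (2 * \<delta>)"] eps1 eps_nonneg exc delta_pos
      unfolding abs_le_iff diff_conv_add_uminus by linarith
    ultimately have "\<bar>distribution z - gauss_cdf z\<bar> \<le> (c * (A + S) + 12 * 4 ^ i) * \<delta> / Z"
      by (simp add: abs_le_iff add_divide_distrib algebra_simps)
    also have "\<dots> \<le> berry_esseen_const \<Delta> i * \<delta> / Z"
      unfolding C using delta_pos Z by (intro divide_right_mono mult_right_mono) auto
    finally show ?thesis by (simp only: Z_def)
  qed
qed

end

section \<open>Lagrange interpolation and power sums of nodes\<close>

definition monic_with_roots :: "(nat \<Rightarrow> real) \<Rightarrow> nat set \<Rightarrow> real poly" where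
  "monic_with_roots x A = (\<Prod>k\<in>A. [:- x k, 1:])"

lemma poly_monic_with_roots: "poly (monic_with_roots x A) t = (\<Prod>k\<in>A. t - x k)"
  by (simp add: monic_with_roots_def poly_prod)

lemma degree_monic_with_roots: "degree (monic_with_roots x A) = card A"
  by (cases "finite A") (simp_all add: monic_with_roots_def degree_prod_eq_sum_degree)

lemma lead_coeff_monic_with_roots: "coeff (monic_with_roots x A) (card A) = 1"
  using lead_coeff_prod[of "\<lambda>k. [:- x k, 1:]" A] degree_monic_with_roots[of x A]
  by (simp add: monic_with_roots_def)

text \<open>Lagrange's interpolation formula reproduces a polynomial of degree less than n from its values
  at n nodes; this compares the coefficients of \<open>x\<^bsup>n-1\<^esup>\<close>.\<close>

lemma sum_over_nodes_eq_coeff: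
  fixes x :: "nat \<Rightarrow> real"
  assumes inj: "inj_on x {..<n}" and deg: "degree f < n"
  shows "(\<Sum>r<n. poly f (x r) / (\<Prod>k\<in>{..<n} - {r}. x r - x k)) = coeff f (n - 1)"
proof -
  define c where "c r = poly f (x r) / (\<Prod>k\<in>{..<n} - {r}. x r - x k)" for r
  define R where "R = (\<Sum>r<n. smult (c r) (monic_with_roots x ({..<n} - {r})))"
  have nz: "(\<Prod>k\<in>{..<n} - {r}. x r - x k) \<noteq> 0" if "r < n" for r
    using that inj by (auto simp: prod_zero_iff inj_on_def)
  have card: "card ({..<n} - {r}) = n - 1" if "r < n" for r
    using that by simp
  have val: "poly R (x s) = poly f (x s)" if s: "s < n" for s
  proof -
    have "poly R (x s) = (\<Sum>r<n. c r * (\<Prod>k\<in>{..<n} - {r}. x s - x k))"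
      by (simp add: R_def poly_sum poly_monic_with_roots)
    also have "\<dots> = (\<Sum>r<n. if r = s then c s * (\<Prod>k\<in>{..<n} - {s}. x s - x k) else 0)"
    proof (rule sum.cong[OF refl])
      fix r assume "r \<in> {..<n}"
      show "c r * (\<Prod>k\<in>{..<n} - {r}. x s - x k)
          = (if r = s then c s * (\<Prod>k\<in>{..<n} - {s}. x s - x k) else 0)"
        using s by (auto simp: prod_zero_iff)
    qed
    also have "\<dots> = poly f (x s)"
      using s nz[OF s] by (simp add: c_def)
    finally show ?thesis .
  qed
  have degR: "degree R \<le> n - 1"
    unfolding R_def
    by (rule degree_sum_le)
       (auto intro!: order_trans[OF degree_smult_le] simp: degree_monic_with_roots)
  have "R = f"
  proof (rule poly_eqI_degree[where A = "x ` {..<n}"])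
    show "poly R t = poly f t" if "t \<in> x ` {..<n}" for t
      using that val by auto
    show "degree R < card (x ` {..<n})" "degree f < card (x ` {..<n})"
      using degR deg inj by (auto simp: card_image)
  qed
  have "coeff R (n - 1) = (\<Sum>r<n. c r * coeff (monic_with_roots x ({..<n} - {r})) (n - 1))"
    by (simp add: R_def coeff_sum)
  also have "\<dots> = (\<Sum>r<n. c r)"
    using lead_coeff_monic_with_roots[of x] card by (metis (no_types, lifting) lessThan_iff mult.right_neutral sum.cong)
  finally show ?thesis
    using \<open>R = f\<close> by (simp add: c_def)
qed

lemma coeff_times_linear:
  "coeff (p * [:- a, 1:]) (Suc n) = coeff p n - a * coeff (p :: real poly) (Suc n)"
  "coeff (p * [:- a, 1:]) 0 = - a * coeff (p :: real poly) 0"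
  by (simp_all add: mult.commute[of p])

lemma monic_with_roots_Suc:
  "monic_with_roots x {..<Suc n} = monic_with_roots x {..<n} * [:- x n, 1:]"
  by (simp add: monic_with_roots_def)

text \<open>Newton's identities for the first elementary symmetric functions, which are the top coefficients
  of the monic polynomial with the given roots.\<close>

lemma newton_coeff_0: "coeff (monic_with_roots x {..<n}) n = 1"
  using lead_coeff_monic_with_roots[of x "{..<n}"] by simp

lemma newton_coeff_1:
  "coeff (monic_with_roots x {..<Suc n}) n = - (\<Sum>k<Suc n. x k)"
proof (induction n)
  case 0
  show ?case by (simp add: monic_with_roots_def)
next
  case (Suc n)
  then show ?case
    by (subst monic_with_roots_Suc) (simp only: coeff_times_linear newton_coeff_0, simp)
qed

lemma newton_coeff_2:
  "coeff (monic_with_roots x {..<Suc (Suc n)}) n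
     = ((\<Sum>k<Suc (Suc n). x k)\<^sup>2 - (\<Sum>k<Suc (Suc n). (x k)\<^sup>2)) / 2"
proof (induction n)
  case 0
  show ?case by (simp add: monic_with_roots_def power2_eq_square algebra_simps)
next
  case (Suc n)
  show ?case
    by (subst monic_with_roots_Suc)
       (simp only: coeff_times_linear Suc newton_coeff_1 sum.lessThan_Suc[of _ "Suc (Suc n)"],
        simp add: power2_eq_square field_simps)
qed

lemma newton_coeff_3:
  "coeff (monic_with_roots x {..<Suc (Suc (Suc n))}) n
     = - ((\<Sum>k<Suc (Suc (Suc n)). x k) ^ 3
        - 3 * (\<Sum>k<Suc (Suc (Suc n)). x k) * (\<Sum>k<Suc (Suc (Suc n)). (x k)\<^sup>2)
        + 2 * (\<Sum>k<Suc (Suc (Suc n)). (x k) ^ 3)) / 6"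
proof (induction n)
  case 0
  show ?case
    by (simp add: monic_with_roots_def power2_eq_square power3_eq_cube algebra_simps)
next
  case (Suc n)
  show ?case
    by (subst monic_with_roots_Suc)
       (simp only: coeff_times_linear Suc newton_coeff_2 sum.lessThan_Suc[of _ "Suc (Suc (Suc n))"],
        simp add: power2_eq_square power3_eq_cube field_simps)
qed

lemma coeff_pCons_zero: "coeff (pCons 0 p) (Suc n) = coeff p n" "coeff (pCons 0 p) 0 = 0"
  by simp_all

text \<open>Let P and Q be the monic polynomials with roots y and x. Then w lists the residues of
  \<open>P / Q\<close>, and its moments are the coefficients of the expansion of \<open>P / Q\<close> at infinity. They
  are found by interpolating P, \<open>x P - Q\<close> and \<open>x (x P - Q)\<close>, which agree with P, \<open>x P\<close> and
  \<open>x\<^sup>2 P\<close> at the nodes and have degree at most N, the last two because P and Q have equal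
  sums of roots.\<close>

lemma node_moments:
  fixes x y :: "nat \<Rightarrow> real"
  assumes N: "N = Suc (Suc (Suc n))" and inj: "inj_on x {..<Suc N}"
    and s1: "(\<Sum>k<Suc N. x k) = (\<Sum>k<N. y k)"
  defines "w \<equiv> \<lambda>r. (\<Prod>k<N. x r - y k) / (\<Prod>k\<in>{..<Suc N} - {r}. x r - x k)"
  shows "(\<Sum>r<Suc N. w r) = 1"
    and "(\<Sum>r<Suc N. w r * x r) = 0"
    and "(\<Sum>r<Suc N. w r * (x r)\<^sup>2) = ((\<Sum>k<Suc N. (x k)\<^sup>2) - (\<Sum>k<N. (y k)\<^sup>2)) / 2"
proof -
  define P where "P = monic_with_roots y {..<N}"
  define Q where "Q = monic_with_roots x {..<Suc N}"
  have dP: "degree P = N" and dQ: "degree Q = Suc N"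
    by (simp_all add: P_def Q_def degree_monic_with_roots)
  have w: "w r = poly P (x r) / (\<Prod>k\<in>{..<Suc N} - {r}. x r - x k)" for r
    by (simp add: w_def P_def poly_monic_with_roots)
  have Q0: "poly Q (x r) = 0" if "r < Suc N" for r
    using that unfolding Q_def poly_monic_with_roots by (intro prod_zero) auto
  have P_above: "coeff P i = 0" if "i > N" for i using that dP by (simp add: coeff_eq_0)
  have Q_above: "coeff Q i = 0" if "i > Suc N" for i using that dQ by (simp add: coeff_eq_0)
  have cP: "coeff P N = 1" "coeff P (Suc (Suc n)) = - (\<Sum>k<N. y k)"
      "coeff P (Suc n) = ((\<Sum>k<N. y k)\<^sup>2 - (\<Sum>k<N. (y k)\<^sup>2)) / 2"
    unfolding P_def N by (simp_all only: newton_coeff_0 newton_coeff_1 newton_coeff_2)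
  have cQ: "coeff Q (Suc N) = 1" "coeff Q N = - (\<Sum>k<Suc N. x k)"
      "coeff Q (Suc (Suc n)) = ((\<Sum>k<Suc N. x k)\<^sup>2 - (\<Sum>k<Suc N. (x k)\<^sup>2)) / 2"
    unfolding Q_def N by (simp_all only: newton_coeff_0 newton_coeff_1 newton_coeff_2)
  show "(\<Sum>r<Suc N. w r) = 1"
    using sum_over_nodes_eq_coeff[OF inj, of P] dP cP(1) by (simp add: w)
  define f where "f = pCons 0 P - Q"
  have "degree f \<le> N"
  proof (rule degree_le, intro allI impI)
    fix i assume i: "N < i"
    then obtain j where j: "i = Suc j" "j \<ge> N" by (cases i) auto
    show "coeff f i = 0"
      using j cP(1) cQ(1) P_above[of j] Q_above[of i] by (cases "j = N") (auto simp: f_def)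
  qed
  then have "(\<Sum>r<Suc N. poly f (x r) / (\<Prod>k\<in>{..<Suc N} - {r}. x r - x k)) = coeff f N"
    using sum_over_nodes_eq_coeff[OF inj, of f] by simp
  moreover have "coeff f N = 0"
    using cP(2) cQ(2) s1 by (simp add: f_def N coeff_pCons_zero del: sum.lessThan_Suc)
  moreover have "poly f (x r) / (\<Prod>k\<in>{..<Suc N} - {r}. x r - x k) = w r * x r" if "r < Suc N" for r
    using Q0[OF that] by (simp add: f_def w)
  ultimately show "(\<Sum>r<Suc N. w r * x r) = 0"
    by (metis (no_types, lifting) lessThan_iff sum.cong)
  define g where "g = pCons 0 f"
  have "degree g \<le> N"
  proof (rule degree_le, intro allI impI)
    fix i assume i: "N < i"
    then obtain j where j: "i = Suc j" "j \<ge> N" by (cases i) auto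
    show "coeff g i = 0"
    proof (cases "j = N")
      case True then show ?thesis using \<open>coeff f N = 0\<close> j by (simp add: g_def)
    next
      case False then show ?thesis using \<open>degree f \<le> N\<close> j by (simp add: g_def coeff_eq_0)
    qed
  qed
  then have "(\<Sum>r<Suc N. poly g (x r) / (\<Prod>k\<in>{..<Suc N} - {r}. x r - x k)) = coeff g N"
    using sum_over_nodes_eq_coeff[OF inj, of g] by simp
  moreover have "coeff g N = ((\<Sum>k<Suc N. (x k)\<^sup>2) - (\<Sum>k<N. (y k)\<^sup>2)) / 2"
  proof -
    have "coeff g N = coeff P (Suc n) - coeff Q (Suc (Suc n))"
      by (simp add: g_def f_def N coeff_pCons_zero)
    then show ?thesis
      unfolding cP cQ using s1 by (simp add: field_simps del: sum.lessThan_Suc)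
  qed
  moreover have "poly g (x r) / (\<Prod>k\<in>{..<Suc N} - {r}. x r - x k) = w r * (x r)\<^sup>2" if "r < Suc N" for r
    using Q0[OF that] by (simp add: g_def f_def w power2_eq_square)
  ultimately show "(\<Sum>r<Suc N. w r * (x r)\<^sup>2) = ((\<Sum>k<Suc N. (x k)\<^sup>2) - (\<Sum>k<N. (y k)\<^sup>2)) / 2"
    by (metis (no_types, lifting) lessThan_iff sum.cong)
qed

text \<open>The same for the reciprocal \<open>Q / P\<close> after removal of its polynomial part: the nodes are now the
  roots of P, and the interpolated polynomials are \<open>Q - x P\<close> and \<open>x (Q - x P) + d P\<close>, with
  d chosen to cancel the term of degree N.\<close>

lemma conode_moments:
  fixes x y :: "nat \<Rightarrow> real"
  assumes N: "N = Suc (Suc (Suc n))" and inj: "inj_on y {..<N}"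
    and s1: "(\<Sum>k<Suc N. x k) = (\<Sum>k<N. y k)"
  defines "w \<equiv> \<lambda>r. (\<Prod>k<Suc N. y r - x k) / (\<Prod>k\<in>{..<N} - {r}. y r - y k)"
  shows "(\<Sum>r<N. w r) = - ((\<Sum>k<Suc N. (x k)\<^sup>2) - (\<Sum>k<N. (y k)\<^sup>2)) / 2"
    and "(\<Sum>r<N. w r * y r) = - ((\<Sum>k<Suc N. (x k) ^ 3) - (\<Sum>k<N. (y k) ^ 3)) / 3"
proof -
  define P where "P = monic_with_roots y {..<N}"
  define Q where "Q = monic_with_roots x {..<Suc N}"
  have dP: "degree P = N" and dQ: "degree Q = Suc N"
    by (simp_all add: P_def Q_def degree_monic_with_roots)
  have w: "w r = poly Q (y r) / (\<Prod>k\<in>{..<N} - {r}. y r - y k)" for r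
    by (simp add: w_def Q_def poly_monic_with_roots)
  have P0: "poly P (y r) = 0" if "r < N" for r
    using that unfolding P_def poly_monic_with_roots by (intro prod_zero) auto
  have P_above: "coeff P i = 0" if "i > N" for i using that dP by (simp add: coeff_eq_0)
  have Q_above: "coeff Q i = 0" if "i > Suc N" for i using that dQ by (simp add: coeff_eq_0)
  have cP: "coeff P N = 1" "coeff P (Suc (Suc n)) = - (\<Sum>k<N. y k)"
      "coeff P (Suc n) = ((\<Sum>k<N. y k)\<^sup>2 - (\<Sum>k<N. (y k)\<^sup>2)) / 2"
      "coeff P n = - ((\<Sum>k<N. y k) ^ 3 - 3 * (\<Sum>k<N. y k) * (\<Sum>k<N. (y k)\<^sup>2)
        + 2 * (\<Sum>k<N. (y k) ^ 3)) / 6"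
    unfolding P_def N
    by (simp_all only: newton_coeff_0 newton_coeff_1 newton_coeff_2 newton_coeff_3)
  have cQ: "coeff Q (Suc N) = 1" "coeff Q N = - (\<Sum>k<Suc N. x k)"
      "coeff Q (Suc (Suc n)) = ((\<Sum>k<Suc N. x k)\<^sup>2 - (\<Sum>k<Suc N. (x k)\<^sup>2)) / 2"
      "coeff Q (Suc n) = - ((\<Sum>k<Suc N. x k) ^ 3 - 3 * (\<Sum>k<Suc N. x k) * (\<Sum>k<Suc N. (x k)\<^sup>2)
        + 2 * (\<Sum>k<Suc N. (x k) ^ 3)) / 6"
    unfolding Q_def N
    by (simp_all only: newton_coeff_0 newton_coeff_1 newton_coeff_2 newton_coeff_3)
  define d where "d = ((\<Sum>k<Suc N. (x k)\<^sup>2) - (\<Sum>k<N. (y k)\<^sup>2)) / 2"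
  define f where "f = Q - pCons 0 P"
  have f_above: "coeff f i = 0" if "i \<ge> N" for i
  proof -
    consider "i = N" | "i = Suc N" | "i > Suc N" using \<open>i \<ge> N\<close> by linarith
    then show ?thesis
    proof cases
      case 1
      then have "coeff f i = coeff Q N - coeff P (Suc (Suc n))" by (simp add: f_def N)
      then show ?thesis unfolding cP cQ using s1 by simp
    next
      case 2
      then show ?thesis using cP(1) cQ(1) by (simp add: f_def)
    next
      case 3
      then obtain j where j: "i = Suc j" "j > N" by (cases i) auto
      then show ?thesis using 3 P_above[of j] Q_above[of i] by (simp add: f_def)
    qed
  qed
  have "degree f \<le> Suc (Suc n)"
    by (rule degree_le) (use f_above N in auto)
  then have "(\<Sum>r<N. poly f (y r) / (\<Prod>k\<in>{..<N} - {r}. y r - y k)) = coeff f (Suc (Suc n))"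
    using sum_over_nodes_eq_coeff[OF inj, of f] N by simp
  moreover have cf: "coeff f (Suc (Suc n)) = - d"
  proof -
    have "coeff f (Suc (Suc n)) = coeff Q (Suc (Suc n)) - coeff P (Suc n)"
      by (simp add: f_def)
    then show ?thesis
      unfolding cP cQ d_def using s1 by (simp add: field_simps del: sum.lessThan_Suc)
  qed
  moreover have "poly f (y r) / (\<Prod>k\<in>{..<N} - {r}. y r - y k) = w r" if "r < N" for r
    using P0[OF that] by (simp add: f_def w)
  ultimately show "(\<Sum>r<N. w r) = - ((\<Sum>k<Suc N. (x k)\<^sup>2) - (\<Sum>k<N. (y k)\<^sup>2)) / 2"
    unfolding d_def by (metis (no_types, lifting) lessThan_iff sum.cong minus_divide_left)
  define g where "g = pCons 0 f + smult d P"
  have "degree g \<le> Suc (Suc n)"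
  proof (rule degree_le, intro allI impI)
    fix i assume i: "Suc (Suc n) < i"
    then obtain j where j: "i = Suc j" "j \<ge> Suc (Suc n)" by (cases i) auto
    show "coeff g i = 0"
    proof (cases "j = Suc (Suc n)")
      case True then show ?thesis using cf cP(1) j N by (simp add: g_def)
    next
      case False then show ?thesis using f_above[of j] P_above[of i] N j by (simp add: g_def)
    qed
  qed
  then have "(\<Sum>r<N. poly g (y r) / (\<Prod>k\<in>{..<N} - {r}. y r - y k)) = coeff g (Suc (Suc n))"
    using sum_over_nodes_eq_coeff[OF inj, of g] N by simp
  moreover have "coeff g (Suc (Suc n)) = - ((\<Sum>k<Suc N. (x k) ^ 3) - (\<Sum>k<N. (y k) ^ 3)) / 3"
  proof -
    have "coeff g (Suc (Suc n)) = coeff Q (Suc n) - coeff P n + d * coeff P (Suc (Suc n))"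
      by (simp add: g_def f_def)
    then show ?thesis
      unfolding cP cQ d_def s1 by (simp add: field_simps del: sum.lessThan_Suc)
  qed
  moreover have "poly g (y r) / (\<Prod>k\<in>{..<N} - {r}. y r - y k) = w r * y r" if "r < N" for r
    using P0[OF that] by (simp add: g_def f_def w)
  ultimately show "(\<Sum>r<N. w r * y r) = - ((\<Sum>k<Suc N. (x k) ^ 3) - (\<Sum>k<N. (y k) ^ 3)) / 3"
    by (metis (no_types, lifting) lessThan_iff sum.cong)
qed

section \<open>Partitions as functions and their transition probabilities\<close>

text \<open>A partition is represented by the function that maps i to the length of row i; it is 0 for
  rows below the diagram. Adding a box is then a function update.\<close>

definition partitions :: "nat \<Rightarrow> (nat \<Rightarrow> nat) set" where
  "partitions n = {f. antimono f \<and> (\<exists>N. (\<forall>i\<ge>N. f i = 0) \<and> (\<Sum>i<N. f i) = n)}"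

definition col :: "(nat \<Rightarrow> nat) \<Rightarrow> nat \<Rightarrow> nat" where
  "col f j = card {i. j < f i}"

definition boxes :: "(nat \<Rightarrow> nat) \<Rightarrow> (nat \<times> nat) set" where
  "boxes f = {(i, j). j < f i}"

definition addable :: "(nat \<Rightarrow> nat) \<Rightarrow> nat \<Rightarrow> bool" where
  "addable f r \<longleftrightarrow> r = 0 \<or> f r < f (r - 1)"

definition removable :: "(nat \<Rightarrow> nat) \<Rightarrow> nat \<Rightarrow> bool" where
  "removable f r \<longleftrightarrow> f (Suc r) < f r"

definition add_box :: "(nat \<Rightarrow> nat) \<Rightarrow> nat \<Rightarrow> nat \<Rightarrow> nat" where
  "add_box f r = f(r := Suc (f r))"

lemma row_antimono: "f \<in> partitions n \<Longrightarrow> i \<le> k \<Longrightarrow> f k \<le> f i"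
  by (auto simp: partitions_def antimono_def)

lemma partition_zero:
  assumes "f \<in> partitions n" "n \<le> i"
  shows "f i = 0"
proof (rule ccontr)
  assume nz: "f i \<noteq> 0"
  obtain N where N: "\<forall>i\<ge>N. f i = 0" "(\<Sum>i<N. f i) = n"
    using assms(1) by (auto simp: partitions_def)
  have "i < N" using nz N(1) by (meson not_less)
  have "(\<Sum>k<Suc i. 1) \<le> (\<Sum>k<Suc i. f k)"
  proof (rule sum_mono)
    fix k assume "k \<in> {..<Suc i}"
    then show "1 \<le> f k" using row_antimono[OF assms(1), of k i] nz by auto
  qed
  also have "\<dots> \<le> (\<Sum>k<N. f k)"
    using \<open>i < N\<close> by (intro sum_mono2) auto
  finally show False using N assms(2) by simp
qed

lemma partition_sum:
  assumes "f \<in> partitions n" "n \<le> N"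
  shows "(\<Sum>i<N. f i) = n"
proof -
  obtain M where M: "\<forall>i\<ge>M. f i = 0" "(\<Sum>i<M. f i) = n"
    using assms(1) by (auto simp: partitions_def)
  have "(\<Sum>i<N. f i) = (\<Sum>i<max M N. f i)"
    by (rule sum.mono_neutral_left) (use partition_zero[OF assms(1)] assms(2) in auto)
  also have "\<dots> = (\<Sum>i<M. f i)"
    by (rule sum.mono_neutral_right) (use M in auto)
  finally show ?thesis using M by simp
qed

lemma partition_row_le:
  assumes "f \<in> partitions n"
  shows "f i \<le> n"
proof (cases "i < n")
  case True
  then have "f i \<le> (\<Sum>i<n. f i)" by (intro member_le_sum) auto
  then show ?thesis using partition_sum[OF assms] by simp
next
  case False
  then show ?thesis using partition_zero[OF assms] by simp
qed

lemma partitionsI: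
  "antimono f \<Longrightarrow> (\<And>i. N \<le> i \<Longrightarrow> f i = 0) \<Longrightarrow> (\<Sum>i<N. f i) = n \<Longrightarrow> f \<in> partitions n"
  by (auto simp: partitions_def)

lemma finite_partitions: "finite (partitions n)"
proof (rule finite_subset)
  show "partitions n \<subseteq> {f. \<forall>i. (i \<in> {..<n} \<longrightarrow> f i \<in> {..n}) \<and> (i \<notin> {..<n} \<longrightarrow> f i = 0)}"
    using partition_row_le partition_zero by auto
  show "finite {f. \<forall>i. (i \<in> {..<n} \<longrightarrow> f i \<in> {..n}) \<and> (i \<notin> {..<n} \<longrightarrow> f i = (0::nat))}"
    by (rule finite_set_of_finite_funs) auto
qed

lemma partitions_0: "partitions 0 = {\<lambda>_. 0}"
proof (rule equalityI)
  show "partitions 0 \<subseteq> {\<lambda>_. 0}"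
    using partition_zero[of _ 0] by (auto simp: fun_eq_iff)
  show "{\<lambda>_. 0} \<subseteq> partitions 0"
    by (auto intro!: partitionsI[of _ 0] simp: antimono_def)
qed

text \<open>Row lengths decrease, so the rows that reach column j form an initial segment.\<close>

lemma less_col_iff:
  assumes "f \<in> partitions n"
  shows "i < col f j \<longleftrightarrow> j < f i"
proof -
  define c where "c = (LEAST c. \<not> j < f c)"
  have "\<not> j < f n" using partition_zero[OF assms, of n] by simp
  then have stop: "\<not> j < f c" unfolding c_def by (rule LeastI)
  have before: "j < f k" if "k < c" for k
    using not_less_Least[of k "\<lambda>c. \<not> j < f c"] that by (auto simp: c_def)
  have after: "\<not> j < f k" if "c \<le> k" for k
    using stop row_antimono[OF assms that] by linarith
  have "{i. j < f i} = {..<c}"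
  proof (intro set_eqI)
    show "i \<in> {i. j < f i} \<longleftrightarrow> i \<in> {..<c}" for i
      using before[of i] after[of i] by (cases "i < c") auto
  qed
  then have "col f j = c" by (simp add: col_def)
  then show ?thesis using before after by (meson not_le)
qed

lemma boxes_Sigma:
  assumes "f \<in> partitions n" "n \<le> N"
  shows "boxes f = Sigma {..<N} (\<lambda>i. {..<f i})"
proof -
  have "i < N" if "j < f i" for i j
    using that partition_zero[OF assms(1), of i] assms(2) by (cases "i < N") auto
  then show ?thesis by (auto simp: boxes_def)
qed

lemma prod_boxes:
  fixes g :: "nat \<Rightarrow> nat \<Rightarrow> real"
  assumes "f \<in> partitions n" "n \<le> N"
  shows "(\<Prod>s\<in>boxes f. g (fst s) (snd s)) = (\<Prod>i<N. \<Prod>j<f i. g i j)"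
  unfolding boxes_Sigma[OF assms] by (subst prod.Sigma) (auto simp: case_prod_beta)

lemma finite_boxes: "f \<in> partitions n \<Longrightarrow> finite (boxes f)"
  by (simp add: boxes_Sigma[of f n n])

lemma addable_above:
  assumes "f \<in> partitions n" "addable f r" "i < r"
  shows "f r < f i"
proof -
  have "f r < f (r - 1)" using assms by (auto simp: addable_def)
  also have "\<dots> \<le> f i" using row_antimono[OF assms(1), of i "r - 1"] assms by simp
  finally show ?thesis .
qed

lemma add_box_partition:
  assumes "f \<in> partitions n" "addable f r"
  shows "add_box f r \<in> partitions (Suc n)"
proof (rule partitionsI[where N = "Suc (n + r)"])
  show "antimono (add_box f r)"
  proof (rule antimonoI)
    fix i k :: nat assume "i \<le> k"
    moreover have "f r < f i" if "i < r" by (rule addable_above[OF assms that])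
    ultimately show "add_box f r k \<le> add_box f r i"
      using row_antimono[OF assms(1), of i k] by (auto simp: add_box_def)
  qed
  show "add_box f r i = 0" if "Suc (n + r) \<le> i" for i
    using that partition_zero[OF assms(1), of i] by (simp add: add_box_def)
  have "(\<Sum>i<Suc (n + r). add_box f r i) = Suc (f r) + (\<Sum>i\<in>{..<Suc (n + r)} - {r}. add_box f r i)"
    by (subst sum.remove[of _ r]) (auto simp: add_box_def)
  also have "(\<Sum>i\<in>{..<Suc (n + r)} - {r}. add_box f r i) = (\<Sum>i\<in>{..<Suc (n + r)} - {r}. f i)"
    by (intro sum.cong) (auto simp: add_box_def)
  also have "Suc (f r) + \<dots> = Suc (\<Sum>i<Suc (n + r). f i)"
    by (subst (2) sum.remove[of _ r]) auto
  finally show "(\<Sum>i<Suc (n + r). add_box f r i) = Suc n"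
    using partition_sum[OF assms(1), of "Suc (n + r)"] by simp
qed

lemma removable_add_box: "f \<in> partitions n \<Longrightarrow> removable (add_box f r) r"
  using row_antimono[of f n r "Suc r"] by (simp add: removable_def add_box_def)

lemma remove_box_partition:
  assumes "f \<in> partitions (Suc n)" "removable f r"
  defines "g \<equiv> f(r := f r - 1)"
  shows "g \<in> partitions n" "addable g r" "add_box g r = f"
proof -
  have pos: "0 < f r" using assms by (auto simp: removable_def)
  show "add_box g r = f" using pos by (auto simp: add_box_def g_def)
  show "addable g r"
    using pos row_antimono[OF assms(1), of "r - 1" r] by (auto simp: addable_def g_def)
  show "g \<in> partitions n"
  proof (rule partitionsI[where N = "Suc (n + r)"])
    show "antimono g"
    proof (rule antimonoI)
      fix i k :: nat assume "i \<le> k"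
      moreover have "r < k \<Longrightarrow> f k < f r"
        using assms(2) row_antimono[OF assms(1), of "Suc r" k] by (auto simp: removable_def)
      ultimately show "g k \<le> g i"
        using row_antimono[OF assms(1), of i k] by (auto simp: g_def)
    qed
    show "g i = 0" if "Suc (n + r) \<le> i" for i
      using that partition_zero[OF assms(1), of i] by (simp add: g_def)
    have "(\<Sum>i<Suc (n + r). f i) = f r + (\<Sum>i\<in>{..<Suc (n + r)} - {r}. f i)"
      by (subst sum.remove[of _ r]) auto
    also have "(\<Sum>i\<in>{..<Suc (n + r)} - {r}. f i) = (\<Sum>i\<in>{..<Suc (n + r)} - {r}. g i)"
      by (intro sum.cong) (auto simp: g_def)
    also have "f r = Suc (g r)" using pos by (simp add: g_def)
    also have "Suc (g r) + (\<Sum>i\<in>{..<Suc (n + r)} - {r}. g i) = Suc (\<Sum>i<Suc (n + r). g i)"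
      by (subst (2) sum.remove[of _ r]) auto
    finally show "(\<Sum>i<Suc (n + r). g i) = n"
      using partition_sum[OF assms(1), of "Suc (n + r)"] by simp
  qed
qed

lemma addable_row_le:
  assumes "f \<in> partitions n" "addable f r"
  shows "r \<le> n"
proof (rule ccontr)
  assume "\<not> r \<le> n"
  then have "f (r - 1) = 0" using partition_zero[OF assms(1), of "r - 1"] by linarith
  then show False using assms(2) \<open>\<not> r \<le> n\<close> by (auto simp: addable_def)
qed

lemma sum_odd_real: "(\<Sum>k<N. 2 * real k + 1) = real N ^ 2"
  by (induction N) (auto simp: power2_eq_square algebra_simps)

lemma sum_cube_differences: "(\<Sum>k<N. 3 * real k ^ 2 + 3 * real k + 1) = real N ^ 3"
  by (induction N) (auto simp: power2_eq_square power3_eq_cube algebra_simps)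


lemma prod_quotients_telescope:
  fixes g :: "nat \<Rightarrow> real"
  assumes "a \<le> b" "\<And>j. a \<le> j \<Longrightarrow> j \<le> b \<Longrightarrow> g j \<noteq> 0"
  shows "(\<Prod>j\<in>{a..<b}. g j / g (Suc j)) = g a / g b"
  using assms
proof (induction b rule: dec_induct)
  case (step b)
  then show ?case by (simp add: prod.atLeastLessThan_Suc)
qed auto

lemma col_add_box:
  assumes "f \<in> partitions n" "addable f r"
  shows "col f (f r) = r"
    and "col (add_box f r) j = (if j = f r then Suc r else col f j)"
proof -
  note new = add_box_partition[OF assms]
  note above = addable_above[OF assms]
  have below: "f i \<le> f r" if "r \<le> i" for i
    using row_antimono[OF assms(1) that] .
  have eq: "a = b" if "\<And>i. i < a \<longleftrightarrow> i < b" for a b :: nat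
    using that by (metis linorder_neqE_nat less_irrefl)
  show "col f (f r) = r"
  proof (rule eq)
    fix i show "i < col f (f r) \<longleftrightarrow> i < r"
      unfolding less_col_iff[OF assms(1)] using above[of i] below[of i] by (cases "i < r") auto
  qed
  show "col (add_box f r) j = (if j = f r then Suc r else col f j)"
  proof (cases "j = f r")
    case True
    have "col (add_box f r) j = Suc r"
    proof (rule eq)
      fix i show "i < col (add_box f r) j \<longleftrightarrow> i < Suc r"
        unfolding less_col_iff[OF new] using True above[of i] below[of i]
        by (cases i r rule: linorder_cases) (auto simp: add_box_def)
    qed
    then show ?thesis using True by simp
  next
    case False
    have "col (add_box f r) j = col f j"
    proof (rule eq)
      fix i show "i < col (add_box f r) j \<longleftrightarrow> i < col f j"
        unfolding less_col_iff[OF new] less_col_iff[OF assms(1)] using False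
        by (auto simp: add_box_def)
    qed
    then show ?thesis using False by simp
  qed
qed


locale jack =
  fixes \<alpha> :: real
  assumes \<alpha>: "0 < \<alpha>"
begin

definition hook :: "(nat \<Rightarrow> nat) \<Rightarrow> nat \<Rightarrow> nat \<Rightarrow> real" where
  "hook f i j = (\<alpha> * real (f i - Suc j) + real (col f j - Suc i) + 1)
                 * (\<alpha> * real (f i - Suc j) + real (col f j - Suc i) + \<alpha>)"

definition hook_prod :: "(nat \<Rightarrow> nat) \<Rightarrow> real" where
  "hook_prod f = (\<Prod>s\<in>boxes f. hook f (fst s) (snd s))"

definition mass :: "nat \<Rightarrow> (nat \<Rightarrow> nat) \<Rightarrow> real" where
  "mass n f = \<alpha> ^ n * fact n / hook_prod f"

text \<open>With \<open>\<alpha> j - i\<close> as the content of the box in row i and column j, this is the content of the box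
  that would be added at the end of row k.\<close>

definition corner :: "(nat \<Rightarrow> nat) \<Rightarrow> nat \<Rightarrow> real" where
  "corner f k = \<alpha> * real (f k) - real k"

text \<open>The residues of \<open>\<Prod>k<N. (z - corner k + 1) / \<Prod>k\<le>N. (z - corner k)\<close>, which is the Stieltjes
  transform of the Jack deformation of Kerov's transition measure. Using all rows up to some N instead of the corners of
  the diagram is harmless: if rows k and \<open>k + 1\<close> have equal length, the factor
  \<open>z - corner k + 1\<close> equals \<open>z - corner (k + 1)\<close> and cancels. For the same reason \<open>up\<close> vanishes at
  rows to which no box can be added.\<close>

definition up :: "nat \<Rightarrow> (nat \<Rightarrow> nat) \<Rightarrow> nat \<Rightarrow> real" where
  "up N f r = (\<Prod>k<N. corner f r - (corner f k - 1))
              / (\<Prod>k\<in>{..<Suc N} - {r}. corner f r - corner f k)"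

text \<open>The negated residues of the reciprocal function. Divided by \<open>\<alpha> n\<close> they are the probabilities
  for removing a box from row r.\<close>

definition down :: "nat \<Rightarrow> (nat \<Rightarrow> nat) \<Rightarrow> nat \<Rightarrow> real" where
  "down N f r = - ((\<Prod>k<Suc N. (corner f r - 1) - corner f k)
              / (\<Prod>k\<in>{..<N} - {r}. (corner f r - 1) - (corner f k - 1)))"

definition content_sum :: "nat \<Rightarrow> (nat \<Rightarrow> nat) \<Rightarrow> real" where
  "content_sum N f = (\<Sum>k<N. \<alpha> * (real (f k) * (real (f k) - 1) / 2) - real k * real (f k))"

lemma hook_pos: "0 < hook f i j"
  using \<alpha> unfolding hook_def by (auto intro!: mult_pos_pos add_nonneg_pos)

lemma hook_prod_pos: "0 < hook_prod f"
  unfolding hook_prod_def by (intro prod_pos hook_pos)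

lemma mass_nonneg: "0 \<le> mass n f"
  using hook_prod_pos[of f] \<alpha> by (simp add: mass_def)

lemma corner_diff: "corner f r - corner f k = \<alpha> * (real (f r) - real (f k)) + (real k - real r)"
  by (simp add: corner_def algebra_simps)

lemma corner_less:
  assumes "f \<in> partitions n" "i < k"
  shows "corner f k + 1 \<le> corner f i"
proof -
  have "\<alpha> * real (f k) \<le> \<alpha> * real (f i)"
    using row_antimono[OF assms(1), of i k] assms \<alpha> by (intro mult_left_mono) auto
  then show ?thesis using assms(2) by (simp add: corner_def)
qed

lemma inj_corner:
  assumes "f \<in> partitions n"
  shows "inj_on (corner f) A"
proof (rule inj_onI)
  fix i k assume "corner f i = corner f k"
  then show "i = k"
    using corner_less[OF assms, of i k] corner_less[OF assms, of k i] by (cases i k rule: linorder_cases) auto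
qed

text \<open>The nodes are the numbers \<open>corner k\<close> for \<open>k \<le> N\<close> and \<open>corner k - 1\<close> for \<open>k < N\<close>. Except for
  \<open>corner N = - N\<close> they come in pairs at distance 1, and the terms that depend on N alone
  telescope.\<close>

lemma corner_power_sums:
  assumes f: "f \<in> partitions n" and N: "n \<le> N"
  shows "(\<Sum>k<Suc N. corner f k) = (\<Sum>k<N. corner f k - 1)"
    and "(\<Sum>k<Suc N. (corner f k)\<^sup>2) - (\<Sum>k<N. (corner f k - 1)\<^sup>2) = 2 * \<alpha> * real n"
    and "(\<Sum>k<Suc N. (corner f k) ^ 3) - (\<Sum>k<N. (corner f k - 1) ^ 3)
           = 6 * \<alpha> * content_sum N f + 3 * \<alpha> * (\<alpha> - 1) * real n"
proof -
  have last: "corner f N = - real N"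
    using partition_zero[OF f N] by (simp add: corner_def)
  have tot: "(\<Sum>k<N. real (f k)) = real n"
    using partition_sum[OF f N] by (metis of_nat_sum)
  show "(\<Sum>k<Suc N. corner f k) = (\<Sum>k<N. corner f k - 1)"
    by (simp add: last sum_subtractf)
  have "(\<Sum>k<N. (corner f k)\<^sup>2) - (\<Sum>k<N. (corner f k - 1)\<^sup>2)
      = (\<Sum>k<N. 2 * \<alpha> * real (f k) - (2 * real k + 1))"
    unfolding sum_subtractf[symmetric]
    by (intro sum.cong) (auto simp: corner_def power2_eq_square algebra_simps)
  also have "\<dots> = 2 * \<alpha> * real n - real N ^ 2"
    unfolding sum_subtractf sum_odd_real tot[symmetric] by (simp add: sum_distrib_left)
  finally show "(\<Sum>k<Suc N. (corner f k)\<^sup>2) - (\<Sum>k<N. (corner f k - 1)\<^sup>2) = 2 * \<alpha> * real n"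
    by (simp add: last)
  have "(\<Sum>k<N. (corner f k) ^ 3) - (\<Sum>k<N. (corner f k - 1) ^ 3)
      = (\<Sum>k<N. 6 * \<alpha> * (\<alpha> * (real (f k) * (real (f k) - 1) / 2) - real k * real (f k))
           + 3 * \<alpha> * (\<alpha> - 1) * real (f k) + (3 * real k ^ 2 + 3 * real k + 1))"
    unfolding sum_subtractf[symmetric]
    by (intro sum.cong) (auto simp: corner_def power2_eq_square power3_eq_cube field_simps)
  also have "\<dots> = 6 * \<alpha> * content_sum N f + 3 * \<alpha> * (\<alpha> - 1) * real n + real N ^ 3"
    by (simp only: sum.distrib sum_cube_differences[symmetric] tot[symmetric] content_sum_def
        sum_distrib_left)
  finally show "(\<Sum>k<Suc N. (corner f k) ^ 3) - (\<Sum>k<N. (corner f k - 1) ^ 3)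
           = 6 * \<alpha> * content_sum N f + 3 * \<alpha> * (\<alpha> - 1) * real n"
    by (simp add: last)
qed

lemma up_moments:
  assumes f: "f \<in> partitions n" and N: "n \<le> N" "3 \<le> N"
  shows "(\<Sum>r<Suc N. up N f r) = 1"
    and "(\<Sum>r<Suc N. up N f r * corner f r) = 0"
    and "(\<Sum>r<Suc N. up N f r * (corner f r)\<^sup>2) = \<alpha> * real n"
proof -
  obtain k where k: "N = Suc (Suc (Suc k))"
    using N(2) by (intro that[of "N - 3"]) linarith
  note m = node_moments[OF k inj_corner[OF f] corner_power_sums(1)[OF f N(1)], folded up_def]
  show "(\<Sum>r<Suc N. up N f r) = 1"
    by (rule m(1))
  show "(\<Sum>r<Suc N. up N f r * corner f r) = 0"
    by (rule m(2))
  show "(\<Sum>r<Suc N. up N f r * (corner f r)\<^sup>2) = \<alpha> * real n"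
    unfolding m(3) corner_power_sums(2)[OF f N(1)] by simp
qed

lemma down_moments:
  assumes f: "f \<in> partitions n" and N: "n \<le> N" "3 \<le> N"
  shows "(\<Sum>r<N. down N f r) = \<alpha> * real n"
    and "(\<Sum>r<N. down N f r * (corner f r - \<alpha>)) = 2 * \<alpha> * content_sum N f"
proof -
  obtain k where k: "N = Suc (Suc (Suc k))"
    using N(2) by (intro that[of "N - 3"]) linarith
  have inj: "inj_on (\<lambda>k. corner f k - 1) {..<N}"
    using inj_corner[OF f] by (auto simp: inj_on_def)
  note m = conode_moments[OF k inj corner_power_sums(1)[OF f N(1)]]
  have d: "down N f r = - ((\<Prod>k<Suc N. (corner f r - 1) - corner f k)
              / (\<Prod>k\<in>{..<N} - {r}. (corner f r - 1) - (corner f k - 1)))" for r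
    by (simp only: down_def)
  show s: "(\<Sum>r<N. down N f r) = \<alpha> * real n"
    unfolding d sum_negf m(1) corner_power_sums(2)[OF f N(1)] by simp
  have "(\<Sum>r<N. down N f r * (corner f r - 1)) = 2 * \<alpha> * content_sum N f + \<alpha> * (\<alpha> - 1) * real n"
    unfolding d mult_minus_left sum_negf m(2) corner_power_sums(3)[OF f N(1)]
    by (simp add: field_simps)
  moreover have "(\<Sum>r<N. down N f r * (corner f r - \<alpha>))
      = (\<Sum>r<N. down N f r * (corner f r - 1)) - (\<alpha> - 1) * (\<Sum>r<N. down N f r)"
    unfolding sum_distrib_left sum_subtractf[symmetric] by (intro sum.cong) (auto simp: algebra_simps)
  ultimately show "(\<Sum>r<N. down N f r * (corner f r - \<alpha>)) = 2 * \<alpha> * content_sum N f"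
    unfolding s by (simp add: algebra_simps)
qed

lemma up_not_addable:
  assumes "f \<in> partitions n" "r < Suc N" "\<not> addable f r"
  shows "up N f r = 0"
proof -
  obtain s where s: "r = Suc s" "f r = f s" "s < N"
    using assms row_antimono[OF assms(1), of "r - 1" r]
    by (cases r) (auto simp: addable_def)
  then have "(\<Prod>k<N. corner f r - (corner f k - 1)) = 0"
    by (intro prod_zero bexI[of _ s]) (auto simp: corner_def)
  then show ?thesis by (simp add: up_def)
qed

lemma down_not_removable:
  assumes "f \<in> partitions n" "r < N" "\<not> removable f r"
  shows "down N f r = 0"
proof -
  have "f (Suc r) = f r"
    using assms row_antimono[OF assms(1), of r "Suc r"] by (auto simp: removable_def)
  then have "(\<Prod>k<Suc N. (corner f r - 1) - corner f k) = 0"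
    using assms(2) by (intro prod_zero bexI[of _ "Suc r"]) (auto simp: corner_def)
  then show ?thesis by (simp only: down_def)
qed

text \<open>In the quotient the factors pair off as \<open>(e + 1) / e\<close> with e a difference of two corners, and such
  a difference is positive or at most \<open>-1\<close>.\<close>

lemma up_nonneg:
  assumes f: "f \<in> partitions n" and r: "r < Suc N"
  shows "0 \<le> up N f r"
proof -
  define e where "e k = corner f r - corner f k" for k
  have e: "0 \<le> (e k + 1) / e k" if "k \<noteq> r" for k
    using corner_less[OF f, of k r] corner_less[OF f, of r k] that
    by (cases "k < r") (auto simp: e_def zero_le_divide_iff)
  have num: "(\<Prod>k<N. corner f r - (corner f k - 1)) = (\<Prod>k\<in>{..<N} - {r}. e k + 1)"
  proof -
    have "(\<Prod>k<N. corner f r - (corner f k - 1)) = (\<Prod>k<N. e k + 1)"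
      by (simp add: e_def algebra_simps)
    also have "\<dots> = (\<Prod>k\<in>{..<N} - {r}. e k + 1)"
      by (rule prod.mono_neutral_right) (auto simp: e_def)
    finally show ?thesis .
  qed
  show ?thesis
  proof (cases "r = N")
    case True
    then have "{..<Suc N} - {r} = {..<N} - {r}" by auto
    then have "up N f r = (\<Prod>k\<in>{..<N} - {r}. (e k + 1) / e k)"
      unfolding up_def num by (simp add: e_def prod_dividef)
    then show ?thesis by (auto intro!: prod_nonneg e)
  next
    case False
    then have "{..<Suc N} - {r} = insert N ({..<N} - {r})" using r by auto
    then have "up N f r = (\<Prod>k\<in>{..<N} - {r}. (e k + 1) / e k) / e N"
      unfolding up_def num by (simp add: e_def prod_dividef)
    moreover have "0 < e N"
      using corner_less[OF f, of r N] False r by (simp add: e_def)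
    ultimately show ?thesis by (auto intro!: divide_nonneg_pos prod_nonneg e)
  qed
qed

lemma content_sum_add_box:
  assumes "r < N"
  shows "content_sum N (add_box f r) = content_sum N f + corner f r"
proof -
  have split: "content_sum N g = (\<alpha> * (real (g r) * (real (g r) - 1) / 2) - real r * real (g r))
      + (\<Sum>k\<in>{..<N} - {r}. \<alpha> * (real (g k) * (real (g k) - 1) / 2) - real k * real (g k))" for g
    unfolding content_sum_def using assms by (subst sum.remove[of _ r]) auto
  have "(\<Sum>k\<in>{..<N} - {r}. \<alpha> * (real (add_box f r k) * (real (add_box f r k) - 1) / 2) - real k * real (add_box f r k))
      = (\<Sum>k\<in>{..<N} - {r}. \<alpha> * (real (f k) * (real (f k) - 1) / 2) - real k * real (f k))"
    by (intro sum.cong) (auto simp: add_box_def)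
  then show ?thesis
    unfolding split by (simp add: add_box_def corner_def field_simps)
qed

section \<open>Hook products under the addition of a box\<close>

text \<open>Adding a box to row r increases the arms in that row by 1. Over a run of columns of equal
  length the hook ratios telescope, and the columns between \<open>f (Suc m)\<close> and \<open>f m\<close> form such a run,
  since all of them end in row m. What is left involves only the end points, that is,
  differences of corners.\<close>

lemma hook_row_ratio:
  assumes f: "f \<in> partitions n" and r: "addable f r" and m: "r \<le> m"
  defines "e \<equiv> \<lambda>k. corner f r - corner f k"
  shows "(\<Prod>j\<in>{f m..<f r}. hook (add_box f r) r j / hook f r j)
       = (\<Prod>k\<in>{r..<m}. (e (Suc k) * (e (Suc k) + \<alpha> - 1)) / ((e k + 1) * (e k + \<alpha>)))"
  using m
proof (induction m rule: dec_induct)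
  case base
  then show ?case by simp
next
  case (step m)
  define c where "c = f r"
  define L where "L = real m + 1 - real r"
  have L: "1 \<le> L" using step by (simp add: L_def)
  define g1 where "g1 j = \<alpha> * (real c - real j) + L" for j :: nat
  define g2 where "g2 j = \<alpha> * (real c + 1 - real j) + L - 1" for j :: nat
  have le: "f (Suc m) \<le> f m" "f m \<le> c"
    using row_antimono[OF f] step by (auto simp: c_def)
  have nz: "g1 j \<noteq> 0" "g2 j \<noteq> 0" if "j \<le> c" for j
  proof -
    have "0 \<le> \<alpha> * (real c - real j)" using \<alpha> that by simp
    then show "g1 j \<noteq> 0" using L by (simp add: g1_def)
    have "0 < \<alpha> * (real c + 1 - real j)" using \<alpha> that by simp
    then show "g2 j \<noteq> 0" using L by (simp add: g2_def)
  qed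
  have ratio: "hook (add_box f r) r j / hook f r j = (g1 j / g1 (Suc j)) * (g2 j / g2 (Suc j))"
    if j: "j \<in> {f (Suc m)..<f m}" for j
  proof -
    have jc: "j < c" using j le by auto
    have "m < col f j" "\<not> Suc m < col f j"
      unfolding less_col_iff[OF f] using j by auto
    then have col: "col f j = Suc m" by simp
    have "hook (add_box f r) r j = g1 j * g2 j"
      using jc step(1)
      by (simp add: hook_def col_add_box(2)[OF f r] col c_def[symmetric])
         (simp add: add_box_def c_def[symmetric] g1_def g2_def L_def of_nat_diff algebra_simps)
    moreover have "hook f r j = g1 (Suc j) * g2 (Suc j)"
      using jc step(1)
      by (simp add: hook_def col c_def[symmetric] g1_def g2_def L_def of_nat_diff algebra_simps)
    ultimately show ?thesis by simp
  qed
  have "(\<Prod>j\<in>{f (Suc m)..<f r}. hook (add_box f r) r j / hook f r j)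
      = (\<Prod>j\<in>{f (Suc m)..<f m}. hook (add_box f r) r j / hook f r j)
        * (\<Prod>j\<in>{f m..<f r}. hook (add_box f r) r j / hook f r j)"
    using le by (intro prod.atLeastLessThan_concat[symmetric]) (auto simp: c_def)
  also have "(\<Prod>j\<in>{f (Suc m)..<f m}. hook (add_box f r) r j / hook f r j)
      = (\<Prod>j\<in>{f (Suc m)..<f m}. g1 j / g1 (Suc j)) * (\<Prod>j\<in>{f (Suc m)..<f m}. g2 j / g2 (Suc j))"
    unfolding prod.distrib[symmetric] by (intro prod.cong refl ratio)
  also have "(\<Prod>j\<in>{f (Suc m)..<f m}. g1 j / g1 (Suc j)) = g1 (f (Suc m)) / g1 (f m)"
    using le nz by (intro prod_quotients_telescope) auto
  also have "(\<Prod>j\<in>{f (Suc m)..<f m}. g2 j / g2 (Suc j)) = g2 (f (Suc m)) / g2 (f m)"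
    using le nz by (intro prod_quotients_telescope) auto
  also have "g1 (f (Suc m)) = e (Suc m)"
    by (simp add: g1_def e_def corner_def L_def c_def algebra_simps)
  also have "g1 (f m) = e m + 1"
    by (simp add: g1_def e_def corner_def L_def c_def algebra_simps)
  also have "g2 (f (Suc m)) = e (Suc m) + \<alpha> - 1"
    by (simp add: g2_def e_def corner_def L_def c_def algebra_simps)
  also have "g2 (f m) = e m + \<alpha>"
    by (simp add: g2_def e_def corner_def L_def c_def algebra_simps)
  finally show ?case
    using step(1) by (simp add: step.IH prod.atLeastLessThan_Suc mult_ac)
qed

text \<open>In the column of the new box the legs increase by 1, and no telescoping is required.\<close>

lemma hook_col_ratio:
  assumes f: "f \<in> partitions n" and r: "addable f r" and i: "i < r"
  defines "e \<equiv> corner f r - corner f i"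
  shows "hook (add_box f r) i (f r) / hook f i (f r)
       = (e * (e + \<alpha> - 1)) / ((e + 1) * (e + \<alpha>))"
proof -
  obtain d where d: "f i = Suc (f r + d)"
    using addable_above[OF f r i] less_imp_Suc_add by blast
  obtain s where s: "r = Suc (i + s)" using i less_imp_Suc_add by blast
  have "hook (add_box f r) i (f r) = e * (e + \<alpha> - 1)"
    using i by (simp add: hook_def col_add_box[OF f r])
      (simp add: add_box_def e_def corner_def d s algebra_simps)
  moreover have "hook f i (f r) = (e + 1) * (e + \<alpha>)"
    by (simp add: hook_def col_add_box[OF f r])
       (simp add: e_def corner_def d s algebra_simps)
  ultimately show ?thesis by simp
qed

text \<open>The new box changes only the hooks in its row and in its column. The two preceding lemmas turn
  the quotient of the hook products into products of differences of corners over the rows above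
  and below r, which are exactly those in \<open>down\<close> and \<open>up\<close>. The corner of row r itself moves
  by \<alpha>.\<close>

theorem hook_prod_add_box:
  assumes f: "f \<in> partitions n" and r: "addable f r" and N: "n < N"
  shows "hook_prod (add_box f r) * up N f r = hook_prod f * down N (add_box f r) r"
proof -
  define c where "c = f r"
  define f' where "f' = add_box f r"
  define e where "e k = corner f r - corner f k" for k
  define \<rho> where "\<rho> i j = hook f' i j / hook f i j" for i j
  note f'p = add_box_partition[OF f r, folded f'_def]
  have rN: "r < N" using addable_row_le[OF f r] N by simp
  note above = addable_above[OF f r]
  have rho_pos: "\<rho> i j \<noteq> 0" for i j
    using hook_pos[of f' i j] hook_pos[of f i j] by (simp add: \<rho>_def)
  have rho_1: "\<rho> i j = 1" if "i \<noteq> r" "j \<noteq> c" for i j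
  proof -
    have "hook f' i j = hook f i j"
      using that by (simp add: hook_def f'_def col_add_box[OF f r] c_def) (simp add: add_box_def)
    then show ?thesis using hook_pos[of f i j] by (simp add: \<rho>_def)
  qed
  have boxes: "boxes f' = insert (r, c) (boxes f)" "(r, c) \<notin> boxes f"
    by (auto simp: boxes_def f'_def add_box_def c_def split: if_splits)
  have new: "hook f' r c = \<alpha>"
    by (simp add: hook_def f'_def col_add_box[OF f r] c_def) (simp add: add_box_def)
  have H1: "hook_prod f' = \<alpha> * (\<Prod>s\<in>boxes f. hook f' (fst s) (snd s))"
    unfolding hook_prod_def boxes(1) using finite_boxes[OF f] boxes(2) by (simp add: new)
  have H2: "(\<Prod>s\<in>boxes f. hook f' (fst s) (snd s)) = hook_prod f * (\<Prod>s\<in>boxes f. \<rho> (fst s) (snd s))"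
  proof -
    have "hook f i j \<noteq> 0" for i j using hook_pos[of f i j] by simp
    then show ?thesis
      unfolding hook_prod_def prod.distrib[symmetric] \<rho>_def by (intro prod.cong) auto
  qed
  have "(\<Prod>s\<in>boxes f. \<rho> (fst s) (snd s)) = (\<Prod>i<N. \<Prod>j<f i. \<rho> i j)"
    using N by (intro prod_boxes[OF f]) simp
  also have "\<dots> = (\<Prod>i\<in>{..<r} \<union> {r} \<union> {r<..<N}. \<Prod>j<f i. \<rho> i j)"
    using rN by (intro prod.cong) auto
  also have "\<dots> = (\<Prod>i<r. \<Prod>j<f i. \<rho> i j) * (\<Prod>j<c. \<rho> r j) * (\<Prod>i\<in>{r<..<N}. \<Prod>j<f i. \<rho> i j)"
    by (subst prod.union_disjoint; (subst prod.union_disjoint)?) (auto simp: c_def)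
  also have "(\<Prod>i\<in>{r<..<N}. \<Prod>j<f i. \<rho> i j) = 1"
  proof (intro prod.neutral ballI)
    fix i j assume "i \<in> {r<..<N}" "j \<in> {..<f i}"
    then show "\<rho> i j = 1"
      using row_antimono[OF f, of r i] by (intro rho_1) (auto simp: c_def)
  qed
  also have "(\<Prod>i<r. \<Prod>j<f i. \<rho> i j) = (\<Prod>i<r. \<rho> i c)"
  proof (rule prod.cong[OF refl])
    fix i assume i: "i \<in> {..<r}"
    have "(\<Prod>j<f i. \<rho> i j) = \<rho> i c * (\<Prod>j\<in>{..<f i} - {c}. \<rho> i j)"
      using above[of i] i by (intro prod.remove) (auto simp: c_def)
    also have "(\<Prod>j\<in>{..<f i} - {c}. \<rho> i j) = 1"
      using i by (intro prod.neutral ballI rho_1) auto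
    finally show "(\<Prod>j<f i. \<rho> i j) = \<rho> i c" by simp
  qed
  also have "\<dots> = (\<Prod>i<r. (e i * (e i + \<alpha> - 1)) / ((e i + 1) * (e i + \<alpha>)))"
    unfolding \<rho>_def f'_def c_def e_def using hook_col_ratio[OF f r] by (intro prod.cong) auto
  also have "(\<Prod>j<c. \<rho> r j) = (\<Prod>k\<in>{r..<N}. (e (Suc k) * (e (Suc k) + \<alpha> - 1)) / ((e k + 1) * (e k + \<alpha>)))"
  proof -
    have "{..<c} = {f N..<f r}" using partition_zero[OF f, of N] N by (auto simp: c_def)
    then show ?thesis
      unfolding \<rho>_def f'_def e_def using hook_row_ratio[OF f r, of N] rN by simp
  qed
  finally have prods: "(\<Prod>s\<in>boxes f. \<rho> (fst s) (snd s))
      = (\<Prod>i<r. (e i * (e i + \<alpha> - 1)) / ((e i + 1) * (e i + \<alpha>)))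
        * (\<Prod>k\<in>{r..<N}. (e (Suc k) * (e (Suc k) + \<alpha> - 1)) / ((e k + 1) * (e k + \<alpha>)))"
    by simp
  \<comment> \<open>Index 1 stands for the rows above \<open>r\<close>, index 2 for those below.\<close>
  define A1 A2 B1 B2 C1 C2 D1 D2 where
    "A1 = (\<Prod>i<r. e i)" and "A2 = (\<Prod>i\<in>{r<..N}. e i)"
    and "B1 = (\<Prod>i<r. e i + 1)" and "B2 = (\<Prod>i\<in>{r<..<N}. e i + 1)"
    and "C1 = (\<Prod>i<r. e i + \<alpha> - 1)" and "C2 = (\<Prod>i\<in>{r<..N}. e i + \<alpha> - 1)"
    and "D1 = (\<Prod>i<r. e i + \<alpha>)" and "D2 = (\<Prod>i\<in>{r<..<N}. e i + \<alpha>)"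
  have e_above: "e i < 0" "e i + 1 < 0" "e i + \<alpha> < 0" if "i < r" for i
  proof -
    have "\<alpha> * 1 \<le> \<alpha> * (real (f i) - real (f r))"
      using \<alpha> above[OF that] by (intro mult_left_mono) auto
    moreover have "real i + 1 \<le> real r" using that by simp
    ultimately show "e i < 0" "e i + 1 < 0" "e i + \<alpha> < 0"
      unfolding e_def corner_diff using \<alpha> by (simp_all add: algebra_simps)
  qed
  have e_below: "0 < e i" if "r < i" for i
    using corner_less[OF f that] by (simp add: e_def)
  have nz: "A1 \<noteq> 0" "A2 \<noteq> 0" "B1 \<noteq> 0" "B2 \<noteq> 0" "D1 \<noteq> 0" "D2 \<noteq> 0"
  proof -
    show "A1 \<noteq> 0" "B1 \<noteq> 0" "D1 \<noteq> 0"
      using e_above by (force simp: A1_def B1_def D1_def prod_zero_iff)+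
    show "A2 \<noteq> 0" "B2 \<noteq> 0" "D2 \<noteq> 0"
      using e_below \<alpha> by (force simp: A2_def B2_def D2_def prod_zero_iff add_pos_pos)+
  qed
  have col: "(\<Prod>i<r. (e i * (e i + \<alpha> - 1)) / ((e i + 1) * (e i + \<alpha>))) = (A1 * C1) / (B1 * D1)"
    by (simp add: A1_def B1_def C1_def D1_def prod_dividef prod.distrib)
  have row: "\<alpha> * (\<Prod>k\<in>{r..<N}. (e (Suc k) * (e (Suc k) + \<alpha> - 1)) / ((e k + 1) * (e k + \<alpha>)))
      = (A2 * C2) / (B2 * D2)"
  proof -
    have shift: "(\<Prod>k\<in>{r..<N}. h (Suc k)) = (\<Prod>k\<in>{r<..N}. h k)" for h :: "nat \<Rightarrow> real"
      using prod.shift_bounds_Suc_ivl[of h r N]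
      by (simp add: atLeastSucLessThan_greaterThanLessThan atLeastLessThanSuc_atLeastAtMost atLeastSucAtMost_greaterThanAtMost)
    have first: "(\<Prod>k\<in>{r..<N}. h k) = h r * (\<Prod>k\<in>{r<..<N}. h k)" for h :: "nat \<Rightarrow> real"
      using prod.atLeast_Suc_lessThan[OF rN, of h] by (simp add: atLeastSucLessThan_greaterThanLessThan)
    have er: "e r = 0" by (simp add: e_def)
    show ?thesis
      using \<alpha> shift[of "\<lambda>k. e k * (e k + \<alpha> - 1)"] first[of "\<lambda>k. (e k + 1) * (e k + \<alpha>)"]
      by (simp add: prod_dividef er A2_def B2_def C2_def D2_def prod.distrib)
  qed
  have s1: "{..<N} - {r} = {..<r} \<union> {r<..<N}" and s2: "{..<Suc N} - {r} = {..<r} \<union> {r<..N}"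
    using rN by auto
  have num: "(\<Prod>k<N. corner f r - (corner f k - 1)) = B1 * B2"
  proof -
    have "(\<Prod>k<N. corner f r - (corner f k - 1)) = (\<Prod>k<N. e k + 1)"
      by (simp add: e_def algebra_simps)
    also have "\<dots> = (\<Prod>k\<in>{..<N} - {r}. e k + 1)"
      by (rule prod.mono_neutral_right) (auto simp: e_def)
    finally show ?thesis
      unfolding s1 B1_def B2_def by (subst (asm) prod.union_disjoint) auto
  qed
  have U: "up N f r = (B1 * B2) / (A1 * A2)"
    unfolding up_def num s2 A1_def A2_def e_def
    by (subst prod.union_disjoint) auto
  have corner': "corner f' k = (if k = r then corner f r + \<alpha> else corner f k)" for k
    by (simp add: corner_def f'_def add_box_def algebra_simps)
  have "(\<Prod>k<Suc N. (corner f' r - 1) - corner f' k)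
      = (corner f' r - 1 - corner f' r) * (\<Prod>k\<in>{..<Suc N} - {r}. (corner f' r - 1) - corner f' k)"
    using rN by (intro prod.remove) auto
  also have "(\<Prod>k\<in>{..<Suc N} - {r}. (corner f' r - 1) - corner f' k) = (\<Prod>k\<in>{..<Suc N} - {r}. e k + \<alpha> - 1)"
    by (intro prod.cong) (auto simp: corner' e_def)
  also have "\<dots> = C1 * C2"
    unfolding s2 C1_def C2_def by (subst prod.union_disjoint) auto
  finally have num': "(\<Prod>k<Suc N. (corner f' r - 1) - corner f' k) = - (C1 * C2)"
    by simp
  have "(\<Prod>k\<in>{..<N} - {r}. (corner f' r - 1) - (corner f' k - 1)) = (\<Prod>k\<in>{..<N} - {r}. e k + \<alpha>)"
    by (intro prod.cong) (auto simp: corner' e_def)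
  also have "\<dots> = D1 * D2"
    unfolding s1 D1_def D2_def by (subst prod.union_disjoint) auto
  finally have Dn: "down N f' r = (C1 * C2) / (D1 * D2)"
    unfolding down_def num' by simp
  have "hook_prod f' = hook_prod f * ((A1 * C1) / (B1 * D1)) * ((A2 * C2) / (B2 * D2))"
    unfolding H1 H2 prods col row[symmetric] by simp
  then have "hook_prod f' * up N f r = hook_prod f * down N f' r"
    unfolding U Dn using nz by (simp add: field_simps)
  then show ?thesis by (simp only: f'_def)
qed

section \<open>Growth of a Jack distributed partition\<close>

text \<open>The box-removing chain is the time reversal of the growth process. The factor \<open>\<alpha> n\<close> comes from
  the numerators \<open>\<alpha>\<^bsup>n\<^esup> n!\<close> and turns \<open>down\<close> into a probability.\<close>

lemma mass_balance:
  assumes f: "f \<in> partitions n" and r: "addable f r" and N: "n < N"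
  shows "mass n f * up N f r
       = mass (Suc n) (add_box f r) * (down N (add_box f r) r / (\<alpha> * real (Suc n)))"
proof -
  have "hook_prod f \<noteq> 0" "hook_prod (add_box f r) \<noteq> 0"
    using hook_prod_pos[of f] hook_prod_pos[of "add_box f r"] by simp_all
  then show ?thesis
    using hook_prod_add_box[OF assms] \<alpha> by (simp add: mass_def field_simps del: of_nat_Suc)
qed

text \<open>Pairs of a partition and an addable row correspond to pairs of a larger partition and a removable
  row. All other rows have weight 0 on either side.\<close>

lemma sum_up_eq_sum_down:
  assumes N: "n < N"
  shows "(\<Sum>f\<in>partitions n. mass n f * (\<Sum>r<Suc N. up N f r * \<phi> (add_box f r) r))
       = (\<Sum>g\<in>partitions (Suc n). mass (Suc n) g
            * ((\<Sum>r<N. down N g r * \<phi> g r) / (\<alpha> * real (Suc n))))"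
proof -
  let ?A = "Sigma (partitions n) (\<lambda>f. {r\<in>{..<Suc N}. addable f r})"
  let ?B = "Sigma (partitions (Suc n)) (\<lambda>g. {r\<in>{..<N}. removable g r})"
  have "(\<Sum>f\<in>partitions n. mass n f * (\<Sum>r<Suc N. up N f r * \<phi> (add_box f r) r))
      = (\<Sum>f\<in>partitions n. \<Sum>r\<in>{r\<in>{..<Suc N}. addable f r}.
            mass n f * up N f r * \<phi> (add_box f r) r)"
    unfolding sum_distrib_left mult.assoc
    by (intro sum.cong refl sum.mono_neutral_right) (auto simp: up_not_addable)
  also have "\<dots> = (\<Sum>(f, r)\<in>?A. mass n f * up N f r * \<phi> (add_box f r) r)"
    by (rule sum.Sigma) (auto simp: finite_partitions)
  also have "\<dots> = (\<Sum>(g, r)\<in>?B. mass (Suc n) g * (down N g r / (\<alpha> * real (Suc n))) * \<phi> g r)"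
  proof (rule sum.reindex_bij_witness[where j = "\<lambda>(f, r). (add_box f r, r)"
        and i = "\<lambda>(g, r). (g(r := g r - 1), r)"])
    fix a assume a: "a \<in> ?A"
    obtain f r where [simp]: "a = (f, r)" by (cases a)
    have f: "f \<in> partitions n" "addable f r" using a by auto
    show "(case case a of (f, r) \<Rightarrow> (add_box f r, r) of (g, r) \<Rightarrow> (g(r := g r - 1), r)) = a"
      by (simp add: add_box_def)
    show "(case a of (f, r) \<Rightarrow> (add_box f r, r)) \<in> ?B"
      using f add_box_partition[OF f] removable_add_box[OF f(1)] addable_row_le[OF f] N by auto
    show "(case case a of (f, r) \<Rightarrow> (add_box f r, r) of
        (g, r) \<Rightarrow> mass (Suc n) g * (down N g r / (\<alpha> * real (Suc n))) * \<phi> g r)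
      = (case a of (f, r) \<Rightarrow> mass n f * up N f r * \<phi> (add_box f r) r)"
      unfolding \<open>a = (f, r)\<close> prod.case using mass_balance[OF f N] by simp
  next
    fix b assume b: "b \<in> ?B"
    obtain g r where [simp]: "b = (g, r)" by (cases b)
    have g: "g \<in> partitions (Suc n)" "removable g r" using b by auto
    note rem = remove_box_partition[OF g]
    show "(case case b of (g, r) \<Rightarrow> (g(r := g r - 1), r) of (f, r) \<Rightarrow> (add_box f r, r)) = b"
      using rem by simp
    show "(case b of (g, r) \<Rightarrow> (g(r := g r - 1), r)) \<in> ?A"
      using rem b by auto
  qed
  also have "\<dots> = (\<Sum>g\<in>partitions (Suc n). \<Sum>r\<in>{r\<in>{..<N}. removable g r}.
      mass (Suc n) g * (down N g r / (\<alpha> * real (Suc n))) * \<phi> g r)"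
    by (rule sum.Sigma[symmetric]) (auto simp: finite_partitions)
  also have "\<dots> = (\<Sum>g\<in>partitions (Suc n). mass (Suc n) g
            * ((\<Sum>r<N. down N g r * \<phi> g r) / (\<alpha> * real (Suc n))))"
    unfolding sum_distrib_left sum_divide_distrib
    by (intro sum.cong refl sum.mono_neutral_cong_left) (auto simp: down_not_removable)
  finally show ?thesis .
qed

text \<open>Both kinds of weights sum to one, so the total mass is the same for n and \<open>n + 1\<close>.\<close>

theorem mass_sum:
  shows "(\<Sum>f\<in>partitions n. mass n f) = 1"
proof (induction n)
  case 0
  have "boxes (\<lambda>_. 0) = {}" by (auto simp: boxes_def)
  then show ?case by (simp add: partitions_0 mass_def hook_prod_def)
next
  case (Suc n)
  \<comment> \<open>Any number of rows that is at least 3 and larger than n will do.\<close>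
  define N where "N = n + 3"
  have "(\<Sum>f\<in>partitions n. mass n f * (\<Sum>r<Suc N. up N f r * 1))
      = (\<Sum>f\<in>partitions n. mass n f)"
  proof (intro sum.cong refl)
    fix f assume f: "f \<in> partitions n"
    have "(\<Sum>r<Suc N. up N f r) = 1"
      by (rule up_moments(1)[OF f]) (simp_all add: N_def)
    then show "mass n f * (\<Sum>r<Suc N. up N f r * 1) = mass n f"
      by (simp only: mult_1_right)
  qed
  moreover have "(\<Sum>g\<in>partitions (Suc n). mass (Suc n) g
            * ((\<Sum>r<N. down N g r * 1) / (\<alpha> * real (Suc n))))
      = (\<Sum>g\<in>partitions (Suc n). mass (Suc n) g)"
    using \<alpha> by (intro sum.cong refl) (simp add: down_moments N_def del: of_nat_Suc)
  ultimately show ?case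
    using sum_up_eq_sum_down[of n N "\<lambda>_ _. 1"] Suc by (simp add: N_def)
qed

lemma up_sum_add_box:
  assumes f: "f \<in> partitions n" and N: "n < N"
  shows "(\<Sum>r<Suc N. up N f r * \<phi> (corner f r) (content_sum N f + corner f r))
      = (\<Sum>r<Suc N. up N f r
            * \<phi> (corner (add_box f r) r - \<alpha>) (content_sum N (add_box f r)))"
proof (intro sum.cong refl)
  fix r assume r: "r \<in> {..<Suc N}"
  show "up N f r * \<phi> (corner f r) (content_sum N f + corner f r)
      = up N f r * \<phi> (corner (add_box f r) r - \<alpha>) (content_sum N (add_box f r))"
  proof (cases "addable f r")
    case True
    then have "r < N" using addable_row_le[OF f] N by fastforce
    then show ?thesis
      by (simp add: content_sum_add_box) (simp add: corner_def add_box_def algebra_simps)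
  next
    case False
    then show ?thesis using up_not_addable[OF f _ False] r by simp
  qed
qed

lemma growth_law:
  assumes N: "n < N" "3 \<le> N"
  shows "(\<Sum>f\<in>partitions n. mass n f
            * (\<Sum>r<Suc N. up N f r * h (content_sum N f + corner f r)))
       = (\<Sum>g\<in>partitions (Suc n). mass (Suc n) g * h (content_sum N g))"
proof -
  have "(\<Sum>f\<in>partitions n. mass n f
            * (\<Sum>r<Suc N. up N f r * h (content_sum N f + corner f r)))
      = (\<Sum>f\<in>partitions n. mass n f
            * (\<Sum>r<Suc N. up N f r * h (content_sum N (add_box f r))))"
    using up_sum_add_box[OF _ N(1), of _ "\<lambda>_. h"] by (intro sum.cong refl) (simp only:)
  also have "\<dots> = (\<Sum>g\<in>partitions (Suc n). mass (Suc n) g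
            * ((\<Sum>r<N. down N g r * h (content_sum N g)) / (\<alpha> * real (Suc n))))"
    by (rule sum_up_eq_sum_down[OF N(1)])
  also have "\<dots> = (\<Sum>g\<in>partitions (Suc n). mass (Suc n) g * h (content_sum N g))"
  proof (intro sum.cong refl)
    fix g assume g: "g \<in> partitions (Suc n)"
    have "(\<Sum>r<N. down N g r * h (content_sum N g)) = \<alpha> * real (Suc n) * h (content_sum N g)"
      using down_moments(1)[OF g] N by (simp add: sum_distrib_right[symmetric])
    then show "mass (Suc n) g
          * ((\<Sum>r<N. down N g r * h (content_sum N g)) / (\<alpha> * real (Suc n)))
        = mass (Suc n) g * h (content_sum N g)"
      using \<alpha> by (simp del: of_nat_Suc)
  qed
  finally show ?thesis .
qed

text \<open>Given the larger partition g, the content of the removed box has mean \<open>2/n\<close> times the content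
  sum of g, where n is the size of g; multiply by a function of the content sum of g and average.\<close>

theorem content_sum_stein_identity:
  assumes N: "n < N" "3 \<le> N"
  shows "(\<Sum>f\<in>partitions n. mass n f * (\<Sum>r<Suc N. up N f r
              * (corner f r * h (content_sum N f + corner f r))))
       = 2 / real (Suc n) * (\<Sum>f\<in>partitions n. mass n f * (\<Sum>r<Suc N. up N f r
              * ((content_sum N f + corner f r) * h (content_sum N f + corner f r))))"
    (is "?L = _ * ?R")
proof -
  define S where "S g = content_sum N g" for g
  have "?L = (\<Sum>f\<in>partitions n. mass n f * (\<Sum>r<Suc N. up N f r
              * ((corner (add_box f r) r - \<alpha>) * h (S (add_box f r)))))"
    unfolding S_def using up_sum_add_box[OF _ N(1), of _ "\<lambda>x s. x * h s"]
    by (intro sum.cong refl) (simp only:)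
  also have "\<dots> = (\<Sum>g\<in>partitions (Suc n). mass (Suc n) g
            * ((\<Sum>r<N. down N g r * ((corner g r - \<alpha>) * h (S g))) / (\<alpha> * real (Suc n))))"
    by (rule sum_up_eq_sum_down[OF N(1)])
  also have "\<dots> = (\<Sum>g\<in>partitions (Suc n). mass (Suc n) g * (2 / real (Suc n) * (S g * h (S g))))"
  proof (intro sum.cong refl)
    fix g assume g: "g \<in> partitions (Suc n)"
    have "(\<Sum>r<N. down N g r * ((corner g r - \<alpha>) * h (S g)))
        = (\<Sum>r<N. down N g r * (corner g r - \<alpha>)) * h (S g)"
      by (simp only: sum_distrib_right mult.assoc)
    also have "\<dots> = 2 * \<alpha> * S g * h (S g)"
      using down_moments(2)[OF g] N by (simp add: S_def)
    finally show "mass (Suc n) g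
            * ((\<Sum>r<N. down N g r * ((corner g r - \<alpha>) * h (S g))) / (\<alpha> * real (Suc n)))
        = mass (Suc n) g * (2 / real (Suc n) * (S g * h (S g)))"
      using \<alpha> by (simp add: field_simps del: of_nat_Suc)
  qed
  also have "\<dots> = 2 / real (Suc n) * (\<Sum>g\<in>partitions (Suc n). mass (Suc n) g * (S g * h (S g)))"
    by (simp add: sum_distrib_left mult_ac del: of_nat_Suc)
  also have "(\<Sum>g\<in>partitions (Suc n). mass (Suc n) g * (S g * h (S g))) = ?R"
    unfolding S_def by (rule growth_law[OF N, of "\<lambda>s. s * h s", symmetric])
  finally show ?thesis .
qed

end

section \<open>Long rows and columns\<close>

definition drop_row :: "(nat \<Rightarrow> nat) \<Rightarrow> nat \<Rightarrow> nat" where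
  "drop_row f i = f (Suc i)"

definition drop_col :: "(nat \<Rightarrow> nat) \<Rightarrow> nat \<Rightarrow> nat" where
  "drop_col f i = f i - 1"

lemma drop_row_partition:
  assumes "f \<in> partitions n"
  shows "drop_row f \<in> partitions (n - f 0)"
proof (rule partitionsI[where N = n])
  show "antimono (drop_row f)"
    using row_antimono[OF assms] by (auto simp: antimono_def drop_row_def)
  show "drop_row f i = 0" if "n \<le> i" for i
    using that partition_zero[OF assms] by (simp add: drop_row_def)
  have "f 0 + (\<Sum>i<n. drop_row f i) = n"
    using partition_sum[OF assms, of "Suc n"] unfolding sum.lessThan_Suc_shift
    by (simp add: drop_row_def)
  then show "(\<Sum>i<n. drop_row f i) = n - f 0" by simp
qed

lemma col_0_eq_card:
  assumes "f \<in> partitions n" "n \<le> N"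
  shows "col f 0 \<le> N" "{i\<in>{..<N}. 0 < f i} = {..<col f 0}"
proof -
  note iff = less_col_iff[OF assms(1), where j = 0]
  show le: "col f 0 \<le> N"
    using iff[of N] partition_zero[OF assms] by linarith
  show "{i\<in>{..<N}. 0 < f i} = {..<col f 0}"
  proof (intro set_eqI)
    fix i show "i \<in> {i\<in>{..<N}. 0 < f i} \<longleftrightarrow> i \<in> {..<col f 0}"
      using iff[of i] le by (cases "i < col f 0") auto
  qed
qed

lemma drop_col_partition:
  assumes "f \<in> partitions n"
  shows "drop_col f \<in> partitions (n - col f 0)"
proof (rule partitionsI[where N = n])
  show "antimono (drop_col f)"
    using row_antimono[OF assms] by (auto simp: antimono_def drop_col_def diff_le_mono)
  show "drop_col f i = 0" if "n \<le> i" for i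
    using that partition_zero[OF assms] by (simp add: drop_col_def)
  have "(\<Sum>i<n. f i) = (\<Sum>i<n. drop_col f i + (if 0 < f i then 1 else 0))"
    by (intro sum.cong) (auto simp: drop_col_def)
  also have "\<dots> = (\<Sum>i<n. drop_col f i) + card {i\<in>{..<n}. 0 < f i}"
    using sum.inter_filter[of "{..<n}" "\<lambda>_. 1::nat" "\<lambda>i. 0 < f i"] by (simp add: sum.distrib)
  also have "card {i\<in>{..<n}. 0 < f i} = col f 0"
    using col_0_eq_card(2)[OF assms, of n] by simp
  finally show "(\<Sum>i<n. drop_col f i) = n - col f 0"
    using partition_sum[OF assms, of n] by simp
qed

lemma prod_reverse: "(\<Prod>j<l. g (l - Suc j)) = (\<Prod>j<l. g j)" for g :: "nat \<Rightarrow> real"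
  by (rule prod.nat_diff_reindex)

lemma fact_le_power_times_fact:
  assumes "l \<le> n"
  shows "(fact n :: real) \<le> real n ^ l * fact (n - l)"
proof -
  have "fact n = (fact n div fact (n - l)) * (fact (n - l) :: nat)"
    using fact_dvd[of "n - l" n, where 'a = nat] by simp
  also have "\<dots> \<le> n ^ l * fact (n - l)"
    using fact_div_fact_le_pow[OF assms] by (rule mult_right_mono) simp
  finally have "real (fact n) \<le> real (n ^ l * fact (n - l))" by (rule of_nat_mono)
  then show ?thesis by simp
qed

lemma power_self_le_exp_fact: "real l ^ l \<le> exp (real l) * fact l"
proof -
  have "(\<Sum>k\<in>{l}. real l ^ k /\<^sub>R fact k) \<le> (\<Sum>k. real l ^ k /\<^sub>R fact k)"
    by (rule sum_le_suminf[OF summable_exp_generic]) auto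
  then have "real l ^ l / fact l \<le> exp (real l)"
    by (simp add: exp_def divide_inverse mult.commute)
  then show ?thesis by (simp add: pos_divide_le_eq)
qed

text \<open>By \<open>l! \<ge> (l/e)\<^bsup>l\<^esup>\<close> the left-hand side is at most \<open>l (e x / l)\<^bsup>2l\<^esup>\<close>, where \<open>l = k + 1\<close>. The base is
  at most \<open>e\<^bsup>-s\<^esup>\<close>, and \<open>l \<ge> x \<ge> ln n\<close>.\<close>

lemma poisson_type_tail:
  assumes n: "2 \<le> n" and x: "ln (real n) \<le> x" "exp (real s + 1) * x \<le> real (Suc k)"
  shows "(x\<^sup>2) ^ Suc k / (fact k * fact (Suc k)) \<le> real (Suc k) / real n ^ (2 * s)"
proof -
  define l where "l = Suc k"
  have "0 < ln (real n)" using n by simp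
  then have x0: "0 < x" using x(1) by linarith
  have l0: "0 < real l" by (simp add: l_def)
  have "x * exp 1 * exp (real s) \<le> real l"
    using x(2) by (simp add: l_def exp_add mult_ac)
  then have "(x * exp 1 * exp (real s)) ^ (2 * l) \<le> real l ^ (2 * l)"
    using x0 by (intro power_mono) auto
  also have "\<dots> = (real l ^ l)\<^sup>2" by (simp add: power_mult[symmetric] mult.commute)
  also have "\<dots> \<le> (exp (real l) * fact l)\<^sup>2"
    by (intro power_mono power_self_le_exp_fact) auto
  finally have "x ^ (2 * l) * exp 1 ^ (2 * l) * exp (real s) ^ (2 * l) \<le> exp 1 ^ (2 * l) * (fact l)\<^sup>2"
    by (simp add: power_mult_distrib exp_of_nat_mult[symmetric] exp_double[symmetric])
  then have step: "x ^ (2 * l) * exp (real s) ^ (2 * l) \<le> (fact l)\<^sup>2"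
    by simp
  have nl: "real n \<le> exp (real l)"
  proof -
    have "x * 1 \<le> x * exp (real s + 1)" using x0 by (intro mult_left_mono) auto
    then have "ln (real n) \<le> real l" using x by (simp add: l_def mult.commute)
    then have "exp (ln (real n)) \<le> exp (real l)" by simp
    then show ?thesis using n by simp
  qed
  have "real n ^ (2 * s) \<le> exp (real l) ^ (2 * s)"
    using nl by (intro power_mono) auto
  also have "\<dots> = exp (real s) ^ (2 * l)"
    by (simp add: exp_of_nat_mult[symmetric] mult_ac)
  finally have "x ^ (2 * l) * real n ^ (2 * s) \<le> (fact l)\<^sup>2"
    using step x0 by (meson mult_left_mono order_trans zero_le_power less_imp_le)
  moreover have "(fact l :: real) = real l * fact k" by (simp add: l_def)
  ultimately have "x ^ (2 * l) * real n ^ (2 * s) \<le> real l * (fact k * fact l)"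
    by (simp add: power2_eq_square mult_ac)
  moreover have "0 < (fact k * fact l :: real)" "0 < real n ^ (2 * s)" using n by simp_all
  ultimately have "x ^ (2 * l) / (fact k * fact l) \<le> real l / real n ^ (2 * s)"
    by (simp add: field_simps)
  then show ?thesis by (simp only: l_def power_mult[symmetric])
qed

context jack
begin

lemma hook_drop_row:
  assumes "f \<in> partitions n"
  shows "hook (drop_row f) i j = hook f (Suc i) j"
proof -
  have "k < col (drop_row f) j \<longleftrightarrow> Suc k < col f j" for k
    unfolding less_col_iff[OF assms] less_col_iff[OF drop_row_partition[OF assms]]
    by (simp add: drop_row_def)
  then have "k < col (drop_row f) j \<longleftrightarrow> k < col f j - 1" for k
    by (simp add: less_diff_conv)
  then have "col (drop_row f) j = col f j - 1"
    by (metis linorder_neqE_nat less_irrefl)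
  then show ?thesis by (simp add: hook_def drop_row_def)
qed

lemma hook_prod_drop_row:
  assumes "f \<in> partitions n"
  shows "hook_prod f = (\<Prod>j<f 0. hook f 0 j) * hook_prod (drop_row f)"
proof -
  have f: "hook_prod f = (\<Prod>i<Suc n. \<Prod>j<f i. hook f i j)"
    unfolding hook_prod_def by (rule prod_boxes[OF assms]) simp
  have "hook_prod (drop_row f) = (\<Prod>i<n. \<Prod>j<drop_row f i. hook (drop_row f) i j)"
    unfolding hook_prod_def by (rule prod_boxes[OF drop_row_partition[OF assms]]) simp
  also have "\<dots> = (\<Prod>i<n. \<Prod>j<f (Suc i). hook f (Suc i) j)"
    by (intro prod.cong refl hook_drop_row[OF assms]) (simp add: drop_row_def)
  finally show ?thesis
    unfolding f prod.lessThan_Suc_shift by simp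
qed

lemma hook_drop_col: "hook (drop_col f) i j = hook f i (Suc j)"
proof -
  have "col (drop_col f) j = col f (Suc j)"
    by (simp add: col_def drop_col_def less_diff_conv)
  then show ?thesis by (simp add: hook_def drop_col_def)
qed

lemma hook_prod_drop_col:
  assumes "f \<in> partitions n"
  shows "hook_prod f = (\<Prod>i<col f 0. hook f i 0) * hook_prod (drop_col f)"
proof -
  have "hook_prod f = (\<Prod>i<n. \<Prod>j<f i. hook f i j)"
    unfolding hook_prod_def by (rule prod_boxes[OF assms order_refl])
  also have "\<dots> = (\<Prod>i<n. (if 0 < f i then hook f i 0 else 1) * (\<Prod>j<drop_col f i. hook (drop_col f) i j))"
  proof (rule prod.cong[OF refl])
    fix i
    show "(\<Prod>j<f i. hook f i j)
        = (if 0 < f i then hook f i 0 else 1) * (\<Prod>j<drop_col f i. hook (drop_col f) i j)"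
      by (cases "f i") (simp_all only: prod.lessThan_Suc_shift hook_drop_col drop_col_def, simp_all)
  qed
  also have "\<dots> = (\<Prod>i<n. if 0 < f i then hook f i 0 else 1) * hook_prod (drop_col f)"
    unfolding prod.distrib hook_prod_def
    using prod_boxes[OF drop_col_partition[OF assms], of n "hook (drop_col f)"] by simp
  also have "(\<Prod>i<n. if 0 < f i then hook f i 0 else 1) = (\<Prod>i\<in>{i\<in>{..<n}. 0 < f i}. hook f i 0)"
    by (rule prod.inter_filter[symmetric]) simp
  also have "{i\<in>{..<n}. 0 < f i} = {..<col f 0}"
    by (rule col_0_eq_card(2)[OF assms order_refl])
  finally show ?thesis .
qed

lemma first_row_hooks_ge:
  assumes l: "f 0 = Suc k"
  shows "\<alpha> ^ (2 * k + 1) * fact k * fact (Suc k) \<le> (\<Prod>j<f 0. hook f 0 j)"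
proof -
  have "\<alpha> ^ (2 * k + 1) * fact k * fact (Suc k)
      \<le> (\<Prod>a<Suc k. (\<alpha> * real a + 1) * (\<alpha> * real a + \<alpha>))"
  proof (induction k)
    case (Suc k)
    have "\<alpha> ^ (2 * Suc k + 1) * fact (Suc k) * fact (Suc (Suc k))
        = \<alpha> ^ (2 * k + 1) * fact k * fact (Suc k) * ((\<alpha> * real (Suc k)) * (\<alpha> * real (Suc k) + \<alpha>))"
      by (simp add: algebra_simps)
    also have "\<dots> \<le> (\<Prod>a<Suc k. (\<alpha> * real a + 1) * (\<alpha> * real a + \<alpha>))
        * ((\<alpha> * real (Suc k) + 1) * (\<alpha> * real (Suc k) + \<alpha>))"
      using \<alpha> by (intro mult_mono Suc) (auto intro!: prod_nonneg mult_nonneg_nonneg)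
    finally show ?case by (simp only: prod.lessThan_Suc[of _ "Suc k"])
  qed simp
  also have "\<dots> = (\<Prod>j<f 0. (\<alpha> * real (f 0 - Suc j) + 1) * (\<alpha> * real (f 0 - Suc j) + \<alpha>))"
    unfolding l by (rule prod_reverse[symmetric])
  also have "\<dots> \<le> (\<Prod>j<f 0. hook f 0 j)"
    unfolding hook_def using \<alpha> by (intro prod_mono conjI mult_mono mult_nonneg_nonneg) auto
  finally show ?thesis .
qed

lemma first_col_hooks_ge:
  assumes l: "col f 0 = Suc k"
  shows "\<alpha> * fact k * fact (Suc k) \<le> (\<Prod>i<col f 0. hook f i 0)"
proof -
  have "\<alpha> * fact k * fact (Suc k) \<le> (\<Prod>a<Suc k. (real a + 1) * (real a + \<alpha>))"
  proof (induction k)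
    case (Suc k)
    have "\<alpha> * fact (Suc k) * fact (Suc (Suc k))
        = \<alpha> * fact k * fact (Suc k) * ((real (Suc k) + 1) * real (Suc k))"
      by (simp add: algebra_simps)
    also have "\<dots> \<le> (\<Prod>a<Suc k. (real a + 1) * (real a + \<alpha>))
        * ((real (Suc k) + 1) * (real (Suc k) + \<alpha>))"
      using \<alpha> by (intro mult_mono Suc) (auto intro!: prod_nonneg mult_nonneg_nonneg)
    finally show ?case by (simp only: prod.lessThan_Suc[of _ "Suc k"])
  qed simp
  also have "\<dots> = (\<Prod>i<col f 0. (real (col f 0 - Suc i) + 1) * (real (col f 0 - Suc i) + \<alpha>))"
    unfolding l by (rule prod_reverse[symmetric])
  also have "\<dots> \<le> (\<Prod>i<col f 0. hook f i 0)"
    unfolding hook_def using \<alpha> by (intro prod_mono conjI mult_mono mult_nonneg_nonneg) auto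
  finally show ?thesis .
qed

text \<open>Splitting off a first row or column of length l, with hook product H, leaves the mass of a
  smaller partition; the quotient of the factorials is at most \<open>n\<^bsup>l\<^esup>\<close>, and the masses of the remaining
  partitions add up to at most 1.\<close>

lemma split_off_mass_le:
  assumes l: "l \<le> n" and h: "0 < h"
    and A: "A \<subseteq> partitions n" and inj: "inj_on d A"
    and d: "\<And>f. f \<in> A \<Longrightarrow> d f \<in> partitions (n - l)"
    and H: "\<And>f. f \<in> A \<Longrightarrow> h \<le> H f"
    and prod: "\<And>f. f \<in> A \<Longrightarrow> hook_prod f = H f * hook_prod (d f)"
  shows "(\<Sum>f\<in>A. mass n f) \<le> (\<alpha> * real n) ^ l / h"
proof -
  have one: "mass n f \<le> (\<alpha> * real n) ^ l / h * mass (n - l) (d f)" if f: "f \<in> A" for f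
  proof -
    have "mass n f = \<alpha> ^ n * fact n / (H f * hook_prod (d f))"
      by (simp add: mass_def prod[OF f])
    also have "\<dots> \<le> \<alpha> ^ n * (real n ^ l * fact (n - l)) / (h * hook_prod (d f))"
      using \<alpha> h H[OF f] hook_prod_pos[of "d f"] fact_le_power_times_fact[OF l]
      by (intro frac_le mult_left_mono mult_right_mono mult_pos_pos mult_nonneg_nonneg) auto
    also have "\<alpha> ^ n = \<alpha> ^ l * \<alpha> ^ (n - l)" using l by (simp flip: power_add)
    also have "\<alpha> ^ l * \<alpha> ^ (n - l) * (real n ^ l * fact (n - l)) / (h * hook_prod (d f))
        = (\<alpha> * real n) ^ l / h * mass (n - l) (d f)"
      by (simp add: mass_def power_mult_distrib)
    finally show ?thesis .
  qed
  have "(\<Sum>f\<in>A. mass n f) \<le> (\<alpha> * real n) ^ l / h * (\<Sum>g\<in>d ` A. mass (n - l) g)"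
    using sum_mono[OF one] by (simp add: sum.reindex[OF inj] sum_distrib_left)
  also have "\<dots> \<le> (\<alpha> * real n) ^ l / h * (\<Sum>g\<in>partitions (n - l). mass (n - l) g)"
    using \<alpha> h d by (intro mult_left_mono sum_mono2) (auto simp: finite_partitions mass_nonneg)
  finally show ?thesis by (simp only: mass_sum mult_1_right)
qed

text \<open>The hooks in a row of length \<open>k + 1\<close> are smallest when all legs are 0.\<close>

lemma first_row_mass_le:
  shows "(\<Sum>f\<in>{f\<in>partitions n. f 0 = Suc k}. mass n f)
           \<le> \<alpha> * ((real n / \<alpha>) ^ Suc k / (fact k * fact (Suc k)))" (is "sum _ ?A \<le> _")
proof (cases "Suc k \<le> n")
  case False
  have no: "?A = {}" using partition_row_le[of _ n 0] False by fastforce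
  show ?thesis unfolding no using \<alpha> by simp
next
  case True
  define h where "h = \<alpha> ^ (2 * k + 1) * fact k * (fact (Suc k) :: real)"
  have inj: "inj_on drop_row ?A"
  proof (rule inj_onI)
    fix f g assume *: "f \<in> ?A" "g \<in> ?A" "drop_row f = drop_row g"
    show "f = g"
    proof
      fix i show "f i = g i"
        using *(1,2) fun_cong[OF *(3), of "i - 1"] by (cases i) (auto simp: drop_row_def)
    qed
  qed
  have "sum (mass n) ?A \<le> (\<alpha> * real n) ^ Suc k / h"
  proof (rule split_off_mass_le[OF True _ _ inj, where H = "\<lambda>f. \<Prod>j<f 0. hook f 0 j"])
    fix f assume f: "f \<in> ?A"
    show "drop_row f \<in> partitions (n - Suc k)" using f drop_row_partition[of f n] by auto
    show "h \<le> (\<Prod>j<f 0. hook f 0 j)" using f first_row_hooks_ge[of f k] by (auto simp: h_def)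
    show "hook_prod f = (\<Prod>j<f 0. hook f 0 j) * hook_prod (drop_row f)"
      using f by (intro hook_prod_drop_row) auto
  qed (use \<alpha> in \<open>auto simp: h_def simp del: fact_Suc\<close>)
  also have "\<dots> = \<alpha> * ((real n / \<alpha>) ^ Suc k / (fact k * fact (Suc k)))"
  proof -
    have "\<alpha> ^ (2 * k + 1) * \<alpha> = \<alpha> ^ Suc k * \<alpha> ^ Suc k"
      by (simp add: power_add[symmetric] mult_2[symmetric] del: power_Suc) (simp add: power_add mult_2)
    then show ?thesis
      using \<alpha> by (simp only: h_def power_mult_distrib power_divide) (simp add: field_simps del: fact_Suc power_Suc)
  qed
  finally show ?thesis .
qed

text \<open>Likewise for the first column, whose hooks are smallest when all arms are 0.\<close>

lemma first_col_mass_le: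
  shows "(\<Sum>f\<in>{f\<in>partitions n. col f 0 = Suc k}. mass n f)
           \<le> 1 / \<alpha> * ((\<alpha> * real n) ^ Suc k / (fact k * fact (Suc k)))" (is "sum _ ?A \<le> _")
proof (cases "Suc k \<le> n")
  case False
  have no: "?A = {}" using col_0_eq_card(1)[of _ n n] False by fastforce
  show ?thesis unfolding no using \<alpha> by simp
next
  case True
  define h where "h = \<alpha> * fact k * (fact (Suc k) :: real)"
  have inj: "inj_on drop_col ?A"
  proof (rule inj_onI)
    fix f g assume *: "f \<in> ?A" "g \<in> ?A" "drop_col f = drop_col g"
    show "f = g"
    proof
      fix i
      have "0 < f i \<longleftrightarrow> i < Suc k" "0 < g i \<longleftrightarrow> i < Suc k"
        using *(1,2) less_col_iff[of f n i 0] less_col_iff[of g n i 0] by auto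
      then show "f i = g i"
        using fun_cong[OF *(3), of i] by (cases "i < Suc k") (auto simp: drop_col_def)
    qed
  qed
  have "sum (mass n) ?A \<le> (\<alpha> * real n) ^ Suc k / h"
  proof (rule split_off_mass_le[OF True _ _ inj, where H = "\<lambda>f. \<Prod>i<col f 0. hook f i 0"])
    fix f assume f: "f \<in> ?A"
    show "drop_col f \<in> partitions (n - Suc k)" using f drop_col_partition[of f n] by auto
    show "h \<le> (\<Prod>i<col f 0. hook f i 0)" using f first_col_hooks_ge[of f k] by (auto simp: h_def)
    show "hook_prod f = (\<Prod>i<col f 0. hook f i 0) * hook_prod (drop_col f)"
      using f by (intro hook_prod_drop_col) auto
  qed (use \<alpha> in \<open>auto simp: h_def simp del: fact_Suc\<close>)
  then show ?thesis by (simp add: h_def del: fact_Suc power_Suc)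
qed

text \<open>There are at most n values in the tail, and each of them has probability at most
  \<open>n\<^sup>2 / n\<^bsup>2s\<^esup>\<close>.\<close>

lemma statistic_tail:
  fixes X :: "(nat \<Rightarrow> nat) \<Rightarrow> nat"
  assumes n: "2 \<le> n" and \<beta>: "0 \<le> \<beta>" "\<beta> \<le> real n"
    and x: "ln (real n) \<le> x"
    and X: "\<And>f. f \<in> partitions n' \<Longrightarrow> X f \<le> n'" and n': "n' \<le> n"
    and mass: "\<And>k. (\<Sum>f\<in>{f\<in>partitions n'. X f = Suc k}. mass n' f)
                 \<le> \<beta> * ((x\<^sup>2) ^ Suc k / (fact k * fact (Suc k)))"
  shows "(\<Sum>f\<in>{f\<in>partitions n'. exp (real s + 1) * x < real (X f)}. mass n' f)
           \<le> real n ^ 3 / real n ^ (2 * s)"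
proof -
  define t where "t = exp (real s + 1) * x"
  have "0 \<le> ln (real n)" using n by simp
  then have "0 \<le> x" using x by linarith
  then have t0: "0 \<le> t" by (simp add: t_def)
  have sub: "{f\<in>partitions n'. t < real (X f)}
      \<subseteq> (\<Union>k\<in>{k\<in>{..<n}. t \<le> real (Suc k)}. {f\<in>partitions n'. X f = Suc k})"
  proof
    fix f assume f: "f \<in> {f\<in>partitions n'. t < real (X f)}"
    then have "0 < X f" using t0 by (cases "X f") auto
    then obtain k where k: "X f = Suc k" by (cases "X f") auto
    then show "f \<in> (\<Union>k\<in>{k\<in>{..<n}. t \<le> real (Suc k)}. {f\<in>partitions n'. X f = Suc k})"
      using f X[of f] n' by (auto intro!: bexI[of _ k])
  qed
  have "(\<Sum>f\<in>{f\<in>partitions n'. t < real (X f)}. mass n' f)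
      \<le> (\<Sum>f\<in>(\<Union>k\<in>{k\<in>{..<n}. t \<le> real (Suc k)}. {f\<in>partitions n'. X f = Suc k}). mass n' f)"
    by (rule sum_mono2[OF _ sub]) (auto simp: finite_partitions mass_nonneg)
  also have "\<dots> = (\<Sum>k\<in>{k\<in>{..<n}. t \<le> real (Suc k)}. \<Sum>f\<in>{f\<in>partitions n'. X f = Suc k}. mass n' f)"
    by (rule sum.UNION_disjoint) (auto simp: finite_partitions)
  also have "\<dots> \<le> (\<Sum>k\<in>{k\<in>{..<n}. t \<le> real (Suc k)}. real n * (real n / real n ^ (2 * s)))"
  proof (rule sum_mono)
    fix k assume k: "k \<in> {k\<in>{..<n}. t \<le> real (Suc k)}"
    have "(\<Sum>f\<in>{f\<in>partitions n'. X f = Suc k}. mass n' f)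
        \<le> \<beta> * ((x\<^sup>2) ^ Suc k / (fact k * fact (Suc k)))" by (rule mass)
    also have "\<dots> \<le> real n * (real n / real n ^ (2 * s))"
    proof (intro mult_mono)
      have "(x\<^sup>2) ^ Suc k / (fact k * fact (Suc k)) \<le> real (Suc k) / real n ^ (2 * s)"
        using k by (intro poisson_type_tail[OF n x]) (auto simp: t_def)
      also have "\<dots> \<le> real n / real n ^ (2 * s)" using k by (intro divide_right_mono) auto
      finally show "(x\<^sup>2) ^ Suc k / (fact k * fact (Suc k)) \<le> real n / real n ^ (2 * s)" .
    qed (use \<beta> in auto)
    finally show "(\<Sum>f\<in>{f\<in>partitions n'. X f = Suc k}. mass n' f)
        \<le> real n * (real n / real n ^ (2 * s))" .
  qed
  also have "\<dots> = real (card {k\<in>{..<n}. t \<le> real (Suc k)}) * (real n * (real n / real n ^ (2 * s)))"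
    by simp
  also have "\<dots> \<le> real n * (real n * (real n / real n ^ (2 * s)))"
  proof (rule mult_right_mono)
    have "card {k\<in>{..<n}. t \<le> real (Suc k)} \<le> card {..<n}" by (rule card_mono) auto
    then show "real (card {k\<in>{..<n}. t \<le> real (Suc k)}) \<le> real n" by simp
  qed simp
  finally show ?thesis by (simp add: t_def power3_eq_cube)
qed

definition long_line :: "nat \<Rightarrow> nat \<Rightarrow> (nat \<Rightarrow> nat) set" where
  "long_line s n = {f. exp (real s + 1) * sqrt (real n / \<alpha>) < real (f 0)
                        \<or> exp (real s + 1) * sqrt (\<alpha> * real n) < real (col f 0)}"

text \<open>The assumption on \<alpha> says that both \<open>sqrt (n/\<alpha>)\<close> and \<open>sqrt (\<alpha> n)\<close> are at least \<open>ln n\<close>, as the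
  tail estimate demands.\<close>

lemma long_rows_or_cols_unlikely:
  assumes range: "(ln (real n))\<^sup>2 / real n \<le> \<alpha>" "\<alpha> \<le> real n / (ln (real n))\<^sup>2"
    and n: "3 \<le> n" and n': "n' \<le> n"
  shows "(\<Sum>f\<in>partitions n' \<inter> long_line s n. mass n' f)
           \<le> 2 * real n ^ 3 / real n ^ (2 * s)" (is "sum _ ?B \<le> _")
    and "\<alpha> \<le> real n" and "1 / \<alpha> \<le> real n"
proof -
  have "exp 1 \<le> real n" using exp_le n by linarith
  then have ln1: "1 \<le> ln (real n)" using n by (simp add: ln_ge_iff)
  then have ln2: "1 \<le> (ln (real n))\<^sup>2" by simp
  have n0: "0 < real n" using n by simp
  have "real n / (ln (real n))\<^sup>2 \<le> real n / 1"
    using ln2 n0 by (intro divide_left_mono) auto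
  then show \<alpha>n: "\<alpha> \<le> real n" using range(2) by simp
  have "(ln (real n))\<^sup>2 \<le> \<alpha> * real n" using range(1) n0 by (simp add: field_simps)
  then have x2: "ln (real n) \<le> sqrt (\<alpha> * real n)" and "1 \<le> \<alpha> * real n"
    using ln2 by (auto intro: real_le_rsqrt)
  then show \<alpha>i: "1 / \<alpha> \<le> real n" using \<alpha> by (simp add: field_simps)
  have ln0: "0 < (ln (real n))\<^sup>2" using ln2 by linarith
  have "(ln (real n))\<^sup>2 \<le> real n / \<alpha>"
    using range(2) by (simp only: pos_le_divide_eq[OF ln0] pos_le_divide_eq[OF \<alpha>] mult.commute)
  then have x1: "ln (real n) \<le> sqrt (real n / \<alpha>)" by (rule real_le_rsqrt)
  let ?R = "{f\<in>partitions n'. exp (real s + 1) * sqrt (real n / \<alpha>) < real (f 0)}"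
  let ?C = "{f\<in>partitions n'. exp (real s + 1) * sqrt (\<alpha> * real n) < real (col f 0)}"
  have row: "sum (mass n') ?R \<le> real n ^ 3 / real n ^ (2 * s)"
  proof (rule statistic_tail[OF _ _ _ x1 _ n'])
    fix k
    have "(\<Sum>f\<in>{f\<in>partitions n'. f 0 = Suc k}. mass n' f)
        \<le> \<alpha> * ((real n' / \<alpha>) ^ Suc k / (fact k * fact (Suc k)))" by (rule first_row_mass_le)
    also have "\<dots> \<le> \<alpha> * ((real n / \<alpha>) ^ Suc k / (fact k * fact (Suc k)))"
      using \<alpha> n' by (intro mult_left_mono divide_right_mono power_mono) auto
    finally show "(\<Sum>f\<in>{f\<in>partitions n'. f 0 = Suc k}. mass n' f)
        \<le> \<alpha> * (((sqrt (real n / \<alpha>))\<^sup>2) ^ Suc k / (fact k * fact (Suc k)))"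
      using \<alpha> by simp
  qed (use n \<alpha> \<alpha>n partition_row_le in auto)
  have "sum (mass n') ?C \<le> real n ^ 3 / real n ^ (2 * s)"
  proof (rule statistic_tail[OF _ _ _ x2 _ n'])
    fix k
    have "(\<Sum>f\<in>{f\<in>partitions n'. col f 0 = Suc k}. mass n' f)
        \<le> 1 / \<alpha> * ((\<alpha> * real n') ^ Suc k / (fact k * fact (Suc k)))" by (rule first_col_mass_le)
    also have "\<dots> \<le> 1 / \<alpha> * ((\<alpha> * real n) ^ Suc k / (fact k * fact (Suc k)))"
      using \<alpha> n' by (intro mult_left_mono divide_right_mono power_mono) auto
    finally show "(\<Sum>f\<in>{f\<in>partitions n'. col f 0 = Suc k}. mass n' f)
        \<le> 1 / \<alpha> * (((sqrt (\<alpha> * real n))\<^sup>2) ^ Suc k / (fact k * fact (Suc k)))"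
      using \<alpha> by simp
  qed (use n \<alpha> \<alpha>i col_0_eq_card(1) in auto)
  moreover have "sum (mass n') ?B \<le> sum (mass n') ?R + sum (mass n') ?C"
  proof -
    have "?B = ?R \<union> ?C" by (auto simp: long_line_def)
    then have "sum (mass n') ?B + sum (mass n') (?R \<inter> ?C)
        = sum (mass n') ?R + sum (mass n') ?C"
      by (simp add: sum.union_inter finite_partitions)
    moreover have "0 \<le> sum (mass n') (?R \<inter> ?C)"
      by (intro sum_nonneg mass_nonneg)
    ultimately show ?thesis by linarith
  qed
  ultimately show "sum (mass n') ?B \<le> 2 * real n ^ 3 / real n ^ (2 * s)"
    using row by simp
qed

end

section \<open>The distribution of the statistic W\<close>

definition row_fun :: "nat list \<Rightarrow> nat \<Rightarrow> nat" where
  "row_fun lam i = (if i < length lam then lam ! i else 0)"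

lemma diagram_row_fun: "diagram lam = boxes (row_fun lam)"
  by (auto simp: diagram_def boxes_def row_fun_def split: if_splits)

lemma row_fun_partition:
  assumes "lam \<in> int_partitions n"
  shows "row_fun lam \<in> partitions n"
proof (rule partitionsI[where N = "length lam"])
  have "sorted_wrt (\<ge>) lam" using assms by (simp add: int_partitions_def)
  then have "lam ! k \<le> lam ! i" if "i \<le> k" "k < length lam" for i k
    using that by (cases "i = k") (auto simp: sorted_wrt_iff_nth_less)
  then show "antimono (row_fun lam)"
    by (auto simp: antimono_def row_fun_def)
  show "row_fun lam i = 0" if "length lam \<le> i" for i
    using that by (simp add: row_fun_def)
  have "(\<Sum>i<length lam. row_fun lam i) = (\<Sum>i<length lam. lam ! i)"
    by (intro sum.cong) (auto simp: row_fun_def)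
  then show "(\<Sum>i<length lam. row_fun lam i) = n"
    using assms by (simp add: int_partitions_def sum_list_sum_nth atLeast0LessThan)
qed

lemma bij_betw_row_fun: "bij_betw row_fun (int_partitions n) (partitions n)"
proof (rule bij_betwI[where g = "\<lambda>f. map f [0..<col f 0]"])
  show "row_fun \<in> int_partitions n \<rightarrow> partitions n"
    using row_fun_partition by auto
  show "(\<lambda>f. map f [0..<col f 0]) \<in> partitions n \<rightarrow> int_partitions n"
  proof
    fix f assume f: "f \<in> partitions n"
    have "sorted_wrt (\<ge>) (map f [0..<col f 0])"
      using row_antimono[OF f] by (auto simp: sorted_wrt_iff_nth_less)
    moreover have "0 \<notin> set (map f [0..<col f 0])"
      using less_col_iff[OF f, of _ 0] by force
    moreover have "sum_list (map f [0..<col f 0]) = n"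
    proof -
      have "sum_list (map f [0..<col f 0]) = (\<Sum>i<col f 0. f i)"
        by (simp add: sum_list_distinct_conv_sum_set atLeast0LessThan)
      also have "\<dots> = (\<Sum>i<n. f i)"
      proof (rule sum.mono_neutral_left)
        show "{..<col f 0} \<subseteq> {..<n}" using col_0_eq_card(1)[OF f order_refl] by auto
        show "\<forall>i\<in>{..<n} - {..<col f 0}. f i = 0" using less_col_iff[OF f, of _ 0] by fastforce
      qed simp
      finally show ?thesis using partition_sum[OF f order_refl] by simp
    qed
    ultimately show "map f [0..<col f 0] \<in> int_partitions n"
      by (simp only: int_partitions_def mem_Collect_eq simp_thms)
  qed
  show "map (row_fun lam) [0..<col (row_fun lam) 0] = lam" if lam: "lam \<in> int_partitions n" for lam
  proof -
    have "0 < row_fun lam i \<longleftrightarrow> i < length lam" for i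
    proof (cases "i < length lam")
      case True
      then have "lam ! i \<in> set lam" by simp
      moreover have "0 \<notin> set lam" using lam by (simp add: int_partitions_def)
      ultimately show ?thesis using True by (metis gr0I row_fun_def)
    qed (simp add: row_fun_def)
    then have "{i. 0 < row_fun lam i} = {..<length lam}" by auto
    then have "col (row_fun lam) 0 = length lam" by (simp add: col_def)
    then show ?thesis by (auto intro!: nth_equalityI simp: row_fun_def)
  qed
  show "row_fun (map f [0..<col f 0]) = f" if f: "f \<in> partitions n" for f
  proof
    fix i show "row_fun (map f [0..<col f 0]) i = f i"
      using less_col_iff[OF f, of i 0] by (auto simp: row_fun_def)
  qed
qed

lemma real_choose_two: "real (k choose 2) = real k * (real k - 1) / 2"
  by (induction k) (simp_all add: numeral_2_eq_2 field_simps)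

lemma real_choose_two_eq_sum: "real (k choose 2) = (\<Sum>i<k. real i)"
  by (induction k) (simp_all add: numeral_2_eq_2)

context jack
begin

lemma jack_weight_eq_mass:
  assumes "lam \<in> int_partitions n"
  shows "jack_weight \<alpha> n lam = mass n (row_fun lam)"
proof -
  define f where "f = row_fun lam"
  have f: "f \<in> partitions n" unfolding f_def by (rule row_fun_partition[OF assms])
  have arm: "arm lam (i, j) = f i - Suc j" for i j
  proof -
    have "{j'. j < j' \<and> (i, j') \<in> diagram lam} = {Suc j..<f i}"
      by (auto simp: diagram_row_fun boxes_def f_def)
    then show ?thesis by (simp add: arm_def)
  qed
  have leg: "leg lam (i, j) = col f j - Suc i" for i j
  proof -
    have "{i'. i < i' \<and> (i', j) \<in> diagram lam} = {Suc i..<col f j}"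
      by (auto simp: diagram_row_fun boxes_def less_col_iff[OF f]) (simp_all add: f_def)
    then show ?thesis by (simp add: leg_def)
  qed
  have "(\<Prod>s\<in>diagram lam. (\<alpha> * real (arm lam s) + real (leg lam s) + 1)
          * (\<alpha> * real (arm lam s) + real (leg lam s) + \<alpha>)) = hook_prod f"
    unfolding hook_prod_def diagram_row_fun f_def[symmetric]
    by (intro prod.cong refl) (auto simp: hook_def arm leg)
  then show ?thesis by (simp add: jack_weight_def mass_def f_def)
qed

text \<open>Counting the boxes above each box by columns or by rows gives
  \<open>\<Sum>j. (col j choose 2) = \<Sum>k. k f(k)\<close>.\<close>

lemma W_stat_eq_content_sum:
  assumes "lam \<in> int_partitions n"
  shows "W_stat n \<alpha> lam = content_sum n (row_fun lam) / sqrt (\<alpha> * real (n choose 2))"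
proof -
  define f where "f = row_fun lam"
  have f: "f \<in> partitions n" unfolding f_def by (rule row_fun_partition[OF assms])
  have row: "row_len lam i = f i" for i
  proof -
    have "{j. (i, j) \<in> diagram lam} = {..<f i}" by (auto simp: diagram_row_fun boxes_def f_def)
    then show ?thesis by (simp add: row_len_def)
  qed
  have col: "col_len lam j = col f j" for j
    by (simp add: col_len_def col_def diagram_row_fun boxes_def f_def)
  have "(\<Sum>j<n. real (col f j choose 2)) = (\<Sum>j<n. \<Sum>k<n. if j < f k then real k else 0)"
  proof (intro sum.cong refl)
    fix j
    have "(\<Sum>k<n. if j < f k then real k else 0) = (\<Sum>k\<in>{k\<in>{..<n}. j < f k}. real k)"
      by (rule sum.inter_filter[symmetric]) simp
    also have "{k\<in>{..<n}. j < f k} = {..<col f j}"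
    proof (intro set_eqI)
      fix k show "k \<in> {k\<in>{..<n}. j < f k} \<longleftrightarrow> k \<in> {..<col f j}"
        using less_col_iff[OF f, of k j] partition_zero[OF f, of k] by (cases "k < n") auto
    qed
    finally show "real (col f j choose 2) = (\<Sum>k<n. if j < f k then real k else 0)"
      by (simp add: real_choose_two_eq_sum)
  qed
  also have "\<dots> = (\<Sum>k<n. \<Sum>j<n. if j < f k then real k else 0)" by (rule sum.swap)
  also have "\<dots> = (\<Sum>k<n. real k * real (f k))"
  proof (intro sum.cong refl)
    fix k
    have "(\<Sum>j<n. if j < f k then real k else 0) = (\<Sum>j\<in>{j\<in>{..<n}. j < f k}. real k)"
      by (rule sum.inter_filter[symmetric]) simp
    also have "{j\<in>{..<n}. j < f k} = {..<f k}" using partition_row_le[OF f, of k] by auto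
    finally show "(\<Sum>j<n. if j < f k then real k else 0) = real k * real (f k)" by simp
  qed
  finally show ?thesis
    unfolding W_stat_def content_sum_def f_def[symmetric] row col sum_subtractf
    by (simp add: real_choose_two)
qed

lemma jack_measure_prob:
  shows "\<P>(lam in jack_measure \<alpha> n. W_stat n \<alpha> lam \<le> z)
    = (\<Sum>f\<in>partitions n. mass n f
         * (if content_sum n f / sqrt (\<alpha> * real (n choose 2)) \<le> z then 1 else 0))"
proof -
  define X where "X = {lam\<in>int_partitions n. W_stat n \<alpha> lam \<le> z}"
  have fin: "finite (int_partitions n)"
    using bij_betw_finite[OF bij_betw_row_fun[of n]] finite_partitions by simp
  have pos: "0 \<le> jack_weight \<alpha> n lam" if "lam \<in> int_partitions n" for lam
    using that by (simp add: jack_weight_eq_mass mass_nonneg)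
  have "emeasure (jack_measure \<alpha> n) X = (\<Sum>lam\<in>X. ennreal (jack_weight \<alpha> n lam))"
    unfolding jack_measure_def
    by (rule emeasure_point_measure_finite2) (use fin in \<open>auto simp: X_def\<close>)
  also have "\<dots> = ennreal (\<Sum>lam\<in>X. jack_weight \<alpha> n lam)"
    by (rule sum_ennreal) (auto simp: X_def pos)
  finally have "measure (jack_measure \<alpha> n) X = (\<Sum>lam\<in>X. jack_weight \<alpha> n lam)"
    using sum_nonneg[of X "jack_weight \<alpha> n"] pos by (simp add: measure_def X_def)
  also have "\<dots> = (\<Sum>lam\<in>int_partitions n. if W_stat n \<alpha> lam \<le> z then jack_weight \<alpha> n lam else 0)"
    unfolding X_def by (rule sum.inter_filter[OF fin])
  also have "\<dots> = (\<Sum>lam\<in>int_partitions n. mass n (row_fun lam)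
         * (if content_sum n (row_fun lam) / sqrt (\<alpha> * real (n choose 2)) \<le> z then 1 else 0))"
    by (intro sum.cong refl) (simp add: jack_weight_eq_mass W_stat_eq_content_sum)
  also have "\<dots> = (\<Sum>f\<in>partitions n. mass n f
         * (if content_sum n f / sqrt (\<alpha> * real (n choose 2)) \<le> z then 1 else 0))"
    by (rule sum.reindex_bij_betw[OF bij_betw_row_fun])
  finally show ?thesis
    by (simp add: X_def jack_measure_def space_point_measure)
qed

definition sd :: "nat \<Rightarrow> real" where
  "sd n = sqrt (\<alpha> * real (n choose 2))"

lemma sd_ge:
  assumes "3 \<le> n"
  shows "sqrt (\<alpha> * real n) * sqrt (real n) / 2 \<le> sd n" "sqrt \<alpha> * real n / 2 \<le> sd n" "0 < sd n"
proof -
  have "\<alpha> * real n * real n / 4 \<le> \<alpha> * (real n * (real n - 1) / 2)"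
  proof -
    have "real n / 4 \<le> (real n - 1) / 2" using assms \<alpha> by (simp add: field_simps)
    then have "\<alpha> * real n * (real n / 4) \<le> \<alpha> * real n * ((real n - 1) / 2)"
      using assms \<alpha> by (intro mult_left_mono) auto
    then show ?thesis by simp
  qed
  then have "sqrt (\<alpha> * real n * real n / 4) \<le> sd n"
    by (simp add: sd_def real_choose_two)
  then show 1: "sqrt (\<alpha> * real n) * sqrt (real n) / 2 \<le> sd n"
    by (simp add: real_sqrt_mult real_sqrt_divide)
  have "sqrt (\<alpha> * real n) * sqrt (real n) = sqrt \<alpha> * (sqrt (real n) * sqrt (real n))"
    by (simp only: real_sqrt_mult mult.assoc)
  also have "sqrt (real n) * sqrt (real n) = real n" by simp
  finally show 2: "sqrt \<alpha> * real n / 2 \<le> sd n"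
    using 1 by simp
  have "0 < sqrt \<alpha> * real n" using assms \<alpha> by simp
  then show "0 < sd n" using 2 by linarith
qed

text \<open>The last box added has scaled content T. Its conditional variance is
  \<open>\<alpha> (n - 1)\<close> divided by \<open>\<alpha> n (n - 1) / 2\<close>.\<close>

lemma stein_step_jack:
  assumes n: "3 \<le> n"
  shows "stein_step (partitions (n - 1)) {..<Suc n} (mass (n - 1)) (up n)
           (\<lambda>f. content_sum n f / sd n) (\<lambda>f r. corner f r / sd n) (2 / real n)"
proof
  have m: "n - 1 \<le> n" "n - 1 < n" "Suc (n - 1) = n" using n by auto
  have sd: "0 < sd n" by (rule sd_ge(3)[OF n])
  show "finite (partitions (n - 1))" by (rule finite_partitions)
  show "finite {..<Suc n}" by simp
  show "0 \<le> mass (n - 1) f" for f by (rule mass_nonneg)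
  show "(\<Sum>f\<in>partitions (n - 1). mass (n - 1) f) = 1" by (rule mass_sum)
  show "0 < 2 / real n" using n by simp
  fix f assume f: "f \<in> partitions (n - 1)"
  show "0 \<le> up n f r" if "r \<in> {..<Suc n}" for r
    using that by (intro up_nonneg[OF f]) simp
  show "(\<Sum>r<Suc n. up n f r) = 1" by (rule up_moments(1)[OF f m(1) n])
  have "(\<Sum>r<Suc n. up n f r * (corner f r / sd n))
      = (\<Sum>r<Suc n. up n f r * corner f r) / sd n"
    unfolding sum_divide_distrib by (intro sum.cong refl) simp
  then show "(\<Sum>r<Suc n. up n f r * (corner f r / sd n)) = 0"
    unfolding up_moments(2)[OF f m(1) n] by (rule trans) simp
  have "(\<Sum>r<Suc n. up n f r * (corner f r / sd n)\<^sup>2)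
      = (\<Sum>r<Suc n. up n f r * (corner f r)\<^sup>2) / (sd n)\<^sup>2"
    unfolding sum_divide_distrib by (intro sum.cong refl) (simp add: power_divide)
  also have "(\<Sum>r<Suc n. up n f r * (corner f r)\<^sup>2) = \<alpha> * real (n - 1)"
    by (rule up_moments(3)[OF f m(1) n])
  also have "(sd n)\<^sup>2 = \<alpha> * (real n * (real n - 1) / 2)"
    using \<alpha> n by (simp add: sd_def real_choose_two)
  also have "\<alpha> * real (n - 1) / (\<alpha> * (real n * (real n - 1) / 2)) = 2 / real n"
    using \<alpha> n by (simp add: of_nat_diff field_simps)
  finally show "(\<Sum>r<Suc n. up n f r * (corner f r / sd n)\<^sup>2) = 2 / real n" .
next
  fix h :: "real \<Rightarrow> real"
  have m: "n - 1 < n" "Suc (n - 1) = n" using n by auto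
  have sd: "0 < sd n" by (rule sd_ge(3)[OF n])
  have solve: "A = 2 / real n * B \<Longrightarrow> B = A / (2 / real n)" for A B
    using n by simp
  \<comment> \<open>The test function in units of the content sum instead of its standard deviation.\<close>
  define k where "k s = h (s / sd n) / sd n" for s
  have "(\<Sum>f\<in>partitions (n - 1). mass (n - 1) f * (\<Sum>r<Suc n. up n f r
              * (corner f r * k (content_sum n f + corner f r))))
       = 2 / real n * (\<Sum>f\<in>partitions (n - 1). mass (n - 1) f * (\<Sum>r<Suc n. up n f r
              * ((content_sum n f + corner f r) * k (content_sum n f + corner f r))))"
    using content_sum_stein_identity[OF m(1) n, of k] unfolding m(2) .
  then have "(\<Sum>f\<in>partitions (n - 1). mass (n - 1) f * (\<Sum>r<Suc n. up n f r
              * ((content_sum n f + corner f r) * k (content_sum n f + corner f r))))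
     = (\<Sum>f\<in>partitions (n - 1). mass (n - 1) f * (\<Sum>r<Suc n. up n f r
              * (corner f r * k (content_sum n f + corner f r)))) / (2 / real n)"
    by (rule solve)
  then show "(\<Sum>f\<in>partitions (n - 1). mass (n - 1) f * (\<Sum>r<Suc n. up n f r
        * ((content_sum n f / sd n + corner f r / sd n)
           * h (content_sum n f / sd n + corner f r / sd n))))
     = (\<Sum>f\<in>partitions (n - 1). mass (n - 1) f * (\<Sum>r<Suc n. up n f r
        * (corner f r / sd n * h (content_sum n f / sd n + corner f r / sd n))))
       / (2 / real n)"
    by (simp only: k_def add_divide_distrib[symmetric] times_divide_eq_left times_divide_eq_right)
qed

text \<open>Every content that can occur is at most \<open>max \<alpha> 1 * n\<close> in absolute value, and the standard deviation is at
  least \<open>sqrt \<alpha> * n / 2\<close>; as \<alpha> and \<open>1/\<alpha>\<close> are at most n, the quotient is polynomial in n.\<close>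

lemma content_bounds:
  assumes range: "\<alpha> \<le> real n" "1 / \<alpha> \<le> real n" and n: "3 \<le> n" and f: "f \<in> partitions (n - 1)"
  shows "r < Suc n \<Longrightarrow> \<bar>corner f r / sd n\<bar> \<le> 2 * real n ^ 2"
    and "\<bar>content_sum n f / sd n\<bar> \<le> 2 * real n ^ 2"
proof -
  define M where "M = max \<alpha> 1 * real n"
  have M: "M \<le> 2 * real n * sd n"
  proof -
    have "max \<alpha> 1 \<le> sqrt (real n ^ 2 * \<alpha>)"
    proof (rule real_le_rsqrt)
      have "1 \<le> real n * \<alpha>" using \<alpha> range by (simp add: field_simps)
      moreover have "real n * \<alpha> \<le> real n ^ 2 * \<alpha>"
        using \<alpha> range n by (intro mult_right_mono) (auto simp: power2_eq_square)
      moreover have "\<alpha> * \<alpha> \<le> real n ^ 2 * \<alpha>"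
        using \<alpha> range n by (intro mult_right_mono) (auto simp: power2_eq_square intro: order_trans)
      ultimately show "(max \<alpha> 1)\<^sup>2 \<le> real n ^ 2 * \<alpha>"
        by (auto simp: max_def power2_eq_square)
    qed
    also have "\<dots> = real n * sqrt \<alpha>" by (simp add: real_sqrt_mult)
    finally have "M \<le> real n * sqrt \<alpha> * real n"
      unfolding M_def by (intro mult_right_mono) auto
    also have "\<dots> = 2 * real n * (sqrt \<alpha> * real n / 2)" by simp
    also have "\<dots> \<le> 2 * real n * sd n"
      by (intro mult_left_mono sd_ge n) auto
    finally show ?thesis .
  qed
  have sd: "0 < sd n" by (rule sd_ge(3)[OF n])
  have n1: "1 \<le> real n" using n by simp
  have aM: "\<alpha> * real n \<le> M" "real n \<le> M"
    unfolding M_def using mult_right_mono[of \<alpha> "max \<alpha> 1" "real n"] mult_right_mono[of 1 "max \<alpha> 1" "real n"]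
    by auto
  have row: "\<alpha> * real (f k) \<le> M" for k
  proof -
    have "real (f k) \<le> real n" using partition_row_le[OF f, of k] by linarith
    then show ?thesis using aM mult_left_mono[of "real (f k)" "real n" \<alpha>] \<alpha> range by linarith
  qed
  show "\<bar>corner f r / sd n\<bar> \<le> 2 * real n ^ 2" if r: "r < Suc n"
  proof -
    have "0 \<le> \<alpha> * real (f r)" using \<alpha> range by simp
    then have "\<bar>corner f r\<bar> \<le> M"
      using row[of r] aM r by (auto simp: corner_def abs_le_iff)
    also have "\<dots> \<le> 2 * real n * sd n" by (rule M)
    also have "\<dots> \<le> 2 * real n ^ 2 * sd n"
      using n1 sd by (intro mult_right_mono) (auto simp: power2_eq_square)
    finally show ?thesis using sd by (simp add: pos_divide_le_eq)
  qed
  have "\<bar>content_sum n f\<bar> \<le> (\<Sum>k<n. M * real (f k))"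
    unfolding content_sum_def
  proof (rule order_trans[OF sum_abs], rule sum_mono)
    fix k assume k: "k \<in> {..<n}"
    have "\<alpha> * (real (f k) * (real (f k) - 1) / 2) \<le> M * real (f k)"
    proof -
      have "\<alpha> * real (f k) * ((real (f k) - 1) / 2) \<le> \<alpha> * real (f k) * real (f k)"
        using \<alpha> range by (intro mult_left_mono) auto
      also have "\<dots> \<le> M * real (f k)" using row by (intro mult_right_mono) auto
      finally show ?thesis by simp
    qed
    moreover have "0 \<le> \<alpha> * (real (f k) * (real (f k) - 1) / 2)"
      using \<alpha> range by (cases "f k") auto
    moreover have "real k * real (f k) \<le> M * real (f k)"
      using k aM by (intro mult_right_mono) auto
    moreover have "0 \<le> real k * real (f k)" by simp
    ultimately show "\<bar>\<alpha> * (real (f k) * (real (f k) - 1) / 2) - real k * real (f k)\<bar> \<le> M * real (f k)"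
      by linarith
  qed
  also have "\<dots> = M * real (\<Sum>k<n. f k)" by (simp add: sum_distrib_left)
  also have "(\<Sum>k<n. f k) = n - 1" using partition_sum[OF f] by simp
  also have "M * real (n - 1) \<le> M * real n"
    using aM n1 by (intro mult_left_mono) auto
  also have "\<dots> \<le> 2 * real n * sd n * real n"
    by (intro mult_right_mono M) auto
  finally show "\<bar>content_sum n f / sd n\<bar> \<le> 2 * real n ^ 2"
    using sd by (simp add: pos_divide_le_eq power2_eq_square mult_ac)
qed

text \<open>On the good event the rows and columns are at most \<open>\<kappa> = exp (s + 1)\<close> times their typical order, so
  that contents are at most \<open>\<kappa> sqrt (\<alpha> n)\<close>. The tail \<open>2 n\<^bsup>3 - 2s\<^esup>\<close> has to beat
  \<open>K\<^bsup>q\<^esup> = 4\<^bsup>q\<^esup> n\<^bsup>2q\<^esup>\<close>, which \<open>s = 2 q + 2\<close> achieves; the factor \<open>4\<^bsup>q\<^esup> \<le> \<kappa>\<close> is absorbed by \<delta>.\<close>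

lemma stein_step_bounded_jack:
  assumes range: "(ln (real n))\<^sup>2 / real n \<le> \<alpha>" "\<alpha> \<le> real n / (ln (real n))\<^sup>2" and n: "3 \<le> n"
    and s: "s = 2 * q + 2"
  shows "stein_step_bounded (partitions (n - 1)) {..<Suc n} (mass (n - 1)) (up n)
           (\<lambda>f. content_sum n f / sd n) (\<lambda>f r. corner f r / sd n) (2 / real n)
           (long_line s n) (2 * exp (real s + 1) / sqrt (real n)) (2 * exp (real s + 1)) (4 * real n ^ 2) q"
proof -
  note tail = long_rows_or_cols_unlikely[OF range n diff_le_self[of n 1]]
  have \<alpha>n: "\<alpha> \<le> real n" and \<alpha>i: "1 / \<alpha> \<le> real n"
    by (rule tail(2-3))+
  define \<kappa> where "\<kappa> = exp (real s + 1)"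
  have \<kappa>: "1 \<le> \<kappa>" by (simp add: \<kappa>_def)
  have n1: "1 \<le> real n" using n by simp
  have sq: "1 \<le> sqrt (real n)" "sqrt (real n) \<le> real n"
    using n1 by (auto simp: real_le_lsqrt power2_eq_square)
  interpret stein_step "partitions (n - 1)" "{..<Suc n}" "mass (n - 1)" "up n"
      "\<lambda>f. content_sum n f / sd n" "\<lambda>f r. corner f r / sd n" "2 / real n"
    by (rule stein_step_jack[OF n])
  have sd: "0 < sd n" by (rule sd_ge(3)[OF n])
  show ?thesis
    unfolding \<kappa>_def[symmetric]
  proof
    fix f r
    assume f: "f \<in> partitions (n - 1) - long_line s n" and r: "r \<in> {..<Suc n}" "up n f r \<noteq> 0"
    have fp: "f \<in> partitions (n - 1)" and f0: "real (f 0) \<le> \<kappa> * sqrt (real n / \<alpha>)"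
      and c0: "real (col f 0) \<le> \<kappa> * sqrt (\<alpha> * real n)" using f by (auto simp: long_line_def \<kappa>_def)
    have add: "addable f r" using up_not_addable[OF fp, of r n] r by auto
    have "r \<le> col f 0"
    proof (cases r)
      case (Suc k)
      then have "k < col f 0" using add less_col_iff[OF fp, of k 0] by (auto simp: addable_def)
      then show ?thesis using Suc by simp
    qed simp
    then have "real r \<le> \<kappa> * sqrt (\<alpha> * real n)" using c0 by linarith
    moreover have "\<alpha> * real (f r) \<le> \<kappa> * sqrt (\<alpha> * real n)"
    proof -
      have "\<alpha> * real (f r) \<le> \<alpha> * real (f 0)"
        using row_antimono[OF fp, of 0 r] \<alpha> by (intro mult_left_mono) auto
      also have "\<dots> \<le> \<alpha> * (\<kappa> * sqrt (real n / \<alpha>))"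
        using f0 \<alpha> by (intro mult_left_mono) auto
      also have "\<dots> = \<kappa> * sqrt (\<alpha> * real n)"
        using \<alpha> by (simp add: real_sqrt_mult real_sqrt_divide real_div_sqrt field_simps)
      finally show ?thesis .
    qed
    moreover have "0 \<le> \<alpha> * real (f r)" using \<alpha> by simp
    ultimately have "\<bar>corner f r\<bar> \<le> \<kappa> * sqrt (\<alpha> * real n)"
      by (simp add: corner_def abs_le_iff)
    also have "\<dots> = 2 * \<kappa> / sqrt (real n) * (sqrt (\<alpha> * real n) * sqrt (real n) / 2)"
      using n1 by simp
    also have "\<dots> \<le> 2 * \<kappa> / sqrt (real n) * sd n"
      using \<kappa> by (intro mult_left_mono sd_ge(1)[OF n]) auto
    finally show "\<bar>corner f r / sd n\<bar> \<le> 2 * \<kappa> / sqrt (real n)"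
      using sd by (simp add: pos_divide_le_eq)
  next
    fix f assume f: "f \<in> partitions (n - 1)"
    show "\<bar>content_sum n f / sd n\<bar> \<le> 4 * real n ^ 2 / 2"
      using content_bounds(2)[OF \<alpha>n \<alpha>i n f] by simp
    fix r assume "r \<in> {..<Suc n}"
    then show "\<bar>corner f r / sd n\<bar> \<le> 4 * real n ^ 2 / 2"
      using content_bounds(1)[OF \<alpha>n \<alpha>i n f, of r] by simp
  next
    have n2: "1 \<le> real n ^ 2" using n1 by simp
    then show "1 \<le> 4 * real n ^ 2" by linarith
    have "4 * real n ^ 2 * (2 / real n) = 8 * real n" by (simp add: power2_eq_square)
    then show "1 \<le> 4 * real n ^ 2 * (2 / real n)" using n1 by linarith
    show "0 < 2 * \<kappa> / sqrt (real n)" using \<kappa> n1 by simp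
    show "2 * \<kappa> / sqrt (real n) \<le> 2 * \<kappa>"
      using \<kappa> sq by (simp add: pos_divide_le_eq)
    have low: "1 / real n \<le> 1 / sqrt (real n)" using sq n1 by (intro divide_left_mono) auto
    have "1 \<le> \<kappa> * real n * 8" using mult_mono[OF \<kappa> n1] \<kappa> by auto
    also have "\<dots> = 2 * \<kappa> * (1 / real n) * (4 * real n ^ 2)" using n1 by (simp add: power2_eq_square)
    also have "\<dots> \<le> 2 * \<kappa> * (1 / sqrt (real n)) * (4 * real n ^ 2)"
      using low \<kappa> by (intro mult_right_mono mult_left_mono) auto
    finally show "1 \<le> 2 * \<kappa> / sqrt (real n) * (4 * real n ^ 2)" by simp
    have "sum (mass (n - 1)) (partitions (n - 1) \<inter> long_line s n) * (4 * real n ^ 2) ^ q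
        \<le> 2 * real n ^ 3 / real n ^ (2 * s) * (4 * real n ^ 2) ^ q"
      using tail(1)[of s] by (intro mult_right_mono) simp_all
    also have "\<dots> = 2 * 4 ^ q * (real n ^ (2 * q + 3) / real n ^ (2 * s))"
      by (simp add: power_mult_distrib power_add power_mult[symmetric])
    also have "\<dots> \<le> 2 * \<kappa> * (1 / real n)"
    proof (rule mult_mono)
      have "(4::real) ^ q \<le> (exp 1 ^ 2) ^ q"
      proof (rule power_mono)
        have "(2::real) \<le> exp 1" using exp_ge_add_one_self[of 1] by simp
        then have "(2::real) ^ 2 \<le> exp 1 ^ 2" by (rule power_mono) simp
        then show "(4::real) \<le> exp 1 ^ 2" by simp
      qed simp
      also have "\<dots> = exp (real (2 * q))"
        by (simp add: power_mult[symmetric] exp_of_nat_mult[symmetric])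
      also have "\<dots> \<le> \<kappa>" by (simp add: \<kappa>_def s)
      finally show "2 * 4 ^ q \<le> 2 * \<kappa>" by simp
      have "real n ^ (2 * q + 3) * real n \<le> real n ^ (2 * s)"
        using power_increasing[OF _ n1, of "2 * q + 4" "2 * s"] s by (simp add: power_add mult_ac numeral_eq_Suc)
      then show "real n ^ (2 * q + 3) / real n ^ (2 * s) \<le> 1 / real n"
        using n1 by (simp add: field_simps)
    qed (use \<kappa> in auto)
    also have "\<dots> \<le> 2 * \<kappa> * (1 / sqrt (real n))"
      using low \<kappa> by (intro mult_left_mono) auto
    finally show "sum (mass (n - 1)) (partitions (n - 1) \<inter> long_line s n) * (4 * real n ^ 2) ^ q
        \<le> 2 * \<kappa> / sqrt (real n)"
      by simp
  qed
qed

end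

text \<open>The statistic is \<open>V + T\<close> for the growth step, so the Berry--Esseen bound applies with any even
  exponent \<open>2 i \<ge> p\<close>. The constants q, s and \<Delta> depend on i only.\<close>

theorem theorem3p2:
  shows "\<forall>p::real. p \<ge> 2 \<longrightarrow>
    (\<exists>C::real. \<forall>n::nat. n \<ge> 3 \<longrightarrow>
      (\<forall>\<alpha>::real. (ln (real n))\<^sup>2 / real n \<le> \<alpha> \<and> \<alpha> \<le> real n / (ln (real n))\<^sup>2 \<longrightarrow>
        (\<forall>z::real.
          \<bar>\<P>(lam in jack_measure \<alpha> n. W_stat n \<alpha> lam \<le> z) - cdf std_normal_distribution z\<bar>
            \<le> C / ((1 + \<bar>z\<bar>) powr p * sqrt (real n)))))"
proof (intro allI impI)
  fix p :: real assume "2 \<le> p"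
  define i where "i = nat \<lceil>p\<rceil>"
  define q where "q = 2 * i + 3"
  define s where "s = 2 * q + 2"
  define \<Delta> where "\<Delta> = 2 * exp (real s + 1)"
  define C where "C = berry_esseen_const \<Delta> i * \<Delta>"
  have pi: "p \<le> real (2 * i)" using \<open>2 \<le> p\<close> by (simp add: i_def) linarith
  show "\<exists>C::real. \<forall>n::nat. n \<ge> 3 \<longrightarrow>
      (\<forall>\<alpha>::real. (ln (real n))\<^sup>2 / real n \<le> \<alpha> \<and> \<alpha> \<le> real n / (ln (real n))\<^sup>2 \<longrightarrow>
        (\<forall>z::real.
          \<bar>\<P>(lam in jack_measure \<alpha> n. W_stat n \<alpha> lam \<le> z) - cdf std_normal_distribution z\<bar>
            \<le> C / ((1 + \<bar>z\<bar>) powr p * sqrt (real n))))"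
  proof (intro exI[of _ C] allI impI)
    fix n :: nat and \<alpha> z :: real
    assume n: "3 \<le> n" and \<alpha>: "(ln (real n))\<^sup>2 / real n \<le> \<alpha> \<and> \<alpha> \<le> real n / (ln (real n))\<^sup>2"
    note \<alpha>1 = \<alpha>[THEN conjunct1] and \<alpha>2 = \<alpha>[THEN conjunct2]
    have "0 < (ln (real n))\<^sup>2 / real n" using n by simp
    then interpret jack \<alpha> by unfold_locales (use \<alpha>1 in linarith)
    interpret stein_step_bounded "partitions (n - 1)" "{..<Suc n}" "mass (n - 1)" "up n"
      "\<lambda>f. content_sum n f / sd n" "\<lambda>f r. corner f r / sd n" "2 / real n"
      "long_line s n"
      "2 * exp (real s + 1) / sqrt (real n)" "2 * exp (real s + 1)" "4 * real n ^ 2" q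
      by (rule stein_step_bounded_jack[OF \<alpha>1 \<alpha>2 n s_def])
    have "distribution z = (\<Sum>f\<in>partitions (n - 1). mass (n - 1) f * (\<Sum>r<Suc n. up n f r
          * (if (content_sum n f + corner f r) / sd n \<le> z then 1 else 0)))"
      by (simp only: distribution_def E_def add_divide_distrib)
    also have "\<dots> = (\<Sum>g\<in>partitions n. mass n g
          * (if content_sum n g / sd n \<le> z then 1 else 0))"
      using growth_law[of "n - 1" n "\<lambda>x. if x / sd n \<le> z then 1 else 0"] n
      by (simp del: sum.lessThan_Suc)
    also have "\<dots> = \<P>(lam in jack_measure \<alpha> n. W_stat n \<alpha> lam \<le> z)"
      unfolding jack_measure_prob sd_def ..
    finally have eq: "distribution z = \<P>(lam in jack_measure \<alpha> n. W_stat n \<alpha> lam \<le> z)" .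
    define Z where "Z = (1 + \<bar>z\<bar>) ^ (2 * i)"
    have Z: "0 < Z" by (simp add: Z_def add_pos_nonneg)
    have n0: "0 < sqrt (real n)" using n by simp
    have "\<bar>distribution z - gauss_cdf z\<bar> \<le> berry_esseen_const \<Delta> i * (\<Delta> / sqrt (real n)) / Z"
      using nonuniform_berry_esseen[OF q_def, of z] by (simp only: \<Delta>_def Z_def)
    also have "\<dots> = C / sqrt (real n) / Z" by (simp add: C_def)
    finally have bound: "\<bar>distribution z - gauss_cdf z\<bar> \<le> C / sqrt (real n) / Z" .
    then have "0 \<le> C / sqrt (real n) / Z" by linarith
    then have "0 \<le> C / sqrt (real n) / Z * Z" using Z by (intro mult_nonneg_nonneg) auto
    then have C0: "0 \<le> C / sqrt (real n)" using Z by simp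
    have "(1 + \<bar>z\<bar>) powr p \<le> (1 + \<bar>z\<bar>) powr real (2 * i)"
      using pi by (intro powr_mono) auto
    also have "\<dots> = Z" unfolding Z_def by (rule powr_realpow) simp
    finally have "C / sqrt (real n) / Z \<le> C / sqrt (real n) / (1 + \<bar>z\<bar>) powr p"
      using C0 Z by (intro divide_left_mono) auto
    then show "\<bar>\<P>(lam in jack_measure \<alpha> n. W_stat n \<alpha> lam \<le> z) - cdf std_normal_distribution z\<bar>
        \<le> C / ((1 + \<bar>z\<bar>) powr p * sqrt (real n))"
      using bound unfolding eq by (simp add: mult.commute)
  qed
qed

end
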